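(* Consider the setting, the system of inclusions (S), and its solution set $\Omega$ given in the context. Suppose that $\Omega\neq\varnothing$ and that $$\beta=\nu_0+\sqrt{\sum_{i=1}^m\sum_{k=1}^s\|N_kL_{k,i}\|^2+\max_{1\le k\le s}\big(\|N_k\|^2+\|M_k\|^2\big)}>0.$$ For every $i\in\{1,\dots,m\}$, let $(a^i_{1,1,n})_{n\in\mathbb N},(b^i_{1,1,n})_{n\in\mathbb N},(c^i_{1,1,n})_{n\in\mathbb N}$ be absolutely summable sequences in $\mathcal H_i$; for every $k\in\{1,\dots,s\}$, let $(a^k_{1,2,n})_{n\in\mathbb N},(c^k_{1,2,n})_{n\in\mathbb N}$ be absolutely summable sequences in $\mathcal G_k$, let $(a^k_{2,1,n})_{n\in\mathbb N},(b^k_{2,1,n})_{n\in\mathbb N},(c^k_{2,1,n})_{n\in\mathbb N}$ be absolutely summable sequences in $\mathcal X_k$, and let $(a^k_{2,2,n})_{n\in\mathbb N},(b^k_{2,2,n})_{n\in\mathbb N},(c^k_{2,2,n})_{n\in\mathbb N}$ be absolutely summable sequences in $\mathcal Y_k$. For every $i\in\{1,\dots,m\}$ and $k\in\{1,\dots,s\}$, let $x^i_{1,0}\in\mathcal H_i$, $x^k_{2,0}\in\mathcal G_k$, $v^k_{1,0}\in\mathcal X_k$, $v^k_{2,0}\in\mathcal Y_k$. Let $\varepsilon\in\,]0,1/(\beta+1)[$, let $(\gamma_n)_{n\in\mathbb N}$ be a sequence in $[\varepsilon,(1-\varepsilon)/\beta]$, and for $n=0,1,\dots$ iterate as follows. For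 $i=1,\dots,m$: $$\begin{aligned} s^i_{1,1,n}&=x^i_{1,n}-\gamma_n\Big(C_i(x^1_{1,n},\dots,x^m_{1,n})+\sum_{k=1}^sL_{k,i}^*N_k^*v^k_{1,n}+a^i_{1,1,n}\Big),\\ p^i_{1,1,n}&=J_{\gamma_nA_i}(s^i_{1,1,n}+\gamma_nz_i)+b^i_{1,1,n}. \end{aligned}$$ For $k=1,\dots,s$: $$\begin{aligned} p^k_{1,2,n}&=x^k_{2,n}+\gamma_n\big(N_k^*v^k_{1,n}-M_k^*v^k_{2,n}+a^k_{1,2,n}\big),\\ s^k_{2,1,n}&=v^k_{1,n}+\gamma_n\Big(\sum_{i=1}^mN_kL_{k,i}x^i_{1,n}-N_kx^k_{2,n}+a^k_{2,1,n}\Big),\\ p^k_{2,1,n}&=s^k_{2,1,n}-\gamma_n\Big(N_kr_k+J_{\gamma_n^{-1}D_k}\big(\gamma_n^{-1}s^k_{2,1,n}-N_kr_k\big)+b^k_{2,1,n}\Big),\\ q^k_{2,1,n}&=p^k_{2,1,n}+\gamma_n\Big(N_k\sum_{i=1}^mL_{k,i}p^i_{1,1,n}-N_kp^k_{1,2,n}+c^k_{2,1,n}\Big),\\ v^k_{1,n+1}&=v^k_{1,n}-s^k_{2,1,n}+q^k_{2,1,n},\\ s^k_{2,2,n}&=v^k_{2,n}+\gamma_n\big(M_kx^k_{2,n}+a^k_{2,2,n}\big),\\ p^k_{2,2,n}&=s^k_{2,2,n}-\gamma_n\Big(J_{\gamma_n^{-1}B_k}\big(\gamma_n^{-1}s^k_{2,2,n}\big)+b^k_{2,2,n}\Big),\\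 q^k_{2,2,n}&=p^k_{2,2,n}+\gamma_n\big(M_kp^k_{1,2,n}+c^k_{2,2,n}\big),\\ v^k_{2,n+1}&=v^k_{2,n}-s^k_{2,2,n}+q^k_{2,2,n},\\ q^k_{1,2,n}&=p^k_{1,2,n}+\gamma_n\big(N_k^*p^k_{2,1,n}-M_k^*p^k_{2,2,n}+c^k_{1,2,n}\big),\\ x^k_{2,n+1}&=x^k_{2,n}-p^k_{1,2,n}+q^k_{1,2,n}. \end{aligned}$$ For $i=1,\dots,m$: $$\begin{aligned} q^i_{1,1,n}&=p^i_{1,1,n}-\gamma_n\Big(C_i(p^1_{1,1,n},\dots,p^m_{1,1,n})+\sum_{k=1}^sL_{k,i}^*N_k^*p^k_{2,1,n}+c^i_{1,1,n}\Big),\\ x^i_{1,n+1}&=x^i_{1,n}-s^i_{1,1,n}+q^i_{1,1,n}. \end{aligned}$$ Then the following hold for each $i\in\{1,\dots,m\}$ and $k\in\{1,\dots,s\}$. (i) $\sum_{n\in\mathbb N}\|x^i_{1,n}-p^i_{1,1,n}\|^2<+\infty$ and $\sum_{n\in\mathbb N}\|x^k_{2,n}-p^k_{1,2,n}\|^2<+\infty$. (ii) $\sum_{n\in\mathbb N}\|v^k_{1,n}-p^k_{2,1,n}\|^2<+\infty$ and $\sum_{n\in\mathbb N}\|v^k_{2,n}-p^k_{2,2,n}\|^2<+\infty$. (iii) There exist points $\overline x_{1,i}\in\mathcal H_i$, $\overline v_{1,k}\in\mathcal X_k$, $\overline v_{2,k}\in\mathcal Y_k$ ($1\le i\le m$,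 $1\le k\le s$) such that $x^i_{1,n}\rightharpoonup\overline x_{1,i}$, $v^k_{1,n}\rightharpoonup\overline v_{1,k}$, $v^k_{2,n}\rightharpoonup\overline v_{2,k}$, $M_k^*\overline v_{2,k}=N_k^*\overline v_{1,k}$, and $(\overline x_{1,1},\dots,\overline x_{1,m},N_1^*\overline v_{1,1},\dots,N_s^*\overline v_{1,s})\in\Omega$. Moreover, with the limits $\overline x_{1,i},\overline v_{1,k},\overline v_{2,k}$ of (iii): (iv) If $A_j$ is uniformly monotone at $\overline x_{1,j}$ for some $j\in\{1,\dots,m\}$, then $x^j_{1,n}\to\overline x_{1,j}$. (v) If the operator $(x_i)_{1\le i\le m}\mapsto\big(C_j(x_1,\dots,x_m)\big)_{1\le j\le m}$ is uniformly monotone at $(\overline x_{1,1},\dots,\overline x_{1,m})$, then $x^i_{1,n}\to\overline x_{1,i}$ for every $i\in\{1,\dots,m\}$. (vi) If there exist $j\in\{1,\dots,m\}$ and an increasing function $\phi_j\colon[0,+\infty[\to[0,+\infty]$ vanishing only at $0$ such that for all $(x_i)_{1\le i\le m}\in\mathcal H_1\times\dots\times\mathcal H_m$ $$\sum_{i=1}^m\big\langle C_i(x_1,\dots,x_m)-C_i(\overline x_{1,1},\dots,\overline x_{1,m})\mid x_i-\overline x_{1,i}\big\rangle\ge\phi_j(\|x_j-\overline x_{1,j}\|),$$ then $x^j_{1,n}\to\overline x_{1,j}$. (vii) If $D_j^{-1}$ is uniformly monotone at $\overline v_{1,j}$ for some $j\in\{1,\dots,s\}$, then $v^j_{1,n}\to\overline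 v_{1,j}$. (viii) If $B_j^{-1}$ is uniformly monotone at $\overline v_{2,j}$ for some $j\in\{1,\dots,s\}$, then $v^j_{2,n}\to\overline v_{2,j}$.
   Context: **Setting.** Let $m,s$ be strictly positive integers. For every $i\in\{1,\dots,m\}$, let $\mathcal H_i$ be a real Hilbert space, $z_i\in\mathcal H_i$, let $A_i\colon\mathcal H_i\to2^{\mathcal H_i}$ be maximally monotone, and let $C_i\colon\mathcal H_1\times\dots\times\mathcal H_m\to\mathcal H_i$. There is $\nu_0\in[0,+\infty[$ such that for all $(x_i)_{1\le i\le m}$ and $(y_i)_{1\le i\le m}$ in $\mathcal H_1\times\dots\times\mathcal H_m$ $$\sum_{i=1}^m\|C_i(x_1,\dots,x_m)-C_i(y_1,\dots,y_m)\|^2\le\nu_0^2\sum_{i=1}^m\|x_i-y_i\|^2,$$ $$\sum_{i=1}^m\langle C_i(x_1,\dots,x_m)-C_i(y_1,\dots,y_m)\mid x_i-y_i\rangle\ge0;$$ this $\nu_0$ is fixed. For every $k\in\{1,\dots,s\}$, let $\mathcal G_k,\mathcal Y_k,\mathcal X_k$ be real Hilbert spaces, $r_k\in\mathcal G_k$, let $B_k\colon\mathcal Y_k\to2^{\mathcal Y_k}$ and $D_k\colon\mathcal X_k\to2^{\mathcal X_k}$ be maximally monotone, let $M_k\colon\mathcal G_k\to\mathcal Y_k$ and $N_k\colon\mathcal G_k\to\mathcal X_k$ be bounded linear operators, and for every $i\in\{1,\dots,m\}$ let $L_{k,i}\colon\mathcal H_i\to\mathcal G_k$ be a bounded linear operator.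 **System (S).** Find $\overline x_1\in\mathcal H_1,\dots,\overline x_m\in\mathcal H_m$ and $\overline v_1\in\mathcal G_1,\dots,\overline v_s\in\mathcal G_s$ such that $$z_i-\sum_{k=1}^sL_{k,i}^*\overline v_k\in A_i\overline x_i+C_i(\overline x_1,\dots,\overline x_m)\quad\text{for every } i\in\{1,\dots,m\},$$ $$\sum_{i=1}^mL_{k,i}\overline x_i-r_k\in(M_k^*\circ B_k\circ M_k)^{-1}\overline v_k+(N_k^*\circ D_k\circ N_k)^{-1}\overline v_k\quad\text{for every } k\in\{1,\dots,s\}.$$ $\Omega$ denotes the set of solutions $(\overline x_1,\dots,\overline x_m,\overline v_1,\dots,\overline v_s)$ of (S). **Notation.** For $A\colon\mathcal H\to2^{\mathcal H}$, $\operatorname{gra}A=\{(x,u)\mid u\in Ax\}$, $\operatorname{dom}A=\{x\mid Ax\ne\varnothing\}$, $A^{-1}u=\{x\mid u\in Ax\}$; $A$ is monotone if $\langle x-y\mid u-v\rangle\ge0$ for all $(x,u),(y,v)\in\operatorname{gra}A$, and maximally monotone if in addition no monotone operator has a graph properly containing $\operatorname{gra}A$. $J_A=(\mathrm{Id}+A)^{-1}$ is the resolvent. $A$ is uniformly monotone at $x\in\operatorname{dom}A$ if there is an increasing function $\phi\colon[0,+\infty[\to[0,+\infty]$ vanishing only at $0$ such that $\langle x-y\mid u-v\rangle\ge\phi(\|x-y\|)$ for all $u\in Ax$ and all $(y,v)\in\operatorname{gra}A$. $L^*$ is the adjoint of $L$; $\rightharpoonup$ and $\to$ denote weak and strong convergence.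 A sequence $(a_n)$ is absolutely summable if $\sum_n\|a_n\|<+\infty$. The product $\mathcal H_1\times\dots\times\mathcal H_m$ carries the Hilbert direct sum structure $\langle x\mid y\rangle=\sum_i\langle x_i\mid y_i\rangle$. *)

theory Defs
  imports "HOL-Analysis.Analysis" "HOL-Library.Set_Algebras" "HOL-Library.Extended_Real"
begin

text \<open>
  A family of possibly different real Hilbert spaces indexed by a finite type is represented
  by a family of closed linear subspaces of one complete real inner product space.
  This loses no generality: every such family embeds isometrically in its Hilbert direct sum.
  Maps between members of such families are total functions on the ambient types of which
  only the values on the subspaces matter. Hence operator norms, adjoints, maximality and weak
  convergence below are taken relative to the subspace.
  A set-valued operator on a subspace \<open>H\<close> is a function \<open>A\<close> with \<open>gra A \<subseteq> H \<times> H\<close>, so that it is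
  empty-valued outside \<open>H\<close>.
\<close>

definition gra :: "('a \<Rightarrow> 'b set) \<Rightarrow> ('a \<times> 'b) set"
  where "gra A = {(x, u). u \<in> A x}"

definition op_dom :: "('a \<Rightarrow> 'b set) \<Rightarrow> 'a set"
  where "op_dom A = {x. A x \<noteq> {}}"

definition op_inv :: "('a \<Rightarrow> 'b set) \<Rightarrow> 'b \<Rightarrow> 'a set"
  where "op_inv A u = {x. u \<in> A x}"

definition op_scale :: "real \<Rightarrow> ('a \<Rightarrow> 'b::real_vector set) \<Rightarrow> 'a \<Rightarrow> 'b set"
  where "op_scale c A x = (\<lambda>u. c *\<^sub>R u) ` A x"

definition single_valued_op :: "'a set \<Rightarrow> ('a \<Rightarrow> 'b) \<Rightarrow> 'a \<Rightarrow> 'b set"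
  where "single_valued_op H T x = (if x \<in> H then {T x} else {})"

definition monotone_op :: "('a::real_inner \<Rightarrow> 'a set) \<Rightarrow> bool"
  where "monotone_op A \<longleftrightarrow>
    (\<forall>(x, u) \<in> gra A. \<forall>(y, v) \<in> gra A. (x - y) \<bullet> (u - v) \<ge> 0)"

definition maximally_monotone_on :: "'a::real_inner set \<Rightarrow> ('a \<Rightarrow> 'a set) \<Rightarrow> bool"
  where "maximally_monotone_on H A \<longleftrightarrow>
    gra A \<subseteq> H \<times> H \<and> monotone_op A \<and>
    \<not> (\<exists>B. gra B \<subseteq> H \<times> H \<and> monotone_op B \<and> gra A \<subset> gra B)"

text \<open>
  The addition in \<open>{p} + A p\<close> is the Minkowski sum. For \<open>A\<close> maximally monotone on a Hilbert
  space \<open>H\<close> and \<open>x \<in> H\<close> the set \<open>(Id + A)\<^sup>-\<^sup>1 x\<close> is a singleton (Minty),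
  and the resolvent is its element.
\<close>

definition resolvent :: "('a::real_vector \<Rightarrow> 'a set) \<Rightarrow> 'a \<Rightarrow> 'a"
  where "resolvent A x = (THE p. p \<in> op_inv (\<lambda>p. {p} + A p) x)"

text \<open>
  ``Increasing'' is meant in the non-strict sense; only the values of \<open>\<phi>\<close> on \<open>[0, \<infinity>[\<close> matter.
\<close>

definition uniform_modulus :: "(real \<Rightarrow> ereal) \<Rightarrow> bool"
  where "uniform_modulus \<phi> \<longleftrightarrow>
    (\<forall>t\<ge>0. \<phi> t \<ge> 0) \<and> mono_on {0..} \<phi> \<and> (\<forall>t\<ge>0. \<phi> t = 0 \<longleftrightarrow> t = 0)"

definition uniformly_monotone_at :: "('a::real_inner \<Rightarrow> 'a set) \<Rightarrow> 'a \<Rightarrow> bool"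
  where "uniformly_monotone_at A x \<longleftrightarrow>
    x \<in> op_dom A \<and>
    (\<exists>\<phi>. uniform_modulus \<phi> \<and>
      (\<forall>u \<in> A x. \<forall>(y, v) \<in> gra A. ereal ((x - y) \<bullet> (u - v)) \<ge> \<phi> (norm (x - y))))"

definition bounded_linear_on ::
    "'a::real_normed_vector set \<Rightarrow> 'b::real_normed_vector set \<Rightarrow> ('a \<Rightarrow> 'b) \<Rightarrow> bool"
  where "bounded_linear_on H G L \<longleftrightarrow>
    (\<forall>x\<in>H. L x \<in> G) \<and>
    (\<forall>x\<in>H. \<forall>y\<in>H. L (x + y) = L x + L y) \<and>
    (\<forall>c. \<forall>x\<in>H. L (c *\<^sub>R x) = c *\<^sub>R L x) \<and>
    (\<exists>K. \<forall>x\<in>H. norm (L x) \<le> K * norm x)"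

text \<open>Operator norm on \<open>H\<close>; on the whole type it is \<^const>\<open>onorm\<close>.\<close>

definition onorm_on :: "'a::real_normed_vector set \<Rightarrow> ('a \<Rightarrow> 'b::real_normed_vector) \<Rightarrow> real"
  where "onorm_on H L = (SUP x\<in>H. norm (L x) / norm x)"

text \<open>Adjoint of a bounded linear operator \<open>L\<close> on the Hilbert space \<open>H\<close>, with values in \<open>H\<close>.\<close>

definition adjoint_on :: "'a::real_inner set \<Rightarrow> ('a \<Rightarrow> 'b::real_inner) \<Rightarrow> 'b \<Rightarrow> 'a"
  where "adjoint_on H L y = (THE w. w \<in> H \<and> (\<forall>x\<in>H. L x \<bullet> y = x \<bullet> w))"

text \<open>The set-valued operator \<open>M\<^sup>* \<circ> B \<circ> M\<close> on \<open>G\<close>, where \<open>M\<close> is defined on \<open>G\<close>.\<close>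

definition adjoint_sandwich ::
    "'a::real_inner set \<Rightarrow> ('a \<Rightarrow> 'b::real_inner) \<Rightarrow> ('b \<Rightarrow> 'b set) \<Rightarrow> 'a \<Rightarrow> 'a set"
  where "adjoint_sandwich G M B x = (if x \<in> G then adjoint_on G M ` B (M x) else {})"

definition weakly_converges_in :: "'a::real_inner set \<Rightarrow> (nat \<Rightarrow> 'a) \<Rightarrow> 'a \<Rightarrow> bool"
  where "weakly_converges_in H X x \<longleftrightarrow>
    x \<in> H \<and> (\<forall>u\<in>H. (\<lambda>n. X n \<bullet> u) \<longlonglongrightarrow> x \<bullet> u)"

definition abs_summable_in :: "'a::real_normed_vector set \<Rightarrow> (nat \<Rightarrow> 'a) \<Rightarrow> bool"
  where "abs_summable_in H a \<longleftrightarrow> (\<forall>n. a n \<in> H) \<and> summable (\<lambda>n. norm (a n))"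

text \<open>
  The product of the spaces \<open>H i\<close>; the inner product of the type \<^typ>\<open>'a ^ 'm\<close> is that of the
  Hilbert direct sum.
\<close>

definition prod_space :: "('m::finite \<Rightarrow> 'a set) \<Rightarrow> ('a ^ 'm) set"
  where "prod_space H = {x. \<forall>i. x $ i \<in> H i}"

definition solutions ::
  "('m::finite \<Rightarrow> 'h::real_inner set) \<Rightarrow> ('s::finite \<Rightarrow> 'g::real_inner set) \<Rightarrow>
   ('m \<Rightarrow> 'h) \<Rightarrow> ('m \<Rightarrow> 'h \<Rightarrow> 'h set) \<Rightarrow> ('m \<Rightarrow> 'h ^ 'm \<Rightarrow> 'h) \<Rightarrow> ('s \<Rightarrow> 'g) \<Rightarrow>
   ('s \<Rightarrow> 'y::real_inner \<Rightarrow> 'y set) \<Rightarrow> ('s \<Rightarrow> 'x::real_inner \<Rightarrow> 'x set) \<Rightarrow>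
   ('s \<Rightarrow> 'g \<Rightarrow> 'y) \<Rightarrow> ('s \<Rightarrow> 'g \<Rightarrow> 'x) \<Rightarrow> ('s \<Rightarrow> 'm \<Rightarrow> 'h \<Rightarrow> 'g) \<Rightarrow>
   (('h ^ 'm) \<times> ('s \<Rightarrow> 'g)) set"
  where "solutions H G z A C r B D M N L =
    {(x, v). x \<in> prod_space H \<and> (\<forall>k. v k \<in> G k) \<and>
      (\<forall>i. z i - (\<Sum>k\<in>UNIV. adjoint_on (H i) (L k i) (v k)) \<in> A i (x $ i) + {C i x}) \<and>
      (\<forall>k. (\<Sum>i\<in>UNIV. L k i (x $ i)) - r k \<in>
             op_inv (adjoint_sandwich (G k) (M k) (B k)) (v k) +
             op_inv (adjoint_sandwich (G k) (N k) (D k)) (v k))}"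

end

(*
  The system is the inclusion 0 : R w + Q w in a product Hilbert space: the auxiliary primal
  variable x2 splits the parallel sum of M* B M and N* D N, R is the product of the operators A_i,
  0, D_k^-1 and B_k^-1 (up to translations), and Q is the sum of C and of a skew linear map, hence
  monotone and beta-Lipschitz. The algorithm is Tseng's forward-backward-forward iteration for R
  and Q with summable errors. Without errors one step decreases the squared distance to every
  zero z by at least a multiple of the squared length of the proximal move, so with errors the
  iterates are quasi-Fejer monotone and these squares are summable. The inclusions produced by the
  steps have residuals tending to 0, and R + Q is maximally monotone, so that weak cluster points
  are zeros and Opial's lemma gives weak convergence. Pairing these inclusions with the one at
  the limit shows that every monotonicity gap tends to 0; where an operator is uniformly monotone
  this forces strong convergence.
*)

theory Submission
  imports Defs "HOL-Library.Diagonal_Subsequence"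
begin

section \<open>Weak convergence in Hilbert spaces\<close>

text \<open>The coupling inside \<open>Q\<close> is skew, so \<open>Q\<close> is in general not
  cocoercive and a plain forward-backward step need not converge; the second forward step asks only
  for monotonicity and a Lipschitz bound. Errors are handled by comparing each step with the exact
  step from the same point: resolvents are nonexpansive and \<gamma> \<beta> < 1, so the two differ
  by a summable amount and the descent estimate is needed for exact steps only. The dual updates
  evaluate resolvents of \<open>D k\<close> and \<open>B k\<close> with parameter 1/\<gamma> because
  Moreau's decomposition turns these into resolvents of the inverses. All Hilbert space facts are
  needed relative to closed subspaces. The Riesz and Minty theorems both come from minimizing
  |p|^2/2 + t over a closed convex set of pairs (p, t): the graph of a negated functional in one
  case, the epigraph of the Fitzpatrick function in the other.\<close>

lemma quadratic_minimizer:
  fixes E :: "('a::{real_inner, complete_space} \<times> real) set"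
  assumes "closed E" "convex E" "E \<noteq> {}"
    and lower: "\<And>p t. (p, t) \<in> E \<Longrightarrow> b \<le> p \<bullet> p / 2 + t"
  obtains p0 t0 where "(p0, t0) \<in> E" "\<And>p t. (p, t) \<in> E \<Longrightarrow> p0 \<bullet> (p - p0) + (t - t0) \<ge> 0"
proof -
  define V :: "'a \<times> real \<Rightarrow> real" where "V e = fst e \<bullet> fst e / 2 + snd e" for e
  define m where "m = Inf (V ` E)"
  have bdd: "bdd_below (V ` E)"
    using lower by (intro bdd_belowI[of _ b]) (auto simp: V_def)
  have m_le: "m \<le> V e" if "e \<in> E" for e
    unfolding m_def using bdd that by (intro cInf_lower) auto
  have "\<exists>e\<in>E. V e < m + 1 / real (Suc n)" for n
    using cInf_lessD[of "V ` E" "m + 1 / real (Suc n)"] assms(3) by (auto simp: m_def)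
  then obtain e where e: "\<And>n. e n \<in> E" "\<And>n. V (e n) < m + 1 / real (Suc n)"
    by metis
  have mid: "(1 - l) *\<^sub>R e1 + l *\<^sub>R e2 \<in> E" if "e1 \<in> E" "e2 \<in> E" "0 \<le> l" "l \<le> 1" for e1 e2 l
    using convexD[OF assms(2) that(1,2), of "1 - l" l] that by auto
  have V_comb: "V ((1 - l) *\<^sub>R e1 + l *\<^sub>R e2)
      = V e1 + l * (fst e1 \<bullet> (fst e2 - fst e1) + (snd e2 - snd e1))
        + l\<^sup>2 / 2 * ((fst e2 - fst e1) \<bullet> (fst e2 - fst e1))" for l e1 e2
    by (simp add: V_def inner_simps inner_commute algebra_simps power2_eq_square add_divide_distrib
        diff_divide_distrib)
  \<comment> \<open>At a midpoint the value falls below the mean of the two values by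
    |difference|^2/8, while no value lies below \<open>m\<close>; hence nearly minimal points have
    nearby first coordinates.\<close>
  have close: "(norm (fst (e k) - fst (e n)))\<^sup>2 \<le> 4 * (1 / real (Suc n) + 1 / real (Suc k))" for n k
  proof -
    have "m \<le> V ((1 - 1/2) *\<^sub>R e n + (1/2) *\<^sub>R e k)"
      by (intro m_le mid e) auto
    also have "\<dots> = (V (e n) + V (e k)) / 2 - (fst (e k) - fst (e n)) \<bullet> (fst (e k) - fst (e n)) / 8"
      unfolding V_comb
      by (simp add: V_def inner_simps inner_commute algebra_simps power2_eq_square add_divide_distrib
        diff_divide_distrib)
    finally show ?thesis
      unfolding power2_norm_eq_inner using e(2)[of n] e(2)[of k] by argo
  qed
  have "Cauchy (\<lambda>n. fst (e n))"
  proof (rule metric_CauchyI)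
    fix d :: real assume "0 < d"
    then obtain n0 where n0: "8 / d\<^sup>2 < real n0"
      using reals_Archimedean2 by blast
    have "dist (fst (e k)) (fst (e n)) < d" if "k \<ge> n0" "n \<ge> n0" for k n
    proof -
      have "1 / real (Suc n) \<le> 1 / real (Suc n0)" "1 / real (Suc k) \<le> 1 / real (Suc n0)"
        using that by (auto simp: divide_simps)
      then have "(norm (fst (e k) - fst (e n)))\<^sup>2 \<le> 8 / real (Suc n0)"
        using close[of k n] by simp
      also have "\<dots> < d\<^sup>2"
      proof -
        have "8 < real n0 * d\<^sup>2"
          using n0 \<open>0 < d\<close> by (simp add: pos_divide_less_eq)
        also have "\<dots> \<le> real (Suc n0) * d\<^sup>2"
          by (intro mult_right_mono) auto
        finally show ?thesis by (simp add: pos_divide_less_eq mult.commute)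
      qed
      finally show ?thesis
        using \<open>0 < d\<close> by (simp add: dist_norm power2_less_imp_less)
    qed
    then show "\<exists>n0. \<forall>k\<ge>n0. \<forall>n\<ge>n0. dist (fst (e k)) (fst (e n)) < d" by blast
  qed
  then obtain p0 where p0: "(\<lambda>n. fst (e n)) \<longlonglongrightarrow> p0"
    by (meson Cauchy_convergent convergent_def)
  have Vm: "(\<lambda>n. V (e n)) \<longlonglongrightarrow> m"
  proof (rule tendsto_sandwich[where f = "\<lambda>_. m" and h = "\<lambda>n. m + 1 / real (Suc n)"])
    show "(\<lambda>n. m + 1 / real (Suc n)) \<longlonglongrightarrow> m"
      using tendsto_add[OF tendsto_const LIMSEQ_Suc[OF lim_1_over_n]] by simp
  qed (use m_le e in \<open>auto intro!: always_eventually less_imp_le\<close>)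
  \<comment> \<open>Chosen so that \<open>V (p0, t0) = m\<close>. Since \<open>V\<close> is affine
    in the second coordinate, convergence of the values yields convergence of the second
    coordinates.\<close>
  define t0 where "t0 = m - p0 \<bullet> p0 / 2"
  have "(\<lambda>n. V (e n) - fst (e n) \<bullet> fst (e n) / 2) \<longlonglongrightarrow> t0"
    unfolding t0_def by (intro tendsto_intros Vm p0) auto
  then have "(\<lambda>n. snd (e n)) \<longlonglongrightarrow> t0"
    by (simp add: V_def)
  with p0 have "(\<lambda>n. (fst (e n), snd (e n))) \<longlonglongrightarrow> (p0, t0)"
    by (rule tendsto_Pair)
  then have E0: "(p0, t0) \<in> E"
    using closed_sequentially[OF assms(1)] e(1) by auto
  have "p0 \<bullet> (p - p0) + (t - t0) \<ge> 0" if "(p, t) \<in> E" for p t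
  proof -
    define c where "c = p0 \<bullet> (p - p0) + (t - t0)"
    define d where "d = (p - p0) \<bullet> (p - p0)"
    \<comment> \<open>First-order condition: moving a fraction \<open>l\<close> from the minimizer
      towards \<open>(p, t)\<close> cannot lower the value; the change is divided by
      \<open>l\<close>, and then \<open>l\<close> tends to 0.\<close>
    have *: "0 \<le> c + l / 2 * d" if l: "0 < l" "l \<le> 1" for l
    proof -
      have "m \<le> V ((1 - l) *\<^sub>R (p0, t0) + l *\<^sub>R (p, t))"
        using l by (intro m_le mid E0 \<open>(p, t) \<in> E\<close>) auto
      also have "\<dots> = m + l * (c + l / 2 * d)"
        unfolding V_comb c_def d_def by (simp add: V_def t0_def distrib_left power2_eq_square)
      finally show ?thesis
        using l by (simp add: zero_le_mult_iff)
    qed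
    have "((\<lambda>l. c + l / 2 * d) \<longlongrightarrow> c + 0 / 2 * d) (at_right 0)"
      by (intro tendsto_intros) auto
    moreover have "\<forall>\<^sub>F l in at_right 0. 0 \<le> c + l / 2 * d"
      using * by (auto simp: eventually_at_right_field intro!: exI[of _ 1])
    ultimately have "0 \<le> c + 0 / 2 * d"
      by (rule tendsto_lowerbound) auto
    then show ?thesis by (simp add: c_def)
  qed
  with E0 show ?thesis using that by blast
qed

text \<open>The minimizer of |p|^2/2 - f p represents \<open>f\<close>: its optimality condition
  holds in the directions \<open>q\<close> and \<open>- q\<close>, and linearity turns the two
  inequalities into an equation.\<close>

lemma riesz_on:
  fixes H :: "'a::{real_inner, complete_space} set" and f :: "'a \<Rightarrow> real"
  assumes H: "subspace H" "closed H" and f: "bounded_linear_on H UNIV f"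
  shows "\<exists>w\<in>H. \<forall>x\<in>H. f x = x \<bullet> w"
proof -
  have add: "f (x + y) = f x + f y" and scale: "f (c *\<^sub>R x) = c * f x" if "x \<in> H" "y \<in> H" for x y c
    using f that by (auto simp: bounded_linear_on_def)
  obtain K where K: "\<And>x. x \<in> H \<Longrightarrow> \<bar>f x\<bar> \<le> K * norm x"
    using f unfolding bounded_linear_on_def real_norm_def by blast
  have diff: "f (x - y) = f x - f y" if "x \<in> H" "y \<in> H" for x y
    using add[of x "- y"] scale[of y y "-1"] that H by (simp add: subspace_neg)
  define E where "E = {(p, t). p \<in> H \<and> t = - f p}"
  have "closed E"
    unfolding closed_sequential_limits
  proof (intro allI impI)
    fix e :: "nat \<Rightarrow> 'a \<times> real" and l assume "(\<forall>n. e n \<in> E) \<and> e \<longlonglongrightarrow> l"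
    then have e: "\<And>n. fst (e n) \<in> H" "\<And>n. snd (e n) = - f (fst (e n))" "e \<longlonglongrightarrow> l"
      by (auto simp: E_def split_beta)
    have l1: "(\<lambda>n. fst (e n)) \<longlonglongrightarrow> fst l" and l2: "(\<lambda>n. snd (e n)) \<longlonglongrightarrow> snd l"
      using e(3) by (auto intro: tendsto_intros)
    have lH: "fst l \<in> H"
      using closed_sequentially[OF H(2) _ l1] e by auto
    have "(\<lambda>n. f (fst (e n)) - f (fst l)) \<longlonglongrightarrow> 0"
    proof (rule Lim_null_comparison)
      show "\<forall>\<^sub>F n in sequentially. norm (f (fst (e n)) - f (fst l)) \<le> K * norm (fst (e n) - fst l)"
        using K[of "fst (e _) - fst l"] e(1) lH H
        by (auto simp: diff[symmetric] subspace_diff intro!: always_eventually)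
      show "(\<lambda>n. K * norm (fst (e n) - fst l)) \<longlonglongrightarrow> 0"
        using l1 by (auto intro!: tendsto_mult_right_zero simp: LIM_zero tendsto_norm_zero)
    qed
    then have "(\<lambda>n. f (fst (e n))) \<longlonglongrightarrow> f (fst l)"
      by (simp add: LIM_zero_iff)
    then have "(\<lambda>n. snd (e n)) \<longlonglongrightarrow> - f (fst l)"
      unfolding e(2) by (intro tendsto_intros)
    then have "snd l = - f (fst l)"
      using l2 LIMSEQ_unique by blast
    then show "l \<in> E" using lH by (auto simp: E_def split: prod.splits)
  qed
  moreover have "convex E"
    unfolding convex_def E_def
    using H by (auto simp: add scale subspace_add subspace_scale)
  moreover have "E \<noteq> {}"
    using subspace_0[OF H(1)] by (auto simp: E_def)
  \<comment> \<open>The lower bound comes from completing the square in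
    \<open>norm p - K\<close>.\<close>
  moreover have "- K\<^sup>2 / 2 \<le> p \<bullet> p / 2 + t" if "(p, t) \<in> E" for p t
  proof -
    have "t \<ge> - (K * norm p)" using that K[of p] by (auto simp: E_def)
    moreover have "(norm p - K)\<^sup>2 \<ge> 0" by simp
    ultimately show ?thesis
      by (simp add: power2_norm_eq_inner[symmetric] power2_eq_square algebra_simps)
  qed
  ultimately obtain w t where "(w, t) \<in> E"
    and opt: "\<And>p t'. (p, t') \<in> E \<Longrightarrow> w \<bullet> (p - w) + (t' - t) \<ge> 0"
    using quadratic_minimizer[of E] by metis
  then have w: "w \<in> H" "t = - f w" by (auto simp: E_def)
  have le: "w \<bullet> q - f q \<ge> 0" if "q \<in> H" for q
    using opt[of "w + q" "- f (w + q)"] that w H by (simp add: E_def add subspace_add)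
  have "f q = q \<bullet> w" if "q \<in> H" for q
    using le[of q] le[of "- q"] scale[of q q "-1"] that H by (simp add: subspace_neg inner_commute)
  with w show ?thesis by blast
qed

lemma projection_on:
  fixes V :: "'a::{real_inner, complete_space} set"
  assumes "subspace V" "closed V"
  obtains w where "w \<in> V" "\<And>x. x \<in> V \<Longrightarrow> x \<bullet> y = x \<bullet> w"
proof -
  have "bounded_linear_on V UNIV (\<lambda>x. x \<bullet> y)"
    unfolding bounded_linear_on_def
    by (auto simp: inner_simps intro!: exI[of _ "norm y"])
      (metis Cauchy_Schwarz_ineq2 mult.commute)
  then show ?thesis using riesz_on[OF assms] that by blast
qed

lemma weakly_convergent_subsequence:
  fixes X :: "nat \<Rightarrow> 'a::{real_inner, complete_space}"
  assumes K: "subspace K" "closed K" and XK: "\<And>n. X n \<in> K" and bnd: "\<And>n. norm (X n) \<le> R"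
  obtains r x where "strict_mono (r :: nat \<Rightarrow> nat)" "weakly_converges_in K (X \<circ> r) x"
proof -
  \<comment> \<open>Along a diagonal subsequence the inner products with every \<open>X j\<close> converge; the vectors with
    this property form a closed subspace, whose orthogonal complement is harmless.\<close>
  interpret subseqs "\<lambda>j r. convergent (\<lambda>n. X (r n) \<bullet> X j)"
  proof
    fix j and s :: "nat \<Rightarrow> nat" assume "strict_mono s"
    have "Bseq (\<lambda>n. X (s n) \<bullet> X j)"
    proof (rule BseqI')
      show "norm (X (s n) \<bullet> X j) \<le> R * norm (X j)" for n
        using Cauchy_Schwarz_ineq2[of "X (s n)" "X j"] bnd[of "s n"]
        by (simp add: mult_right_mono order_trans[of _ "norm (X (s n)) * norm (X j)"])
    qed
    then obtain r' where r': "strict_mono r'" "monoseq (\<lambda>n. X (s (r' n)) \<bullet> X j)"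
      using seq_monosub[of "\<lambda>n. X (s n) \<bullet> X j"] by (auto simp: o_def)
    have "Bseq (\<lambda>n. X (s (r' n)) \<bullet> X j)"
      using \<open>Bseq (\<lambda>n. X (s n) \<bullet> X j)\<close> unfolding Bseq_def by fast
    then show "\<exists>r'. strict_mono r' \<and> convergent (\<lambda>n. X ((s \<circ> r') n) \<bullet> X j)"
      using r' Bseq_monoseq_convergent by auto
  qed
  have seq_conv: "convergent (\<lambda>n. X ((diagseq \<circ> (+) (Suc j)) n) \<bullet> X j)" for j
  proof (rule diagseq_holds)
    fix j r s assume "strict_mono (r :: nat \<Rightarrow> nat)" "convergent (\<lambda>n. X (s n) \<bullet> X j)"
    then show "convergent (\<lambda>n. X ((s \<circ> r) n) \<bullet> X j)"
      using convergent_subseq_convergent[of "\<lambda>n. X (s n) \<bullet> X j" r] by (simp add: o_def)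
  qed
  define r where "r = diagseq"
  have r: "strict_mono r" unfolding r_def by (rule subseq_diagseq)
  define V where "V = {y. convergent (\<lambda>n. X (r n) \<bullet> y)}"
  \<comment> \<open>The diagonal sequence is known to be good for \<open>X j\<close> only from index
    \<open>Suc j\<close> on; dropping an initial segment does not affect convergence.\<close>
  have XV: "X j \<in> V" for j
    using seq_conv[of j] convergent_ignore_initial_segment[of "\<lambda>n. X (r n) \<bullet> X j" "Suc j"]
    by (simp add: V_def r_def o_def add.commute)
  have V_sub: "subspace V"
    unfolding subspace_def V_def
    by (auto simp: inner_simps intro: convergent_add convergent_mult convergent_const)
  have V_closed: "closed V"
    unfolding closed_sequential_limits
  proof (intro allI impI)
    fix Yv l assume A: "(\<forall>n. Yv n \<in> V) \<and> Yv \<longlonglongrightarrow> l"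
    have "Cauchy (\<lambda>n. X (r n) \<bullet> l)"
    proof (rule metric_CauchyI)
      fix d :: real assume "0 < d"
      define R' where "R' = max R 1"
      have R': "R' \<ge> 1" "\<And>n. norm (X n) \<le> R'" using bnd by (auto simp: R'_def le_max_iff_disj)
      have "0 < d / (3 * R')" using \<open>0 < d\<close> R' by simp
      then obtain j where "dist (Yv j) l < d / (3 * R')"
        using A metric_LIMSEQ_D by blast
      then have j: "R' * norm (Yv j - l) < d / 3"
        using R' by (simp add: dist_norm field_simps)
      have near: "\<bar>X n \<bullet> Yv j - X n \<bullet> l\<bar> < d / 3" for n
      proof -
        have "\<bar>X n \<bullet> (Yv j - l)\<bar> \<le> norm (X n) * norm (Yv j - l)" by (rule Cauchy_Schwarz_ineq2)
        also have "\<dots> \<le> R' * norm (Yv j - l)" by (intro mult_right_mono R') auto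
        finally show ?thesis using j by (simp add: inner_simps)
      qed
      have "Cauchy (\<lambda>n. X (r n) \<bullet> Yv j)"
        using A by (auto simp: V_def convergent_Cauchy)
      then obtain n0 where n0: "\<And>m n. m \<ge> n0 \<Longrightarrow> n \<ge> n0 \<Longrightarrow> dist (X (r m) \<bullet> Yv j) (X (r n) \<bullet> Yv j) < d / 3"
        using \<open>0 < d\<close> unfolding Cauchy_def by (metis divide_pos_pos zero_less_numeral)
      have "dist (X (r m) \<bullet> l) (X (r n) \<bullet> l) < d" if "m \<ge> n0" "n \<ge> n0" for m n
        using n0[OF that] near[of "r m"] near[of "r n"] unfolding dist_real_def by linarith
      then show "\<exists>n0. \<forall>m\<ge>n0. \<forall>n\<ge>n0. dist (X (r m) \<bullet> l) (X (r n) \<bullet> l) < d" by blast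
    qed
    then show "l \<in> V" by (simp add: V_def Cauchy_convergent)
  qed
  have conv: "convergent (\<lambda>n. X (r n) \<bullet> y)" for y
  proof -
    obtain w where w: "w \<in> V" "\<And>x. x \<in> V \<Longrightarrow> x \<bullet> y = x \<bullet> w"
      using projection_on[OF V_sub V_closed] by blast
    have "X (r n) \<bullet> y = X (r n) \<bullet> w" for n
      using w(2)[OF XV] by simp
    with w(1) show ?thesis by (simp add: V_def)
  qed
  \<comment> \<open>The limits form a linear functional bounded by \<open>R\<close>, the bound of
    the sequence; its Riesz representative in \<open>K\<close> is the weak limit.\<close>
  define f where "f y = lim (\<lambda>n. X (r n) \<bullet> y)" for y
  have f: "(\<lambda>n. X (r n) \<bullet> y) \<longlonglongrightarrow> f y" for y
    using conv unfolding f_def by (simp add: convergent_LIMSEQ_iff)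
  have "bounded_linear_on K UNIV f"
    unfolding bounded_linear_on_def
  proof (intro conjI ballI allI exI)
    show "f (x + y) = f x + f y" for x y
      using LIMSEQ_unique[OF f[of "x + y"]] tendsto_add[OF f[of x] f[of y]] by (simp add: inner_simps)
    show "f (c *\<^sub>R x) = c *\<^sub>R f x" for x c
      using LIMSEQ_unique[OF f[of "c *\<^sub>R x"]] tendsto_mult[OF tendsto_const f[of x]] by simp
    show "norm (f x) \<le> R * norm x" for x
    proof (rule tendsto_upperbound[OF tendsto_norm[OF f[of x]]])
      show "\<forall>\<^sub>F n in sequentially. norm (X (r n) \<bullet> x) \<le> R * norm x"
        using order_trans[OF Cauchy_Schwarz_ineq2 mult_right_mono[OF bnd]]
        by (auto intro!: always_eventually)
    qed auto
  qed auto
  then obtain w where "w \<in> K" "\<And>x. x \<in> K \<Longrightarrow> f x = x \<bullet> w"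
    using riesz_on[OF K] by blast
  then have "weakly_converges_in K (X \<circ> r) w"
    using f unfolding weakly_converges_in_def comp_def by (metis inner_commute)
  with r show ?thesis using that by blast
qed

text \<open>For two weak cluster points \<open>x\<close> and \<open>y\<close> both distances
  converge, so by polarization the products with \<open>x - y\<close> converge as well; comparing
  their limits along the two subsequences gives |x - y|^2 = 0. Weak sequential compactness then
  upgrades the only cluster point to the limit.\<close>

lemma opial:
  fixes X :: "nat \<Rightarrow> 'a::{real_inner, complete_space}"
  assumes K: "subspace K" "closed K" and XK: "\<And>n. X n \<in> K"
    and Z: "Z \<subseteq> K" "Z \<noteq> {}"
    and conv: "\<And>z. z \<in> Z \<Longrightarrow> convergent (\<lambda>n. norm (X n - z))"
    and cluster: "\<And>r x. strict_mono r \<Longrightarrow> weakly_converges_in K (X \<circ> r) x \<Longrightarrow> x \<in> Z"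
  shows "\<exists>x\<in>Z. weakly_converges_in K X x"
proof -
  obtain z where z: "z \<in> Z" using Z by blast
  obtain R where R: "\<And>n. norm (X n - z) \<le> R"
    using convergent_imp_Bseq[OF conv[OF z]] by (auto simp: Bseq_def)
  have bnd: "norm (X n) \<le> R + norm z" for n
    using R[of n] norm_triangle_sub[of "X n" z] by linarith
  have unique: "x = y"
    if r: "strict_mono r" "weakly_converges_in K (X \<circ> r) x"
      and s: "strict_mono s" "weakly_converges_in K (X \<circ> s) y" for r s x y
  proof -
    have xy: "x \<in> Z" "y \<in> Z" using cluster r s by auto
    then have xyK: "x - y \<in> K" using Z K subspace_diff by blast
    obtain lx ly where lx: "(\<lambda>n. norm (X n - x)) \<longlonglongrightarrow> lx" and ly: "(\<lambda>n. norm (X n - y)) \<longlonglongrightarrow> ly"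
      using conv xy unfolding convergent_def by blast
    have "X n \<bullet> (x - y) = ((norm (X n - y))\<^sup>2 - (norm (X n - x))\<^sup>2 + x \<bullet> x - y \<bullet> y) / 2" for n
      by (simp add: power2_norm_eq_inner inner_simps inner_commute)
    then have L: "(\<lambda>n. X n \<bullet> (x - y)) \<longlonglongrightarrow> (ly\<^sup>2 - lx\<^sup>2 + x \<bullet> x - y \<bullet> y) / 2"
      by (simp only:) (intro tendsto_intros lx ly, auto)
    have "(\<lambda>n. (X \<circ> r) n \<bullet> (x - y)) \<longlonglongrightarrow> x \<bullet> (x - y)" "(\<lambda>n. (X \<circ> s) n \<bullet> (x - y)) \<longlonglongrightarrow> y \<bullet> (x - y)"
      using r(2) s(2) xyK unfolding weakly_converges_in_def by blast+
    moreover note LIMSEQ_subseq_LIMSEQ[OF L r(1)] LIMSEQ_subseq_LIMSEQ[OF L s(1)]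
    ultimately have "x \<bullet> (x - y) = (ly\<^sup>2 - lx\<^sup>2 + x \<bullet> x - y \<bullet> y) / 2"
      "y \<bullet> (x - y) = (ly\<^sup>2 - lx\<^sup>2 + x \<bullet> x - y \<bullet> y) / 2"
      unfolding comp_def by (blast intro: LIMSEQ_unique)+
    then have "x \<bullet> (x - y) = y \<bullet> (x - y)" by simp
    then have "(x - y) \<bullet> (x - y) = 0" by (simp add: inner_simps)
    then show ?thesis by simp
  qed
  obtain r x where r: "strict_mono r" "weakly_converges_in K (X \<circ> r) x"
    by (rule weakly_convergent_subsequence[OF K XK bnd])
  have "(\<lambda>n. X n \<bullet> u) \<longlonglongrightarrow> x \<bullet> u" if u: "u \<in> K" for u
  proof (rule ccontr)
    \<comment> \<open>Failure at \<open>u\<close> yields a subsequence that stays \<open>e\<close>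
      away; a further subsequence converges weakly, necessarily to \<open>x\<close>, which is a
      contradiction.\<close>
    assume "\<not> ?thesis"
    then obtain e where e: "e > 0" "\<And>n0. \<exists>n\<ge>n0. \<not> dist (X n \<bullet> u) (x \<bullet> u) < e"
      unfolding lim_sequentially by blast
    then have "infinite {n. \<not> dist (X n \<bullet> u) (x \<bullet> u) < e}"
      unfolding infinite_nat_iff_unbounded_le by auto
    then obtain s :: "nat \<Rightarrow> nat" where s: "strict_mono s"
      and "\<forall>n. s n \<in> {n. \<not> dist (X n \<bullet> u) (x \<bullet> u) < e}"
      using infinite_enumerate by meson
    then have far: "\<not> dist (X (s n) \<bullet> u) (x \<bullet> u) < e" for n by simp
    obtain r' y where r': "strict_mono r'" "weakly_converges_in K ((X \<circ> s) \<circ> r') y"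
    proof (rule weakly_convergent_subsequence[OF K])
      show "(X \<circ> s) n \<in> K" "norm ((X \<circ> s) n) \<le> R + norm z" for n
        using XK bnd by auto
    qed
    then have "weakly_converges_in K (X \<circ> (s \<circ> r')) y" by (simp add: o_assoc)
    then have "y = x"
      using unique[OF strict_mono_o[OF s r'(1)] _ r] by blast
    then have "(\<lambda>n. X (s (r' n)) \<bullet> u) \<longlonglongrightarrow> x \<bullet> u"
      using r'(2) u by (auto simp: weakly_converges_in_def)
    then have "\<exists>n. dist (X (s (r' n)) \<bullet> u) (x \<bullet> u) < e"
      using metric_LIMSEQ_D e(1) by blast
    with far show False by blast
  qed
  then have "weakly_converges_in K X x"
    using r by (auto simp: weakly_converges_in_def)
  then show ?thesis by (rule bexI[OF _ cluster[OF r]])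
qed

section \<open>Maximally monotone operators and their resolvents\<close>

text \<open>Minimize (|x|^2 + |u|^2)/2 plus the Fitzpatrick function, which dominates
  \<open>x \<bullet> u\<close> with equality on \<open>R\<close>. Optimality compared with the
  points of \<open>R\<close> makes \<open>(- u, - x)\<close> monotonically related to
  \<open>R\<close>; maximality puts it into \<open>R\<close>, and as a test point for itself it
  forces \<open>x + u = 0\<close>.\<close>

lemma minty_surjective:
  fixes H :: "'a::{real_inner, complete_space} set"
  assumes H: "subspace H" "closed H" and R: "R \<subseteq> H \<times> H"
    and mono: "\<And>x u y v. (x, u) \<in> R \<Longrightarrow> (y, v) \<in> R \<Longrightarrow> (x - y) \<bullet> (u - v) \<ge> 0"
    and max: "\<And>x u. x \<in> H \<Longrightarrow> u \<in> H \<Longrightarrow>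
      (\<And>y v. (y, v) \<in> R \<Longrightarrow> (x - y) \<bullet> (u - v) \<ge> 0) \<Longrightarrow> (x, u) \<in> R"
  shows "\<exists>x. (x, - x) \<in> R"
proof -
  \<comment> \<open>the epigraph of the Fitzpatrick function of \<open>R\<close>\<close>
  define E where "E = {((x, u), t). x \<in> H \<and> u \<in> H \<and> (\<forall>(y, v)\<in>R. x \<bullet> v + y \<bullet> u - y \<bullet> v \<le> t)}"
  have E_bound: "x \<bullet> v + y \<bullet> u - y \<bullet> v \<le> t" if "((x, u), t) \<in> E" "(y, v) \<in> R" for x u t y v
    using that by (auto simp: E_def)
  \<comment> \<open>For a pair outside \<open>R\<close>, maximality supplies \<open>(y, v)\<close>
    with negative product, and this single test point already gives the bound.\<close>
  have E_inner: "x \<bullet> u \<le> t" if "((x, u), t) \<in> E" for x u t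
  proof (cases "(x, u) \<in> R")
    case True
    then show ?thesis using E_bound[OF that True] by simp
  next
    case False
    have "x \<in> H" "u \<in> H" using that by (auto simp: E_def)
    with False obtain y v where "(y, v) \<in> R" "(x - y) \<bullet> (u - v) < 0"
      using max[of x u] by (meson not_le)
    then show ?thesis using E_bound[OF that, of y v] by (simp add: inner_simps)
  qed
  have R_E: "((y, v), y \<bullet> v) \<in> E" if "(y, v) \<in> R" for y v
  proof -
    have "y \<bullet> v' + y' \<bullet> v - y' \<bullet> v' \<le> y \<bullet> v" if "(y', v') \<in> R" for y' v'
      using mono[OF \<open>(y, v) \<in> R\<close> that] by (simp add: inner_simps)
    then show ?thesis using that R by (auto simp: E_def)
  qed
  have "closed E"
  proof -
    have "E = ((H \<times> H) \<times> UNIV) \<inter>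
        (\<Inter>(y, v)\<in>R. {e. fst (fst e) \<bullet> v + y \<bullet> snd (fst e) - y \<bullet> v \<le> snd e})"
      unfolding E_def by auto
    moreover have "closed {e :: ('a \<times> 'a) \<times> real. fst (fst e) \<bullet> v + y \<bullet> snd (fst e) - y \<bullet> v \<le> snd e}"
      for y v by (intro closed_Collect_le continuous_intros)
    ultimately show ?thesis
      using H by (auto intro!: closed_Int closed_INT closed_Times)
  qed
  have "convex E"
  proof (rule convexI)
    fix e e' and l m :: real
    assume E: "e \<in> E" "e' \<in> E" and lm: "0 \<le> l" "0 \<le> m" "l + m = 1"
    obtain x u t x' u' t' where e: "e = ((x, u), t)" "e' = ((x', u'), t')" by (metis surj_pair)
    have "(l *\<^sub>R x + m *\<^sub>R x') \<bullet> v + y \<bullet> (l *\<^sub>R u + m *\<^sub>R u') - y \<bullet> v \<le> l * t + m * t'"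
      if "(y, v) \<in> R" for y v
    proof -
      have "l * (x \<bullet> v + y \<bullet> u - y \<bullet> v) + m * (x' \<bullet> v + y \<bullet> u' - y \<bullet> v) \<le> l * t + m * t'"
        using E_bound E that lm unfolding e by (intro add_mono mult_left_mono) auto
      moreover have "l * (y \<bullet> v) + m * (y \<bullet> v) = y \<bullet> v"
        using lm(3) by (metis distrib_right mult_1)
      ultimately show ?thesis by (simp add: inner_simps algebra_simps)
    qed
    then show "l *\<^sub>R e + m *\<^sub>R e' \<in> E"
      using E H by (auto simp: E_def e subspace_add subspace_scale)
  qed
  have "E \<noteq> {}"
  proof -
    obtain y v where "(y, v) \<in> R" using max[of 0 0] subspace_0[OF H(1)] by auto
    from R_E[OF this] show ?thesis by auto
  qed
  \<comment> \<open>Since \<open>x \<bullet> u \<le> t\<close>, the objective is at least |x +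
    u|^2/2.\<close>
  have lower: "0 \<le> p \<bullet> p / 2 + t" if "(p, t) \<in> E" for p t
  proof -
    obtain x u where p: "p = (x, u)" by force
    have "0 \<le> (x + u) \<bullet> (x + u)" by simp
    then show ?thesis using E_inner[of x u t] that unfolding p
      by (simp add: inner_simps inner_commute add_divide_distrib)
  qed
  obtain p t where pt: "(p, t) \<in> E"
    and opt: "\<And>p' t'. (p', t') \<in> E \<Longrightarrow> p \<bullet> (p' - p) + (t' - t) \<ge> 0"
    by (rule quadratic_minimizer[OF \<open>closed E\<close> \<open>convex E\<close> \<open>E \<noteq> {}\<close> lower]) (assumption, rule that)
  obtain x u where p: "p = (x, u)" by force
  have xu: "x \<in> H" "u \<in> H" using pt by (auto simp: p E_def)
  \<comment> \<open>The optimality condition, combined with \<open>x \<bullet> u \<le> t\<close> and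
    regrouped into two products.\<close>
  have *: "(x + u) \<bullet> (x + u) \<le> (- u - y) \<bullet> (- x - v)" if "(y, v) \<in> R" for y v
    using opt[OF R_E[OF that]] E_inner[of x u t] pt
    by (simp add: p inner_simps inner_commute)
  have "(- u, - x) \<in> R"
    using xu H order_trans[OF inner_ge_zero *] by (intro max) (auto simp: subspace_neg)
  with *[OF this] have "(x + u) \<bullet> (x + u) \<le> 0" by simp
  then have "x + u = 0" by (metis inner_ge_zero inner_eq_zero_iff order_antisym)
  with \<open>(- u, - x) \<in> R\<close> show ?thesis by (metis add_eq_0_iff2 minus_minus)
qed

text \<open>
  By Minty's theorem the graphs satisfying the following condition are exactly those of the
  maximally monotone operators on \<open>K\<close>; unlike maximality, it passes to products and to
  inverses without effort.
\<close>

definition resolvable_on :: "'a::real_inner set \<Rightarrow> ('a \<times> 'a) set \<Rightarrow> bool"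
  where "resolvable_on K R \<longleftrightarrow> (\<forall>x u. (x, u) \<in> R \<longrightarrow> x \<in> K \<and> u \<in> K) \<and>
    (\<forall>x u y v. (x, u) \<in> R \<longrightarrow> (y, v) \<in> R \<longrightarrow> (x - y) \<bullet> (u - v) \<ge> 0) \<and>
    (\<forall>\<mu>>0. \<forall>x\<in>K. \<exists>p. (p, (1 / \<mu>) *\<^sub>R (x - p)) \<in> R)"

lemma resolvable_onD:
  assumes "resolvable_on K R"
  shows "(x, u) \<in> R \<Longrightarrow> x \<in> K" "(x, u) \<in> R \<Longrightarrow> u \<in> K"
    "(x, u) \<in> R \<Longrightarrow> (y, v) \<in> R \<Longrightarrow> (x - y) \<bullet> (u - v) \<ge> 0"
    "\<mu> > 0 \<Longrightarrow> x \<in> K \<Longrightarrow> \<exists>p. (p, (1 / \<mu>) *\<^sub>R (x - p)) \<in> R"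
  using assms unfolding resolvable_on_def by meson+

lemma resolvable_on_nonexpansive:
  assumes R: "resolvable_on K R" and "\<mu> > 0"
    and p: "(p, (1 / \<mu>) *\<^sub>R (x - p)) \<in> R" "(q, (1 / \<mu>) *\<^sub>R (y - q)) \<in> R"
  shows "norm (p - q) \<le> norm (x - y)"
proof -
  have "0 \<le> (p - q) \<bullet> ((1 / \<mu>) *\<^sub>R (x - p) - (1 / \<mu>) *\<^sub>R (y - q))"
    by (rule resolvable_onD(3)[OF R p])
  also have "\<dots> = (1 / \<mu>) * ((p - q) \<bullet> (x - y) - (p - q) \<bullet> (p - q))"
    by (simp add: scaleR_diff_right[symmetric] inner_diff_right)
  finally have "(norm (p - q))\<^sup>2 \<le> (p - q) \<bullet> (x - y)"
    using \<open>\<mu> > 0\<close> by (simp add: zero_le_divide_iff power2_norm_eq_inner)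
  also have "\<dots> \<le> norm (p - q) * norm (x - y)"
    by (rule norm_cauchy_schwarz)
  finally show ?thesis
    by (cases "p = q") (auto simp: power2_eq_square)
qed

text \<open>Solving \<open>x = p + \<mu> u\<close> with \<open>u\<close> in \<open>A p\<close> is
  Minty's theorem for the graph shifted by \<open>x\<close> in the first coordinate and scaled by
  \<mu> in the second; both changes preserve maximality.\<close>

lemma maximally_monotone_resolvable:
  fixes H :: "'a::{real_inner, complete_space} set"
  assumes H: "subspace H" "closed H" and A: "maximally_monotone_on H A"
  shows "resolvable_on H (gra A)"
  unfolding resolvable_on_def
proof (intro conjI allI impI ballI)
  have sub: "gra A \<subseteq> H \<times> H"
    using A by (simp add: maximally_monotone_on_def)
  then show "x \<in> H" "u \<in> H" if "(x, u) \<in> gra A" for x u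
    using that by auto
  show mono: "(x - y) \<bullet> (u - v) \<ge> 0" if "(x, u) \<in> gra A" "(y, v) \<in> gra A" for x u y v
    using A that unfolding maximally_monotone_on_def monotone_op_def by blast
  have max: "(x, u) \<in> gra A"
    if "x \<in> H" "u \<in> H" "\<And>y v. (y, v) \<in> gra A \<Longrightarrow> (x - y) \<bullet> (u - v) \<ge> 0" for x u
  proof (rule ccontr)
    \<comment> \<open>Maximality with respect to inclusion of graphs becomes a pointwise criterion,
      because a monotonically related pair could be added to the graph.\<close>
    assume not: "(x, u) \<notin> gra A"
    define A' where "A' y = A y \<union> (if y = x then {u} else {})" for y
    have gra: "gra A' = insert (x, u) (gra A)"
      by (auto simp: A'_def gra_def split: if_splits)
    have sym: "(y - x) \<bullet> (v - u) = (x - y) \<bullet> (u - v)" for y v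
      by (simp add: inner_simps)
    have "monotone_op A'"
      unfolding monotone_op_def gra using mono that(3) by (auto simp: sym)
    moreover have "gra A' \<subseteq> H \<times> H" "gra A \<subset> gra A'"
      unfolding gra using not sub that(1,2) by auto
    ultimately show False
      using A unfolding maximally_monotone_on_def by blast
  qed
  fix \<mu> :: real and x assume "\<mu> > 0" and x: "x \<in> H"
  define R where "R = (\<lambda>(y, v). (y - x, \<mu> *\<^sub>R v)) ` gra A"
  have "\<exists>w. (w, - w) \<in> R"
  proof (rule minty_surjective[OF H])
    show "R \<subseteq> H \<times> H"
      using sub x H by (auto simp: R_def subspace_diff subspace_scale)
    show "(y - y') \<bullet> (v - v') \<ge> 0" if "(y, v) \<in> R" "(y', v') \<in> R" for y v y' v'
    proof -
      obtain y0 v0 y1 v1 where *: "(y0, v0) \<in> gra A" "(y1, v1) \<in> gra A" "y = y0 - x" "y' = y1 - x"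
        "v = \<mu> *\<^sub>R v0" "v' = \<mu> *\<^sub>R v1"
        using \<open>(y, v) \<in> R\<close> \<open>(y', v') \<in> R\<close> unfolding R_def by auto
      have "(y - y') \<bullet> (v - v') = \<mu> * ((y0 - y1) \<bullet> (v0 - v1))"
        unfolding * by (simp add: scaleR_right_diff_distrib[symmetric])
      moreover have "0 \<le> (y0 - y1) \<bullet> (v0 - v1)"
        using *(1,2) by (rule mono)
      ultimately show ?thesis using \<open>\<mu> > 0\<close> by simp
    qed
    show "(a, b) \<in> R" if a: "a \<in> H" and b: "b \<in> H"
      and rel: "\<And>y v. (y, v) \<in> R \<Longrightarrow> (a - y) \<bullet> (b - v) \<ge> 0" for a b
    proof -
      have "(a + x, (1 / \<mu>) *\<^sub>R b) \<in> gra A"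
      proof (rule max)
        fix y v assume "(y, v) \<in> gra A"
        then have "0 \<le> (a - (y - x)) \<bullet> (b - \<mu> *\<^sub>R v)"
          by (intro rel) (auto simp: R_def)
        also have "\<dots> = \<mu> * ((a + x - y) \<bullet> ((1 / \<mu>) *\<^sub>R b - v))"
          using \<open>\<mu> > 0\<close> by (simp add: inner_simps algebra_simps)
        finally show "0 \<le> (a + x - y) \<bullet> ((1 / \<mu>) *\<^sub>R b - v)"
          using \<open>\<mu> > 0\<close> by (simp add: zero_le_mult_iff)
      qed (use a b x H in \<open>auto simp: subspace_add subspace_scale\<close>)
      then show ?thesis
        unfolding R_def using \<open>\<mu> > 0\<close> by (intro rev_image_eqI) auto
    qed
  qed
  then obtain y v where yv: "(y, v) \<in> gra A" "\<mu> *\<^sub>R v = x - y"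
    unfolding R_def by auto
  then have "v = (1 / \<mu>) *\<^sub>R (x - y)"
    using \<open>\<mu> > 0\<close> by (metis divide_self_if less_numeral_extra(3) scaleR_one scaleR_scaleR times_divide_eq_left mult_1)
  with yv show "\<exists>p. (p, (1 / \<mu>) *\<^sub>R (x - p)) \<in> gra A" by blast
qed

text \<open>The definite description in \<open>resolvent\<close> is legitimate: nonexpansiveness
  with equal arguments gives uniqueness.\<close>

lemma resolvent_in_gra:
  assumes R: "resolvable_on H (gra A)" and "\<mu> > 0" "x \<in> H"
  shows "(resolvent (op_scale \<mu> A) x, (1 / \<mu>) *\<^sub>R (x - resolvent (op_scale \<mu> A) x)) \<in> gra A"
proof -
  have iff: "p \<in> op_inv (\<lambda>p. {p} + op_scale \<mu> A p) x \<longleftrightarrow> (p, (1 / \<mu>) *\<^sub>R (x - p)) \<in> gra A" for p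
  proof -
    have "x = p + \<mu> *\<^sub>R u \<longleftrightarrow> u = (1 / \<mu>) *\<^sub>R (x - p)" for u
    proof
      show "u = (1 / \<mu>) *\<^sub>R (x - p)" if "x = p + \<mu> *\<^sub>R u"
        unfolding that using \<open>\<mu> > 0\<close> by simp
      show "x = p + \<mu> *\<^sub>R u" if "u = (1 / \<mu>) *\<^sub>R (x - p)"
        unfolding that using \<open>\<mu> > 0\<close> by simp
    qed
    then show ?thesis
      by (auto simp: op_inv_def op_scale_def gra_def set_plus_def)
  qed
  obtain p where p: "(p, (1 / \<mu>) *\<^sub>R (x - p)) \<in> gra A"
    using resolvable_onD(4)[OF R] assms by blast
  have "resolvent (op_scale \<mu> A) x = p"
    unfolding resolvent_def iff
  proof (rule the_equality)
    show "q = p" if "(q, (1 / \<mu>) *\<^sub>R (x - q)) \<in> gra A" for q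
      using resolvable_on_nonexpansive[OF R \<open>\<mu> > 0\<close> that p] by simp
  qed (rule p)
  with p show ?thesis by simp
qed

text \<open>
  For small \<open>\<mu>\<close>, the resolvent inclusion of \<open>R + Q\<close> is a fixed point equation for a contraction;
  hence \<open>R + Q\<close> is again maximally monotone.
\<close>

lemma resolvable_on_lipschitz_perturbation:
  fixes K :: "'a::{real_inner, complete_space} set"
  assumes K: "subspace K" "closed K" and R: "resolvable_on K R"
    and Q: "\<And>x. x \<in> K \<Longrightarrow> Q x \<in> K"
    and lip: "\<And>x y. x \<in> K \<Longrightarrow> y \<in> K \<Longrightarrow> norm (Q x - Q y) \<le> \<beta> * norm (x - y)" and "\<beta> > 0"
    and x: "x \<in> K" "u \<in> K" and rel: "\<And>y v. (y, v) \<in> R \<Longrightarrow> (x - y) \<bullet> (u - (v + Q y)) \<ge> 0"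
  shows "(x, u - Q x) \<in> R"
proof -
  \<comment> \<open>With this parameter \<mu> \<open>Q\<close> is a contraction with factor
    1/2.\<close>
  define \<mu> where "\<mu> = 1 / (2 * \<beta>)"
  have \<mu>: "\<mu> > 0" "\<mu> * \<beta> = 1 / 2" using \<open>\<beta> > 0\<close> by (auto simp: \<mu>_def)
  obtain J where J: "\<And>w. w \<in> K \<Longrightarrow> (J w, (1 / \<mu>) *\<^sub>R (w - J w)) \<in> R"
    using resolvable_onD(4)[OF R \<mu>(1)] by metis
  define f where "f y = J (x + \<mu> *\<^sub>R u - \<mu> *\<^sub>R Q y)" for y
  have arg: "x + \<mu> *\<^sub>R u - \<mu> *\<^sub>R Q y \<in> K" if "y \<in> K" for y
    using that K x Q by (intro subspace_add subspace_diff subspace_scale) auto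
  have "\<exists>!y\<in>K. f y = y"
  proof (rule Banach_fix)
    show "complete K" using K(2) by (simp add: complete_eq_closed)
    show "K \<noteq> {}" using x by blast
    show "f ` K \<subseteq> K" using J arg resolvable_onD(1)[OF R] by (force simp: f_def)
    show "dist (f y) (f y') \<le> 1 / 2 * dist y y'" if y: "y \<in> K" "y' \<in> K" for y y'
    proof -
      have "norm (f y - f y')
          \<le> norm ((x + \<mu> *\<^sub>R u - \<mu> *\<^sub>R Q y) - (x + \<mu> *\<^sub>R u - \<mu> *\<^sub>R Q y'))"
        unfolding f_def using J arg y by (intro resolvable_on_nonexpansive[OF R \<mu>(1)]) auto
      also have "\<dots> = \<mu> * norm (Q y - Q y')"
        using \<mu>(1) norm_scaleR[of "- \<mu>" "Q y - Q y'"] by (simp add: algebra_simps norm_minus_commute)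
      also have "\<dots> \<le> \<mu> * (\<beta> * norm (y - y'))"
        using lip y \<mu>(1) by (intro mult_left_mono) auto
      finally show ?thesis
        by (simp add: dist_norm mult.assoc[symmetric] \<mu>(2))
    qed
  qed auto
  then obtain y where y: "y \<in> K" "f y = y" by (auto dest: ex1_implies_ex)
  define v where "v = (1 / \<mu>) *\<^sub>R (x + \<mu> *\<^sub>R u - \<mu> *\<^sub>R Q y - y)"
  have v: "v = (1 / \<mu>) *\<^sub>R (x - y) + u - Q y"
    using \<mu>(1) by (simp add: v_def scaleR_diff_right scaleR_add_right)
  have yv: "(y, v) \<in> R"
    using J[OF arg[OF y(1)]] y(2) by (simp add: f_def v_def)
  \<comment> \<open>At the fixed point \<open>u - (v + Q y)\<close> is a negative multiple of
    \<open>x - y\<close>, so the assumed relation can hold only if \<open>x = y\<close>.\<close>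
  have "0 \<le> (x - y) \<bullet> (u - (v + Q y))" by (rule rel[OF yv])
  also have "\<dots> = - ((1 / \<mu>) * ((x - y) \<bullet> (x - y)))"
    unfolding v by simp
  finally have "(1 / \<mu>) * ((x - y) \<bullet> (x - y)) \<le> 0" by simp
  then have "(x - y) \<bullet> (x - y) \<le> 0"
    using \<mu>(1) by (simp add: field_simps)
  then have "x = y" by (metis inner_ge_zero inner_eq_zero_iff antisym eq_iff_diff_eq_0)
  with yv show ?thesis by (simp add: v)
qed

section \<open>Scalar recursions with summable errors\<close>

lemma quasi_fejer_convergent:
  fixes d e :: "nat \<Rightarrow> real"
  assumes "\<And>n. d n \<ge> 0" "\<And>n. e n \<ge> 0" "summable e" "\<And>n. d (Suc n) \<le> d n + e n"
  shows "convergent d"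
proof -
  \<comment> \<open>Subtracting the accumulated errors leaves a decreasing sequence that is bounded
    below by minus the total error.\<close>
  have dec: "decseq (\<lambda>n. d n - sum e {..<n})"
    using assms(4) by (intro decseq_SucI) (simp add: algebra_simps)
  have bounded: "\<forall>n. - suminf e \<le> d n - sum e {..<n}"
  proof
    show "- suminf e \<le> d n - sum e {..<n}" for n
      using assms(1)[of n] sum_le_suminf[OF assms(3), of "{..<n}"] assms(2) by simp
  qed
  obtain l where "(\<lambda>n. d n - sum e {..<n}) \<longlonglongrightarrow> l"
    using decseq_convergent[OF dec bounded] by auto
  then have "convergent (\<lambda>n. d n - sum e {..<n})"
    by (rule convergentI)
  moreover have "convergent (\<lambda>n. sum e {..<n})"
    using assms(3) by (simp add: summable_iff_convergent)
  ultimately have "convergent (\<lambda>n. (d n - sum e {..<n}) + sum e {..<n})"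
    by (rule convergent_add)
  then show ?thesis by simp
qed

lemma summable_of_quasi_descent:
  fixes d e f :: "nat \<Rightarrow> real"
  assumes "\<And>n. d n \<ge> 0" "\<And>n. f n \<ge> 0" "\<And>n. e n \<ge> 0" "summable e"
    "\<And>n. d (Suc n) \<le> d n - f n + e n"
  shows "summable f"
proof (rule summableI_nonneg_bounded)
  show "sum f {..<n} \<le> d 0 + suminf e" for n
  proof -
    have "sum f {..<n} + d n \<le> d 0 + sum e {..<n}"
    proof (induction n)
      case (Suc n)
      then show ?case using assms(5)[of n] by simp
    qed simp
    then show ?thesis
      using assms(1)[of n] sum_le_suminf[OF assms(4), of "{..<n}"] assms(3) by simp
  qed
qed (rule assms(2))

section \<open>Tseng's iteration with errors\<close>

text \<open>
  Membership in \<open>K\<close> follows inductively from the recursion. It is a premise of the assumptions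
  on \<open>y\<close> and \<open>q\<close> since an instance may need it for these: resolvents exist, and
  operators are linear, only on \<open>K\<close>.
\<close>

locale perturbed_tseng =
  fixes K :: "'a::{real_inner, complete_space} set" and R :: "('a \<times> 'a) set" and Q :: "'a \<Rightarrow> 'a"
    and \<beta> \<epsilon> :: real and \<gamma> :: "nat \<Rightarrow> real" and a b c x s y p q :: "nat \<Rightarrow> 'a"
  assumes K: "subspace K" "closed K" and R: "resolvable_on K R"
    and Q: "\<And>w. w \<in> K \<Longrightarrow> Q w \<in> K"
    and lip: "\<And>w w'. w \<in> K \<Longrightarrow> w' \<in> K \<Longrightarrow> norm (Q w - Q w') \<le> \<beta> * norm (w - w')"
    and mono: "\<And>w w'. w \<in> K \<Longrightarrow> w' \<in> K \<Longrightarrow> (w - w') \<bullet> (Q w - Q w') \<ge> 0"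
    and \<beta>: "\<beta> > 0" and \<epsilon>: "0 < \<epsilon>" "\<epsilon> < 1" and \<gamma>: "\<And>n. \<gamma> n \<in> {\<epsilon>..(1 - \<epsilon>) / \<beta>}"
    and errors: "\<And>n. a n \<in> K" "\<And>n. b n \<in> K" "\<And>n. c n \<in> K"
      "summable (\<lambda>n. norm (a n))" "summable (\<lambda>n. norm (b n))" "summable (\<lambda>n. norm (c n))"
    and x0: "x 0 \<in> K"
    and s: "\<And>n. s n = x n - \<gamma> n *\<^sub>R (Q (x n) + a n)"
    and y: "\<And>n. s n \<in> K \<Longrightarrow> (y n, (1 / \<gamma> n) *\<^sub>R (s n - y n)) \<in> R"
    and p: "\<And>n. p n = y n + b n"
    and q: "\<And>n. p n \<in> K \<Longrightarrow> q n = p n - \<gamma> n *\<^sub>R (Q (p n) + c n)"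
    and x_Suc: "\<And>n. x (Suc n) = x n - s n + q n"
    and solvable: "\<exists>z. (z, - Q z) \<in> R"
begin

lemma step: "\<gamma> n > 0" "\<epsilon> \<le> \<gamma> n" "\<gamma> n * \<beta> \<le> 1 - \<epsilon>" "\<gamma> n \<le> 1 / \<beta>"
  using \<gamma>[of n] \<epsilon> \<beta> by (auto simp: pos_le_divide_eq)

lemma in_K: "x n \<in> K" "s n \<in> K" "y n \<in> K" "p n \<in> K" "q n \<in> K"
proof -
  have *: "s n \<in> K \<and> y n \<in> K \<and> p n \<in> K \<and> q n \<in> K" if "x n \<in> K" for n
  proof -
    have "s n \<in> K" unfolding s
      using that K Q errors by (intro subspace_diff subspace_scale subspace_add) auto
    moreover from this have "y n \<in> K" using resolvable_onD(1)[OF R y] by blast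
    moreover from this have "p n \<in> K" unfolding p using K errors by (intro subspace_add) auto
    moreover from this have "q n \<in> K" unfolding q[OF \<open>p n \<in> K\<close>]
      using K Q errors by (intro subspace_diff subspace_scale subspace_add) auto
    ultimately show ?thesis by blast
  qed
  have "x n \<in> K"
  proof (induction n)
    case (Suc n)
    then show ?case unfolding x_Suc using * K by (auto intro: subspace_add subspace_diff)
  qed (rule x0)
  with * show "x n \<in> K" "s n \<in> K" "y n \<in> K" "p n \<in> K" "q n \<in> K" by blast+
qed

text \<open>
  The iterates \<open>prox n\<close> and \<open>next_exact n\<close> result from an error-free step started at \<open>x n\<close>, and
  \<open>dual n + Q (prox n)\<close> is the element of \<open>(R + Q) (prox n)\<close> that this step produces.
\<close>

definition prox :: "nat \<Rightarrow> 'a"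
  where "prox n = (SOME w. (w, (1 / \<gamma> n) *\<^sub>R (x n - \<gamma> n *\<^sub>R Q (x n) - w)) \<in> R)"

definition dual :: "nat \<Rightarrow> 'a"
  where "dual n = (1 / \<gamma> n) *\<^sub>R (x n - \<gamma> n *\<^sub>R Q (x n) - prox n)"

definition next_exact :: "nat \<Rightarrow> 'a"
  where "next_exact n = prox n + \<gamma> n *\<^sub>R (Q (x n) - Q (prox n))"

text \<open>The constants count how errors reach \<open>x (Suc n)\<close>: \<open>a n\<close> enters
  through \<open>s n\<close>, through \<open>p n\<close> and through \<open>Q (p n)\<close>,
  \<open>b n\<close> through the last two, \<open>c n\<close> once. The factor 1/\<beta> bounds
  \<gamma>, and \<gamma> \<beta> \<le> 1 makes \<gamma> \<open>Q\<close> nonexpansive.\<close>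

definition err :: "nat \<Rightarrow> real"
  where "err n = 3 / \<beta> * norm (a n) + 2 * norm (b n) + 1 / \<beta> * norm (c n)"

lemma prox_dual: "(prox n, dual n) \<in> R"
proof -
  have "x n - \<gamma> n *\<^sub>R Q (x n) \<in> K"
    using K Q in_K by (intro subspace_diff subspace_scale) auto
  from resolvable_onD(4)[OF R step(1) this]
  show ?thesis unfolding dual_def prox_def by (rule someI_ex)
qed

lemma prox_in_K: "prox n \<in> K"
  using resolvable_onD(1)[OF R prox_dual] .

lemma dual_eq: "\<gamma> n *\<^sub>R dual n = x n - \<gamma> n *\<^sub>R Q (x n) - prox n"
  unfolding dual_def using step(1)[of n] by simp

lemma residual_eq: "\<gamma> n *\<^sub>R (dual n + Q (prox n)) = x n - next_exact n"
  unfolding scaleR_add_right dual_eq next_exact_def by (simp add: algebra_simps)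

lemma err_summable: "summable err" and err_nonneg: "err n \<ge> 0"
  unfolding err_def using errors \<beta> by (auto intro!: summable_add summable_mult)

lemma s_prox_near: "norm (s n - (x n - \<gamma> n *\<^sub>R Q (x n))) \<le> 1 / \<beta> * norm (a n)"
proof -
  have "s n - (x n - \<gamma> n *\<^sub>R Q (x n)) = - (\<gamma> n *\<^sub>R a n)"
    unfolding s by (simp add: algebra_simps)
  then have "norm (s n - (x n - \<gamma> n *\<^sub>R Q (x n))) = \<gamma> n * norm (a n)"
    using step(1)[of n] by simp
  also have "\<dots> \<le> 1 / \<beta> * norm (a n)"
    by (intro mult_right_mono step) auto
  finally show ?thesis .
qed

lemma p_prox_near: "norm (p n - prox n) \<le> 1 / \<beta> * norm (a n) + norm (b n)"
proof -
  have "norm (y n - prox n) \<le> norm (s n - (x n - \<gamma> n *\<^sub>R Q (x n)))"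
    using prox_dual[of n] unfolding dual_def
    by (intro resolvable_on_nonexpansive[OF R step(1) y[OF in_K(2)]])
  moreover have "norm (p n - prox n) \<le> norm (y n - prox n) + norm (b n)"
    using norm_triangle_ineq[of "y n - prox n" "b n"] by (simp add: p algebra_simps)
  ultimately show ?thesis using s_prox_near[of n] by linarith
qed

lemma Suc_near: "norm (x (Suc n) - next_exact n) \<le> err n"
proof -
  have "x (Suc n) - next_exact n = - (s n - (x n - \<gamma> n *\<^sub>R Q (x n)))
      + ((p n - prox n) + - (\<gamma> n *\<^sub>R (Q (p n) - Q (prox n))) + - (\<gamma> n *\<^sub>R c n))"
    unfolding x_Suc q[OF in_K(4)] next_exact_def by (simp add: algebra_simps)
  then have "norm (x (Suc n) - next_exact n) \<le> norm (s n - (x n - \<gamma> n *\<^sub>R Q (x n)))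
      + (norm (p n - prox n) + norm (\<gamma> n *\<^sub>R (Q (p n) - Q (prox n))) + norm (\<gamma> n *\<^sub>R c n))"
    by (simp only: norm_minus_cancel norm_triangle_mono norm_triangle_ineq4 norm_triangle_le add_left_mono order_refl)
  moreover have "norm (\<gamma> n *\<^sub>R (Q (p n) - Q (prox n))) \<le> norm (p n - prox n)"
  proof -
    have "norm (\<gamma> n *\<^sub>R (Q (p n) - Q (prox n))) \<le> \<gamma> n * (\<beta> * norm (p n - prox n))"
      using step(1)[of n] lip[OF in_K(4) prox_in_K] by simp
    also have "\<dots> \<le> 1 * norm (p n - prox n)"
      unfolding mult.assoc[symmetric] using step(3)[of n] \<epsilon> by (intro mult_right_mono) auto
    finally show ?thesis by simp
  qed
  moreover have "norm (\<gamma> n *\<^sub>R c n) \<le> 1 / \<beta> * norm (c n)"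
    using step(1)[of n] mult_right_mono[OF step(4)[of n], of "norm (c n)"] by simp
  moreover have "3 / \<beta> * norm (a n) = 3 * (1 / \<beta> * norm (a n))" by simp
  ultimately show ?thesis
    using s_prox_near[of n] p_prox_near[of n] unfolding err_def by linarith
qed

text \<open>Expand the square around \<open>prox n\<close>. The cross term has the good sign because
  \<open>dual n + Q (prox n)\<close> and 0 are values of the monotone operator \<open>R + Q\<close>
  at \<open>prox n\<close> and at \<open>z\<close>; the remaining term
  \<open>norm (next_exact n - prox n)\<close> is controlled by the Lipschitz bound and \<gamma>
  \<beta> \<le> 1 - \<epsilon>.\<close>

lemma exact_descent:
  assumes z: "(z, - Q z) \<in> R"
  shows "(norm (next_exact n - z))\<^sup>2 \<le> (norm (x n - z))\<^sup>2 - \<epsilon> * (norm (x n - prox n))\<^sup>2"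
proof -
  have zK: "z \<in> K" using resolvable_onD(1)[OF R z] .
  have "0 \<le> (prox n - z) \<bullet> (dual n - (- Q z)) + (prox n - z) \<bullet> (Q (prox n) - Q z)"
    by (intro add_nonneg_nonneg resolvable_onD(3)[OF R prox_dual z] mono prox_in_K zK)
  also have "\<dots> = (prox n - z) \<bullet> (dual n + Q (prox n))"
    by (simp add: inner_simps)
  finally have "0 \<le> \<gamma> n * ((prox n - z) \<bullet> (dual n + Q (prox n)))"
    using step(1)[of n] by simp
  then have nonneg: "0 \<le> (prox n - z) \<bullet> (x n - next_exact n)"
    unfolding inner_scaleR_right[symmetric] residual_eq .
  have "norm (next_exact n - prox n) \<le> \<gamma> n * (\<beta> * norm (x n - prox n))"
    using step(1)[of n] lip[OF in_K(1) prox_in_K] by (simp add: next_exact_def)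
  also have "\<dots> \<le> (1 - \<epsilon>) * norm (x n - prox n)"
    unfolding mult.assoc[symmetric] by (intro mult_right_mono step) auto
  finally have "(norm (next_exact n - prox n))\<^sup>2 \<le> ((1 - \<epsilon>) * norm (x n - prox n))\<^sup>2"
    by (rule power_mono) auto
  also have "\<dots> = (1 - \<epsilon>)\<^sup>2 * (norm (x n - prox n))\<^sup>2"
    by (rule power_mult_distrib)
  \<comment> \<open>Keeping only one factor 1 - \<epsilon> makes the coefficient of the decrease
    exactly \<epsilon>.\<close>
  also have "\<dots> \<le> (1 - \<epsilon>) * (norm (x n - prox n))\<^sup>2"
    using \<epsilon> by (intro mult_right_mono) (auto simp: power2_eq_square mult_left_le)
  finally have "(norm (next_exact n - prox n))\<^sup>2 \<le> (1 - \<epsilon>) * (norm (x n - prox n))\<^sup>2" .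
  moreover have "(norm (next_exact n - z))\<^sup>2 = (norm (x n - z))\<^sup>2 - (norm (x n - prox n))\<^sup>2
      + (norm (next_exact n - prox n))\<^sup>2 - 2 * ((prox n - z) \<bullet> (x n - next_exact n))"
    by (simp add: power2_norm_eq_inner inner_simps inner_commute)
  ultimately show ?thesis using nonneg by (simp add: left_diff_distrib)
qed

lemma dist_convergent:
  assumes z: "(z, - Q z) \<in> R"
  shows "convergent (\<lambda>n. norm (x n - z))"
proof (rule quasi_fejer_convergent[OF _ err_nonneg err_summable])
  fix n
  have "(norm (next_exact n - z))\<^sup>2 \<le> (norm (x n - z))\<^sup>2"
    using exact_descent[OF z, of n] \<epsilon> by (smt (verit) mult_nonneg_nonneg zero_le_power2)
  then have "norm (next_exact n - z) \<le> norm (x n - z)"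
    by (rule power2_le_imp_le) simp
  moreover have "norm (x (Suc n) - z) \<le> norm (x (Suc n) - next_exact n) + norm (next_exact n - z)"
    using norm_triangle_ineq[of "x (Suc n) - next_exact n" "next_exact n - z"] by simp
  ultimately show "norm (x (Suc n) - z) \<le> norm (x n - z) + err n"
    using Suc_near[of n] by linarith
qed simp

lemma summable_prox: "summable (\<lambda>n. (norm (x n - prox n))\<^sup>2)"
proof -
  obtain z where z: "(z, - Q z) \<in> R" using solvable by blast
  obtain d where d: "\<And>n. norm (x n - z) \<le> d"
    using convergent_imp_Bseq[OF dist_convergent[OF z]] by (auto simp: Bseq_def)
  obtain e where e: "\<And>n. err n \<le> e"
    using convergent_imp_Bseq[OF convergentI[OF summable_LIMSEQ_zero[OF err_summable]]]
    by (auto simp: Bseq_def intro: order_trans[OF abs_ge_self])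
  \<comment> \<open>The error term comes from (t + err)^2 - t^2 = err (2 t + err), where
    \<open>d\<close> bounds the distances to \<open>z\<close> and \<open>e\<close> bounds
    \<open>err\<close>.\<close>
  have "summable (\<lambda>n. \<epsilon> * (norm (x n - prox n))\<^sup>2)"
  proof (rule summable_of_quasi_descent[where d = "\<lambda>n. (norm (x n - z))\<^sup>2"
        and e = "\<lambda>n. err n * (2 * d + e)"])
    show "summable (\<lambda>n. err n * (2 * d + e))"
      by (intro summable_mult2 err_summable)
    show "0 \<le> err n * (2 * d + e)" for n
      using err_nonneg[of n] order_trans[OF norm_ge_zero d] order_trans[OF err_nonneg e] by simp
    show "(norm (x (Suc n) - z))\<^sup>2
        \<le> (norm (x n - z))\<^sup>2 - \<epsilon> * (norm (x n - prox n))\<^sup>2 + err n * (2 * d + e)" for n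
    proof -
      define t where "t = norm (next_exact n - z)"
      have desc: "t\<^sup>2 \<le> (norm (x n - z))\<^sup>2 - \<epsilon> * (norm (x n - prox n))\<^sup>2"
        unfolding t_def by (rule exact_descent[OF z])
      then have "t\<^sup>2 \<le> (norm (x n - z))\<^sup>2"
        using \<epsilon> by (smt (verit) mult_nonneg_nonneg zero_le_power2)
      then have "t \<le> norm (x n - z)"
        by (rule power2_le_imp_le) simp
      then have t: "t \<le> d" using d[of n] by simp
      have "norm (x (Suc n) - z) \<le> t + err n"
        using norm_triangle_ineq[of "x (Suc n) - next_exact n" "next_exact n - z"] Suc_near[of n]
        by (simp add: t_def)
      then have "(norm (x (Suc n) - z))\<^sup>2 \<le> (t + err n)\<^sup>2"
        by (rule power_mono) simp
      also have "\<dots> = t\<^sup>2 + err n * (2 * t + err n)"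
        by (simp add: power2_eq_square algebra_simps)
      also have "\<dots> \<le> t\<^sup>2 + err n * (2 * d + e)"
        using t e[of n] err_nonneg[of n] by (intro add_left_mono mult_left_mono) auto
      finally show ?thesis using desc by simp
    qed
  qed (use \<epsilon> in auto)
  then show ?thesis using \<epsilon> by (simp add: summable_cmult_iff)
qed

lemma norm_x_prox: "(\<lambda>n. norm (x n - prox n)) \<longlonglongrightarrow> 0"
proof -
  have "(\<lambda>n. sqrt ((norm (x n - prox n))\<^sup>2)) \<longlonglongrightarrow> sqrt 0"
    by (intro tendsto_real_sqrt summable_LIMSEQ_zero summable_prox)
  then show ?thesis by simp
qed

text \<open>The residual is (x n - prox n)/\<gamma> n minus a difference of values of
  \<open>Q\<close>; the lower bound \<epsilon> on the step sizes keeps the first part comparable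
  with \<open>x n - prox n\<close>.\<close>

lemma residual: "(\<lambda>n. dual n + Q (prox n)) \<longlonglongrightarrow> 0"
proof (rule Lim_null_comparison)
  show "\<forall>\<^sub>F n in sequentially. norm (dual n + Q (prox n)) \<le> (1 / \<epsilon> + \<beta>) * norm (x n - prox n)"
  proof (intro always_eventually allI)
    fix n
    have "dual n + Q (prox n) = (1 / \<gamma> n) *\<^sub>R (x n - prox n) - (Q (x n) - Q (prox n))"
      using step(1)[of n] by (simp add: dual_def scaleR_diff_right)
    then have "norm (dual n + Q (prox n))
        \<le> norm ((1 / \<gamma> n) *\<^sub>R (x n - prox n)) + norm (Q (x n) - Q (prox n))"
      by (simp only: norm_triangle_ineq4)
    also have "\<dots> \<le> 1 / \<epsilon> * norm (x n - prox n) + \<beta> * norm (x n - prox n)"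
    proof (intro add_mono lip in_K prox_in_K)
      have "1 / \<gamma> n \<le> 1 / \<epsilon>" using step(2)[of n] \<epsilon> by (simp add: frac_le)
      then show "norm ((1 / \<gamma> n) *\<^sub>R (x n - prox n)) \<le> 1 / \<epsilon> * norm (x n - prox n)"
        using step(1)[of n] by (simp only: norm_scaleR) (intro mult_right_mono, auto)
    qed
    finally show "norm (dual n + Q (prox n)) \<le> (1 / \<epsilon> + \<beta>) * norm (x n - prox n)"
      by (simp add: distrib_right)
  qed
  show "(\<lambda>n. (1 / \<epsilon> + \<beta>) * norm (x n - prox n)) \<longlonglongrightarrow> 0"
    by (intro tendsto_mult_right_zero norm_x_prox)
qed

text \<open>The point \<open>p n\<close> lies within \<open>err n\<close> of \<open>prox n\<close>,
  and summable errors are square summable because they are eventually below 1.\<close>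

lemma summable_p: "summable (\<lambda>n. (norm (x n - p n))\<^sup>2)"
proof (rule summable_comparison_test')
  have "summable (\<lambda>n. (err n)\<^sup>2)"
  proof -
    have "\<forall>\<^sub>F n in sequentially. err n < 1"
      using order_tendstoD(2)[OF summable_LIMSEQ_zero[OF err_summable], of 1] by simp
    then have "\<forall>\<^sub>F n in sequentially. norm ((err n)\<^sup>2) \<le> err n"
      by eventually_elim (use err_nonneg in \<open>simp add: power2_eq_square mult_left_le\<close>)
    then show ?thesis using err_summable by (rule summable_comparison_test_ev)
  qed
  then show "summable (\<lambda>n. 2 * (norm (x n - prox n))\<^sup>2 + 2 * (err n)\<^sup>2)"
    by (intro summable_add summable_mult summable_prox)
  show "norm ((norm (x n - p n))\<^sup>2) \<le> 2 * (norm (x n - prox n))\<^sup>2 + 2 * (err n)\<^sup>2" for n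
  proof -
    have "norm (x n - p n) \<le> norm (x n - prox n) + norm (p n - prox n)"
      using norm_triangle_ineq4[of "x n - prox n" "p n - prox n"] by simp
    also have "norm (p n - prox n) \<le> err n"
    proof -
      have "err n = (1 / \<beta> * norm (a n) + norm (b n)) + (2 / \<beta> * norm (a n) + norm (b n) + 1 / \<beta> * norm (c n))"
        by (simp add: err_def add_divide_distrib[symmetric])
      moreover have "0 \<le> 2 / \<beta> * norm (a n) + norm (b n) + 1 / \<beta> * norm (c n)"
        using \<beta> by simp
      ultimately show ?thesis using p_prox_near[of n] by linarith
    qed
    finally have "(norm (x n - p n))\<^sup>2 \<le> (norm (x n - prox n) + err n)\<^sup>2"
      by (intro power_mono) auto
    also have "\<dots> \<le> 2 * (norm (x n - prox n))\<^sup>2 + 2 * (err n)\<^sup>2"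
      using zero_le_power2[of "norm (x n - prox n) - err n"]
      by (simp add: power2_sum power2_diff)
    finally show ?thesis by simp
  qed
qed

lemma bounded_prox:   "\<exists>d. \<forall>n. norm (prox n - w) \<le> d"
proof -
  obtain z where z: "(z, - Q z) \<in> R" using solvable by blast
  obtain d where d: "\<And>n. norm (x n - z) \<le> d"
    using convergent_imp_Bseq[OF dist_convergent[OF z]] by (auto simp: Bseq_def)
  obtain d' where d': "\<And>n. norm (x n - prox n) \<le> d'"
    using convergent_imp_Bseq[OF convergentI[OF norm_x_prox]] by (auto simp: Bseq_def)
  have "norm (prox n - w) \<le> d' + d + norm (z - w)" for n
  proof -
    have "prox n - w = - (x n - prox n) + (x n - z) + (z - w)" by simp
    then have "norm (prox n - w) \<le> norm (- (x n - prox n) + (x n - z)) + norm (z - w)"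
      by (metis norm_triangle_ineq)
    also have "\<dots> \<le> norm (- (x n - prox n)) + norm (x n - z) + norm (z - w)"
      by (intro add_right_mono norm_triangle_ineq)
    also have "\<dots> \<le> d' + d + norm (z - w)"
      unfolding norm_minus_cancel by (intro add_mono d d') auto
    finally show ?thesis .
  qed
  then show ?thesis by blast
qed

lemma inner_residual: "(\<lambda>n. (prox n - w) \<bullet> (dual n + Q (prox n))) \<longlonglongrightarrow> 0"
proof -
  obtain d where d: "\<And>n. norm (prox n - w) \<le> d" using bounded_prox by blast
  show ?thesis
  proof (rule Lim_null_comparison)
    show "\<forall>\<^sub>F n in sequentially.
        norm ((prox n - w) \<bullet> (dual n + Q (prox n))) \<le> d * norm (dual n + Q (prox n))"
    proof (intro always_eventually allI)
      show "norm ((prox n - w) \<bullet> (dual n + Q (prox n))) \<le> d * norm (dual n + Q (prox n))" for n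
        using Cauchy_Schwarz_ineq2[of "prox n - w" "dual n + Q (prox n)"]
          mult_right_mono[OF d[of n], of "norm (dual n + Q (prox n))"] by simp
    qed
    show "(\<lambda>n. d * norm (dual n + Q (prox n))) \<longlonglongrightarrow> 0"
      by (intro tendsto_mult_right_zero tendsto_norm_zero residual)
  qed
qed

text \<open>In the monotonicity inequality of \<open>R + Q\<close> between \<open>prox n\<close> and
  a fixed point, the moving dual element is strongly null and the fixed one needs only weak
  convergence. The limit makes \<open>(w, 0)\<close> monotonically related to the graph of
  \<open>R + Q\<close>, and maximality concludes.\<close>

lemma weak_cluster:
  assumes r: "strict_mono r" and w: "weakly_converges_in K (x \<circ> r) w"
  shows "(w, - Q w) \<in> R"
proof -
  have wK: "w \<in> K" using w by (simp add: weakly_converges_in_def)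
  \<comment> \<open>\<open>x n - prox n\<close> is strongly null, so both sequences have the same
    weak limits along \<open>r\<close>.\<close>
  have prox_lim: "(\<lambda>n. prox (r n) \<bullet> u) \<longlonglongrightarrow> w \<bullet> u" if "u \<in> K" for u
  proof -
    have "(\<lambda>n. x n - prox n) \<longlonglongrightarrow> 0"
      using norm_x_prox by (simp add: tendsto_norm_zero_iff)
    then have "(\<lambda>n. x (r n) - prox (r n)) \<longlonglongrightarrow> 0"
      using LIMSEQ_subseq_LIMSEQ[OF _ r] by (simp add: o_def)
    then have "(\<lambda>n. (x (r n) - prox (r n)) \<bullet> u) \<longlonglongrightarrow> 0 \<bullet> u"
      by (intro tendsto_inner tendsto_const)
    moreover have "(\<lambda>n. x (r n) \<bullet> u) \<longlonglongrightarrow> w \<bullet> u"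
      using w that by (simp add: weakly_converges_in_def)
    ultimately have "(\<lambda>n. x (r n) \<bullet> u - (x (r n) - prox (r n)) \<bullet> u) \<longlonglongrightarrow> w \<bullet> u - 0 \<bullet> u"
      by (rule tendsto_diff[rotated])
    then show ?thesis by (simp add: inner_diff_left)
  qed
  have "(w, 0 - Q w) \<in> R"
  proof (rule resolvable_on_lipschitz_perturbation[OF K R Q lip \<beta> wK])
    show "0 \<in> K" using K by (simp add: subspace_0)
    fix y' v assume yv: "(y', v) \<in> R"
    define k where "k = v + Q y'"
    have y': "y' \<in> K" "v \<in> K" using resolvable_onD(1,2)[OF R yv] .
    then have kK: "k \<in> K" unfolding k_def using K Q by (simp add: subspace_add)
    have nonneg: "0 \<le> (prox n - y') \<bullet> (dual n + Q (prox n)) - (prox n \<bullet> k - y' \<bullet> k)" for n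
    proof -
      have "0 \<le> (prox n - y') \<bullet> (dual n - v) + (prox n - y') \<bullet> (Q (prox n) - Q y')"
        by (intro add_nonneg_nonneg resolvable_onD(3)[OF R prox_dual yv] mono prox_in_K y')
      then show ?thesis by (simp add: k_def inner_simps)
    qed
    have "(\<lambda>n. (prox (r n) - y') \<bullet> (dual (r n) + Q (prox (r n))) - (prox (r n) \<bullet> k - y' \<bullet> k))
        \<longlonglongrightarrow> 0 - (w \<bullet> k - y' \<bullet> k)"
      using LIMSEQ_subseq_LIMSEQ[OF inner_residual r]
      by (intro tendsto_diff prox_lim kK tendsto_const) (simp add: o_def)
    then have "0 \<le> 0 - (w \<bullet> k - y' \<bullet> k)"
      using nonneg by (intro tendsto_lowerbound) auto
    then show "0 \<le> (w - y') \<bullet> (0 - (v + Q y'))"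
      by (simp add: k_def[symmetric] inner_diff_left)
  qed auto
  then show ?thesis by simp
qed

text \<open>Opial's lemma gives the limit. The last two sequences are the monotonicity gaps of
  \<open>R\<close> and of \<open>Q\<close> at \<open>w\<close>: both are nonnegative and their sum
  is the null sequence of \<open>inner_residual\<close>. They are the source of all strong
  convergence statements.\<close>

theorem weak_convergence:
  obtains w where "weakly_converges_in K x w" "(w, - Q w) \<in> R"
    "(\<lambda>n. (prox n - w) \<bullet> (dual n + Q w)) \<longlonglongrightarrow> 0"
    "(\<lambda>n. (prox n - w) \<bullet> (Q (prox n) - Q w)) \<longlonglongrightarrow> 0"
proof -
  have "\<exists>w\<in>{w. (w, - Q w) \<in> R}. weakly_converges_in K x w"
  proof (rule opial[OF K, of x "{w. (w, - Q w) \<in> R}"])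
    show "{w. (w, - Q w) \<in> R} \<subseteq> K" using resolvable_onD(1)[OF R] by blast
    show "{w. (w, - Q w) \<in> R} \<noteq> {}" using solvable by blast
    show "convergent (\<lambda>n. norm (x n - z))" if "z \<in> {w. (w, - Q w) \<in> R}" for z
      using that dist_convergent by simp
    show "w \<in> {w. (w, - Q w) \<in> R}" if "strict_mono r" "weakly_converges_in K (x \<circ> r) w" for r w
      using weak_cluster[OF that] by simp
  qed (rule in_K)
  then obtain w where wR: "(w, - Q w) \<in> R" and w: "weakly_converges_in K x w"
    by blast
  have wK: "w \<in> K" using w by (simp add: weakly_converges_in_def)
  have nonneg: "0 \<le> (prox n - w) \<bullet> (dual n + Q w)" "0 \<le> (prox n - w) \<bullet> (Q (prox n) - Q w)" for n
    using resolvable_onD(3)[OF R prox_dual wR] mono[OF prox_in_K wK] by auto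
  have sum: "(prox n - w) \<bullet> (dual n + Q w) + (prox n - w) \<bullet> (Q (prox n) - Q w)
      = (prox n - w) \<bullet> (dual n + Q (prox n))" for n
    by (simp add: inner_simps)
  have "(\<lambda>n. (prox n - w) \<bullet> (dual n + Q w)) \<longlonglongrightarrow> 0"
    by (rule tendsto_sandwich[OF _ _ tendsto_const inner_residual[of w]])
      (use nonneg in \<open>auto simp: sum[symmetric]\<close>)
  moreover have "(\<lambda>n. (prox n - w) \<bullet> (Q (prox n) - Q w)) \<longlonglongrightarrow> 0"
    by (rule tendsto_sandwich[OF _ _ tendsto_const inner_residual[of w]])
      (use nonneg in \<open>auto simp: sum[symmetric]\<close>)
  ultimately show ?thesis using that[OF w wR] by blast
qed

end

section \<open>Operators on products of subspaces\<close>

lemma bounded_linear_onD: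
  assumes "bounded_linear_on H G L"
  shows "x \<in> H \<Longrightarrow> L x \<in> G" "x \<in> H \<Longrightarrow> y \<in> H \<Longrightarrow> L (x + y) = L x + L y"
    "x \<in> H \<Longrightarrow> L (t *\<^sub>R x) = t *\<^sub>R L x" "\<exists>K. \<forall>x\<in>H. norm (L x) \<le> K * norm x"
  using assms unfolding bounded_linear_on_def by auto

lemma bounded_linear_on_diff:
  assumes L: "bounded_linear_on H G L" and "subspace H" "x \<in> H" "y \<in> H"
  shows "L (x - y) = L x - L y"
  using bounded_linear_onD(2)[OF L, of x "- y"] bounded_linear_onD(3)[OF L, of y "-1"] assms
  by (simp add: subspace_neg)

lemma bounded_linear_on_sum:
  assumes L: "bounded_linear_on H G L" and "subspace H" "finite I" "\<And>i. i \<in> I \<Longrightarrow> f i \<in> H"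
  shows "L (\<Sum>i\<in>I. f i) = (\<Sum>i\<in>I. L (f i))"
  using assms(3,4)
proof (induction I rule: finite_induct)
  case empty
  show ?case using bounded_linear_onD(3)[OF L, of 0 0] assms(2) by (simp add: subspace_0)
next
  case (insert i I)
  then show ?case
    using bounded_linear_onD(2)[OF L, of "f i" "\<Sum>i\<in>I. f i"] assms(2) by (simp add: subspace_sum)
qed

lemma bounded_linear_on_comp:
  assumes L: "bounded_linear_on H G L" and N: "bounded_linear_on G X N"
  shows "bounded_linear_on H X (N \<circ> L)"
proof -
  obtain l n where l: "\<And>x. x \<in> H \<Longrightarrow> norm (L x) \<le> l * norm x"
    and n: "\<And>x. x \<in> G \<Longrightarrow> norm (N x) \<le> n * norm x"
    using bounded_linear_onD(4)[OF L] bounded_linear_onD(4)[OF N] by auto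
  have "norm (N (L x)) \<le> (\<bar>n\<bar> * l) * norm x" if "x \<in> H" for x
  proof -
    have "norm (N (L x)) \<le> n * norm (L x)" using n bounded_linear_onD(1)[OF L that] by blast
    also have "\<dots> \<le> \<bar>n\<bar> * norm (L x)" by (intro mult_right_mono) auto
    also have "\<dots> \<le> \<bar>n\<bar> * (l * norm x)" using l[OF that] by (intro mult_left_mono) auto
    finally show ?thesis by simp
  qed
  then show ?thesis
    unfolding bounded_linear_on_def[of H X]
    using bounded_linear_onD(1-3)[OF L] bounded_linear_onD(1-3)[OF N] by auto
qed

lemma norm_le_onorm_on:
  assumes L: "bounded_linear_on H G L" and x: "x \<in> H"
  shows "norm (L x) \<le> onorm_on H L * norm x"
proof (cases "x = 0")
  case True
  then show ?thesis using bounded_linear_onD(3)[OF L x, of 0] by simp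
next
  case False
  obtain K where K: "\<And>x. x \<in> H \<Longrightarrow> norm (L x) \<le> K * norm x"
    using bounded_linear_onD(4)[OF L] by auto
  \<comment> \<open>At \<open>y = 0\<close> the quotient is 0 by the convention for division, so
    that point respects the bound too.\<close>
  have "norm (L y) / norm y \<le> \<bar>K\<bar>" if "y \<in> H" for y
    using order_trans[OF K[OF that] mult_right_mono[OF abs_ge_self norm_ge_zero]]
    by (cases "y = 0") (auto simp: pos_divide_le_eq)
  then have "bdd_above ((\<lambda>x. norm (L x) / norm x) ` H)"
    by (intro bdd_aboveI2)
  then have "norm (L x) / norm x \<le> onorm_on H L"
    unfolding onorm_on_def using x by (intro cSUP_upper)
  then show ?thesis using False by (simp add: pos_divide_le_eq)
qed

text \<open>The value is the Riesz representative of the functional sending \<open>x\<close> to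
  \<open>L x \<bullet> y\<close>; testing with the difference of two candidates gives
  uniqueness.\<close>

lemma adjoint_on:
  fixes L :: "'a::{real_inner, complete_space} \<Rightarrow> 'b::real_inner"
  assumes H: "subspace H" "closed H" and L: "bounded_linear_on H G L"
  shows "adjoint_on H L y \<in> H" "x \<in> H \<Longrightarrow> L x \<bullet> y = x \<bullet> adjoint_on H L y"
proof -
  have "bounded_linear_on H UNIV (\<lambda>x. L x \<bullet> y)"
  proof -
    obtain K where K: "\<And>x. x \<in> H \<Longrightarrow> norm (L x) \<le> K * norm x"
      using bounded_linear_onD(4)[OF L] by auto
    have "norm (L x \<bullet> y) \<le> (K * norm y) * norm x" if "x \<in> H" for x
      using Cauchy_Schwarz_ineq2[of "L x" y] mult_right_mono[OF K[OF that], of "norm y"]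
      by (simp add: algebra_simps)
    then show ?thesis
      unfolding bounded_linear_on_def
      using bounded_linear_onD(2,3)[OF L] by (auto simp: inner_simps)
  qed
  then obtain w where w: "w \<in> H" "\<And>x. x \<in> H \<Longrightarrow> L x \<bullet> y = x \<bullet> w"
    using riesz_on[OF H] by blast
  have "adjoint_on H L y = w"
    unfolding adjoint_on_def
  proof (rule the_equality)
    fix w' assume w': "w' \<in> H \<and> (\<forall>x\<in>H. L x \<bullet> y = x \<bullet> w')"
    then have "w' - w \<in> H" using w(1) H by (simp add: subspace_diff)
    then have "(w' - w) \<bullet> w' = (w' - w) \<bullet> w" using w' w(2) by metis
    then have "(w' - w) \<bullet> (w' - w) = 0" by (simp add: inner_simps)
    then show "w' = w" by simp
  qed (use w in auto)
  with w show "adjoint_on H L y \<in> H" "x \<in> H \<Longrightarrow> L x \<bullet> y = x \<bullet> adjoint_on H L y" by auto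
qed

section \<open>Products, inverses and translates of monotone graphs\<close>

lemma norm_vec_sq: "(norm (x :: 'a::real_inner ^ 'n::finite))\<^sup>2 = (\<Sum>i\<in>UNIV. (norm (x $ i))\<^sup>2)"
  by (simp add: power2_norm_eq_inner inner_vec_def)

lemma norm_prod_sq: "(norm (x :: 'a::real_inner \<times> 'b::real_inner))\<^sup>2 = (norm (fst x))\<^sup>2 + (norm (snd x))\<^sup>2"
  by (simp add: power2_norm_eq_inner inner_prod_def)

lemma subspace_prod_space: "(\<And>i. subspace (H i)) \<Longrightarrow> subspace (prod_space H)"
  by (auto simp: subspace_def prod_space_def)

lemma closed_prod_space:
  fixes H :: "'n::finite \<Rightarrow> 'a::real_normed_vector set"
  assumes "\<And>i. closed (H i)" shows "closed (prod_space H)"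
proof -
  have "prod_space H = (\<Inter>i. (\<lambda>x. x $ i) -` H i)" by (auto simp: prod_space_def)
  then show ?thesis
    using assms by (auto intro!: closed_INT closed_vimage continuous_intros)
qed

lemma resolvable_on_Times:
  assumes R: "resolvable_on K R" and S: "resolvable_on K' S"
  shows "resolvable_on (K \<times> K') {(x, u). (fst x, fst u) \<in> R \<and> (snd x, snd u) \<in> S}"
  unfolding resolvable_on_def
proof (intro conjI allI impI ballI)
  fix x u y v assume x: "(x, u) \<in> {(x, u). (fst x, fst u) \<in> R \<and> (snd x, snd u) \<in> S}"
  then show "x \<in> K \<times> K'" "u \<in> K \<times> K'"
    using resolvable_onD(1,2)[OF R, of "fst x"] resolvable_onD(1,2)[OF S, of "snd x"]
    by (auto simp: mem_Times_iff)
  assume y: "(y, v) \<in> {(x, u). (fst x, fst u) \<in> R \<and> (snd x, snd u) \<in> S}"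
  show "0 \<le> (x - y) \<bullet> (u - v)"
    using x y resolvable_onD(3)[OF R, of "fst x" "fst u" "fst y" "fst v"]
      resolvable_onD(3)[OF S, of "snd x" "snd u" "snd y" "snd v"]
    by (simp add: inner_prod_def)
next
  fix \<mu> :: real and x assume "0 < \<mu>" "x \<in> K \<times> K'"
  then obtain p p' where "(p, (1 / \<mu>) *\<^sub>R (fst x - p)) \<in> R" "(p', (1 / \<mu>) *\<^sub>R (snd x - p')) \<in> S"
    using resolvable_onD(4)[OF R, of \<mu> "fst x"] resolvable_onD(4)[OF S, of \<mu> "snd x"]
    by (auto simp: mem_Times_iff)
  then show "\<exists>p. (p, (1 / \<mu>) *\<^sub>R (x - p)) \<in> {(x, u). (fst x, fst u) \<in> R \<and> (snd x, snd u) \<in> S}"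
    by (intro exI[of _ "(p, p')"]) simp
qed

lemma resolvable_on_prod_space:
  assumes R: "\<And>i. resolvable_on (H i) (R i)"
  shows "resolvable_on (prod_space H) {(x, u). \<forall>i. (x $ i, u $ i) \<in> R i}"
  unfolding resolvable_on_def
proof (intro conjI allI impI ballI)
  fix x u y v assume x: "(x, u) \<in> {(x, u). \<forall>i. (x $ i, u $ i) \<in> R i}"
  then show "x \<in> prod_space H" "u \<in> prod_space H"
    using resolvable_onD(1,2)[OF R] unfolding prod_space_def by blast+
  assume y: "(y, v) \<in> {(x, u). \<forall>i. (x $ i, u $ i) \<in> R i}"
  show "0 \<le> (x - y) \<bullet> (u - v)"
    unfolding inner_vec_def using x y by (auto intro!: sum_nonneg resolvable_onD(3)[OF R])
next
  fix \<mu> :: real and x assume "0 < \<mu>" "x \<in> prod_space H"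
  then have "\<forall>i. \<exists>p. (p, (1 / \<mu>) *\<^sub>R (x $ i - p)) \<in> R i"
    using resolvable_onD(4)[OF R] by (auto simp: prod_space_def)
  then obtain p where "\<And>i. (p i, (1 / \<mu>) *\<^sub>R (x $ i - p i)) \<in> R i" by metis
  then show "\<exists>p. (p, (1 / \<mu>) *\<^sub>R (x - p)) \<in> {(x, u). \<forall>i. (x $ i, u $ i) \<in> R i}"
    by (intro exI[of _ "\<chi> i. p i"]) simp
qed

text \<open>Moreau's decomposition: the resolvent point of the inverse at \<open>x\<close> is
  \<open>x - \<mu> w\<close>, where \<open>w\<close> is the resolvent point of \<open>R\<close> at
  x/\<mu> with parameter 1/\<mu>.\<close>

lemma resolvable_on_converse:
  assumes K: "subspace K" and R: "resolvable_on K R"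
  shows "resolvable_on K (R\<inverse>)"
  unfolding resolvable_on_def
proof (intro conjI allI impI ballI)
  fix x u y v assume x: "(x, u) \<in> R\<inverse>"
  then show "x \<in> K" "u \<in> K" using resolvable_onD(1,2)[OF R] by auto
  assume "(y, v) \<in> R\<inverse>"
  with x show "0 \<le> (x - y) \<bullet> (u - v)"
    using resolvable_onD(3)[OF R, of u x v y] by (simp add: inner_commute)
next
  fix \<mu> :: real and x assume \<mu>: "0 < \<mu>" and "x \<in> K"
  then have "(1 / \<mu>) *\<^sub>R x \<in> K" using K by (simp add: subspace_scale)
  then obtain w where w: "(w, (1 / (1 / \<mu>)) *\<^sub>R ((1 / \<mu>) *\<^sub>R x - w)) \<in> R"
    using resolvable_onD(4)[OF R, of "1 / \<mu>"] \<mu> by auto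
  moreover have "(1 / (1 / \<mu>)) *\<^sub>R ((1 / \<mu>) *\<^sub>R x - w) = x - \<mu> *\<^sub>R w"
    using \<mu> by (simp add: scaleR_diff_right)
  ultimately have "(w, x - \<mu> *\<^sub>R w) \<in> R" by simp
  then show "\<exists>p. (p, (1 / \<mu>) *\<^sub>R (x - p)) \<in> R\<inverse>"
    using \<mu> by (intro exI[of _ "x - \<mu> *\<^sub>R w"]) simp
qed

text \<open>Subtracting the constant \<open>c\<close> from the operator moves the argument of the
  resolvent to \<open>x + \<mu> c\<close>.\<close>

lemma resolvable_on_translate:
  assumes K: "subspace K" and R: "resolvable_on K R" and c: "c \<in> K"
  shows "resolvable_on K {(x, u). (x, u + c) \<in> R}"
  unfolding resolvable_on_def
proof (intro conjI allI impI ballI)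
  fix x u y v assume x: "(x, u) \<in> {(x, u). (x, u + c) \<in> R}"
  then show "x \<in> K" using resolvable_onD(1)[OF R] by auto
  have "u + c \<in> K" using x resolvable_onD(2)[OF R] by auto
  from subspace_diff[OF K this c] show "u \<in> K" by simp
  assume "(y, v) \<in> {(x, u). (x, u + c) \<in> R}"
  with x show "0 \<le> (x - y) \<bullet> (u - v)"
    using resolvable_onD(3)[OF R, of x "u + c" y "v + c"] by simp
next
  fix \<mu> :: real and x assume \<mu>: "0 < \<mu>" and "x \<in> K"
  then have "x + \<mu> *\<^sub>R c \<in> K" using K c by (simp add: subspace_scale subspace_add)
  then obtain p where p: "(p, (1 / \<mu>) *\<^sub>R (x + \<mu> *\<^sub>R c - p)) \<in> R"
    using resolvable_onD(4)[OF R \<mu>] by auto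
  moreover have "(1 / \<mu>) *\<^sub>R (x + \<mu> *\<^sub>R c - p) = (1 / \<mu>) *\<^sub>R (x - p) + c"
    using \<mu> by (simp add: scaleR_diff_right scaleR_add_right)
  ultimately show "\<exists>p. (p, (1 / \<mu>) *\<^sub>R (x - p)) \<in> {(x, u). (x, u + c) \<in> R}" by auto
qed

lemma resolvable_on_zero: "subspace K \<Longrightarrow> resolvable_on K (K \<times> {0})"
  unfolding resolvable_on_def by (auto simp: subspace_0)

section \<open>Strong convergence from uniform monotonicity\<close>

lemma modulus_tendsto:
  assumes \<phi>: "uniform_modulus \<phi>" and t: "t \<longlonglongrightarrow> 0"
    and le: "\<And>n. \<phi> (norm (y n - w)) \<le> ereal (t n)"
  shows "y \<longlonglongrightarrow> w"
proof (rule metric_LIMSEQ_I)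
  fix e :: real assume e: "0 < e"
  then have "0 < \<phi> e"
    using \<phi> unfolding uniform_modulus_def by (metis less_le order.strict_implies_order)
  moreover have "(\<lambda>n. ereal (t n)) \<longlonglongrightarrow> ereal 0" using t by simp
  ultimately have "\<forall>\<^sub>F n in sequentially. ereal (t n) < \<phi> e"
    by (intro order_tendstoD(2)) (auto simp: zero_ereal_def)
  then obtain n0 where n0: "\<And>n. n \<ge> n0 \<Longrightarrow> ereal (t n) < \<phi> e"
    unfolding eventually_sequentially by blast
  have "norm (y n - w) < e" if "n \<ge> n0" for n
  proof (rule ccontr)
    assume "\<not> norm (y n - w) < e"
    \<comment> \<open>As \<phi> is increasing, a distance of at least \<open>e\<close> would keep
      \<open>t n\<close> above the positive value \<open>\<phi> e\<close>.\<close>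
    then have "\<phi> e \<le> \<phi> (norm (y n - w))"
      using \<phi> e unfolding uniform_modulus_def by (auto intro: mono_onD)
    then show False using le[of n] n0[OF that] by (simp add: not_less[symmetric])
  qed
  then show "\<exists>n0. \<forall>n\<ge>n0. dist (y n) w < e" by (auto simp: dist_norm)
qed

lemma uniformly_monotone_tendsto:
  assumes A: "uniformly_monotone_at A w" and u: "(w, u) \<in> gra A" and v: "\<And>n. (y n, v n) \<in> gra A"
    and lim: "(\<lambda>n. (y n - w) \<bullet> (v n - u)) \<longlonglongrightarrow> 0"
  shows "y \<longlonglongrightarrow> w"
proof -
  obtain \<phi> where \<phi>: "uniform_modulus \<phi>"
    and mono: "\<And>u y v. u \<in> A w \<Longrightarrow> (y, v) \<in> gra A \<Longrightarrow> \<phi> (norm (w - y)) \<le> ereal ((w - y) \<bullet> (u - v))"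
    using A unfolding uniformly_monotone_at_def by blast
  show ?thesis
  proof (rule modulus_tendsto[OF \<phi> lim])
    show "\<phi> (norm (y n - w)) \<le> ereal ((y n - w) \<bullet> (v n - u))" for n
    proof -
      have "(y n - w) \<bullet> (v n - u) = (w - y n) \<bullet> (u - v n)" by (simp add: inner_simps)
      then show ?thesis
        using mono[OF _ v[of n], of u] u by (simp add: gra_def norm_minus_commute)
    qed
  qed
qed

section \<open>Norm estimates for four-block vectors\<close>

lemma norm_vec_le_sum: "norm (x :: 'a::real_normed_vector ^ 'n::finite) \<le> (\<Sum>i\<in>UNIV. norm (x $ i))"
  unfolding norm_vec_def by (intro L2_set_le_sum) auto

lemma summable_norm_quadruple:
  fixes a :: "'i::finite \<Rightarrow> nat \<Rightarrow> 'a::real_normed_vector" and b :: "'j::finite \<Rightarrow> nat \<Rightarrow> 'b::real_normed_vector"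
    and c :: "'k::finite \<Rightarrow> nat \<Rightarrow> 'c::real_normed_vector" and d :: "'l::finite \<Rightarrow> nat \<Rightarrow> 'd::real_normed_vector"
  assumes "\<And>i. summable (\<lambda>n. norm (a i n))" "\<And>i. summable (\<lambda>n. norm (b i n))"
    "\<And>i. summable (\<lambda>n. norm (c i n))" "\<And>i. summable (\<lambda>n. norm (d i n))"
  shows "summable (\<lambda>n. norm ((\<chi> i. a i n, \<chi> i. b i n), (\<chi> i. c i n, \<chi> i. d i n)))"
proof (rule summable_comparison_test')
  show "summable (\<lambda>n. ((\<Sum>i\<in>UNIV. norm (a i n)) + (\<Sum>i\<in>UNIV. norm (b i n)))
      + ((\<Sum>i\<in>UNIV. norm (c i n)) + (\<Sum>i\<in>UNIV. norm (d i n))))"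
    by (intro summable_add summable_sum assms)
  show "norm (norm ((\<chi> i. a i n, \<chi> i. b i n), (\<chi> i. c i n, \<chi> i. d i n)))
    \<le> ((\<Sum>i\<in>UNIV. norm (a i n)) + (\<Sum>i\<in>UNIV. norm (b i n)))
      + ((\<Sum>i\<in>UNIV. norm (c i n)) + (\<Sum>i\<in>UNIV. norm (d i n)))" for n
  proof -
    have pair: "norm (u, v) \<le> norm u + norm v" for u :: "'u::real_normed_vector" and v :: "'v::real_normed_vector"
      by (simp add: norm_prod_def sqrt_sum_squares_le_sum)
    show ?thesis
      using pair[of "(\<chi> i. a i n, \<chi> i. b i n)" "(\<chi> i. c i n, \<chi> i. d i n)"]
        pair[of "\<chi> i. a i n" "\<chi> i. b i n"] pair[of "\<chi> i. c i n" "\<chi> i. d i n"]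
        norm_vec_le_sum[of "\<chi> i. a i n"] norm_vec_le_sum[of "\<chi> i. b i n"]
        norm_vec_le_sum[of "\<chi> i. c i n"] norm_vec_le_sum[of "\<chi> i. d i n"] by simp
  qed
qed

lemma norm_component_le:
  fixes w :: "(('a::real_normed_vector ^ 'i::finite) \<times> ('b::real_normed_vector ^ 'j::finite))
    \<times> (('c::real_normed_vector ^ 'k::finite) \<times> ('d::real_normed_vector ^ 'l::finite))"
  shows "norm (fst (fst w) $ i1) \<le> norm w" "norm (snd (fst w) $ i2) \<le> norm w"
    "norm (fst (snd w) $ i3) \<le> norm w" "norm (snd (snd w) $ i4) \<le> norm w"
proof -
  have "norm (fst u) \<le> norm u" "norm (snd u) \<le> norm u"
    for u :: "'u::real_normed_vector \<times> 'v::real_normed_vector"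
    by (simp_all add: norm_prod_def)
  then show "norm (fst (fst w) $ i1) \<le> norm w" "norm (snd (fst w) $ i2) \<le> norm w"
    "norm (fst (snd w) $ i3) \<le> norm w" "norm (snd (snd w) $ i4) \<le> norm w"
    by (meson Finite_Cartesian_Product.norm_nth_le order_trans)+
qed

section \<open>The primal-dual system\<close>

locale structured_system =
  fixes H :: "'m::finite \<Rightarrow> 'h::{real_inner, complete_space} set"
    and G :: "'s::finite \<Rightarrow> 'g::{real_inner, complete_space} set"
    and Y :: "'s \<Rightarrow> 'y::{real_inner, complete_space} set"
    and X :: "'s \<Rightarrow> 'x::{real_inner, complete_space} set"
    and z :: "'m \<Rightarrow> 'h"
    and A :: "'m \<Rightarrow> 'h \<Rightarrow> 'h set"
    and C :: "'m \<Rightarrow> 'h ^ 'm \<Rightarrow> 'h"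
    and r :: "'s \<Rightarrow> 'g"
    and B :: "'s \<Rightarrow> 'y \<Rightarrow> 'y set"
    and D :: "'s \<Rightarrow> 'x \<Rightarrow> 'x set"
    and M :: "'s \<Rightarrow> 'g \<Rightarrow> 'y"
    and N :: "'s \<Rightarrow> 'g \<Rightarrow> 'x"
    and L :: "'s \<Rightarrow> 'm \<Rightarrow> 'h \<Rightarrow> 'g"
    and \<nu>\<^sub>0 \<beta> :: real
  assumes H: "\<And>i. subspace (H i)" "\<And>i. closed (H i)"
    and G: "\<And>k. subspace (G k)" "\<And>k. closed (G k)"
    and Y: "\<And>k. subspace (Y k)" "\<And>k. closed (Y k)"
    and X: "\<And>k. subspace (X k)" "\<And>k. closed (X k)"
    and z: "\<And>i. z i \<in> H i"
    and A: "\<And>i. maximally_monotone_on (H i) (A i)"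
    and C: "\<And>i x. x \<in> prod_space H \<Longrightarrow> C i x \<in> H i"
    and \<nu>\<^sub>0: "\<nu>\<^sub>0 \<ge> 0"
    and C_lipschitz: "\<And>x y. x \<in> prod_space H \<Longrightarrow> y \<in> prod_space H \<Longrightarrow>
          (\<Sum>i\<in>UNIV. (norm (C i x - C i y))\<^sup>2) \<le> \<nu>\<^sub>0\<^sup>2 * (\<Sum>i\<in>UNIV. (norm (x $ i - y $ i))\<^sup>2)"
    and C_monotone: "\<And>x y. x \<in> prod_space H \<Longrightarrow> y \<in> prod_space H \<Longrightarrow>
          (\<Sum>i\<in>UNIV. (C i x - C i y) \<bullet> (x $ i - y $ i)) \<ge> 0"
    and r: "\<And>k. r k \<in> G k"
    and B: "\<And>k. maximally_monotone_on (Y k) (B k)"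
    and D: "\<And>k. maximally_monotone_on (X k) (D k)"
    and M: "\<And>k. bounded_linear_on (G k) (Y k) (M k)"
    and N: "\<And>k. bounded_linear_on (G k) (X k) (N k)"
    and L: "\<And>k i. bounded_linear_on (H i) (G k) (L k i)"
    and \<beta>_def: "\<beta> = \<nu>\<^sub>0 + sqrt ((\<Sum>i\<in>UNIV. \<Sum>k\<in>UNIV. (onorm_on (H i) (N k \<circ> L k i))\<^sup>2)
          + (MAX k. (onorm_on (G k) (N k))\<^sup>2 + (onorm_on (G k) (M k))\<^sup>2))"
begin

abbreviation N_adj :: "'s \<Rightarrow> 'x \<Rightarrow> 'g" where "N_adj k \<equiv> adjoint_on (G k) (N k)"
abbreviation M_adj :: "'s \<Rightarrow> 'y \<Rightarrow> 'g" where "M_adj k \<equiv> adjoint_on (G k) (M k)"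
abbreviation L_adj :: "'s \<Rightarrow> 'm \<Rightarrow> 'g \<Rightarrow> 'h" where "L_adj k i \<equiv> adjoint_on (H i) (L k i)"

text \<open>
  With the primal variable \<open>(x\<^sub>1, x\<^sub>2)\<close> and the dual variable \<open>(v\<^sub>1, v\<^sub>2)\<close> the system reads
  \<open>0 \<in> R w + Q w\<close>, where the linear part \<open>(p, d) \<mapsto> (T_adj d, - T p)\<close> of \<open>Q\<close> is skew.
\<close>

definition T :: "('h ^ 'm) \<times> ('g ^ 's) \<Rightarrow> ('x ^ 's) \<times> ('y ^ 's)"
  where "T p = (\<chi> k. (\<Sum>i\<in>UNIV. N k (L k i (fst p $ i))) - N k (snd p $ k), \<chi> k. M k (snd p $ k))"

definition T_adj :: "('x ^ 's) \<times> ('y ^ 's) \<Rightarrow> ('h ^ 'm) \<times> ('g ^ 's)"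
  where "T_adj d = (\<chi> i. \<Sum>k\<in>UNIV. L_adj k i (N_adj k (fst d $ k)),
    \<chi> k. M_adj k (snd d $ k) - N_adj k (fst d $ k))"

definition F :: "('h ^ 'm) \<times> ('g ^ 's) \<Rightarrow> ('h ^ 'm) \<times> ('g ^ 's)"
  where "F p = (\<chi> i. C i (fst p), 0)"

definition Q :: "(('h ^ 'm) \<times> ('g ^ 's)) \<times> (('x ^ 's) \<times> ('y ^ 's)) \<Rightarrow> (('h ^ 'm) \<times> ('g ^ 's)) \<times> (('x ^ 's) \<times> ('y ^ 's))"
  where "Q w = (F (fst w) + T_adj (snd w), - T (fst w))"

definition K :: "((('h ^ 'm) \<times> ('g ^ 's)) \<times> (('x ^ 's) \<times> ('y ^ 's))) set"
  where "K = (prod_space H \<times> prod_space G) \<times> (prod_space X \<times> prod_space Y)"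

text \<open>Exchanged coordinates express the inverses: the third line says that
  \<open>w1 $ k\<close> lies in the inverse of \<open>D k\<close> at \<open>d1 $ k\<close>,
  translated by \<open>N k (r k)\<close>. The second line is the zero operator on
  \<open>G k\<close>, and \<open>z i\<close> is absorbed into the first.\<close>

definition R :: "(((('h ^ 'm) \<times> ('g ^ 's)) \<times> (('x ^ 's) \<times> ('y ^ 's))) \<times>
    ((('h ^ 'm) \<times> ('g ^ 's)) \<times> (('x ^ 's) \<times> ('y ^ 's)))) set"
  where "R = {(((p1, p2), (d1, d2)), ((u1, u2), (w1, w2))).
    (\<forall>i. (p1 $ i, u1 $ i + z i) \<in> gra (A i)) \<and>
    (\<forall>k. p2 $ k \<in> G k \<and> u2 $ k = 0) \<and>
    (\<forall>k. (w1 $ k - N k (r k), d1 $ k) \<in> gra (D k)) \<and>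
    (\<forall>k. (w2 $ k, d2 $ k) \<in> gra (B k))}"

lemma mem_K: "((p1, p2), (d1, d2)) \<in> K \<longleftrightarrow>
    (\<forall>i. p1 $ i \<in> H i) \<and> (\<forall>k. p2 $ k \<in> G k) \<and> (\<forall>k. d1 $ k \<in> X k) \<and> (\<forall>k. d2 $ k \<in> Y k)"
  by (auto simp: K_def prod_space_def)

lemma K: "subspace K" "closed K"
  unfolding K_def using H G X Y
  by (auto intro!: subspace_Times closed_Times subspace_prod_space closed_prod_space)

lemma N_r: "N k (r k) \<in> X k"
  using bounded_linear_onD(1)[OF N r] .

lemmas A_resolvable = maximally_monotone_resolvable[OF H A]
  and B_resolvable = maximally_monotone_resolvable[OF Y B]
  and D_resolvable = maximally_monotone_resolvable[OF X D]

lemma R_resolvable: "resolvable_on K R"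
proof -
  define RA where "RA i = {(x, u). (x, u + z i) \<in> gra (A i)}" for i
  define RG :: "'s \<Rightarrow> ('g \<times> 'g) set" where "RG k = G k \<times> {0}" for k
  define RD where "RD k = {(x, u). (x, u + - N k (r k)) \<in> (gra (D k))\<inverse>}" for k
  define RB where "RB k = (gra (B k))\<inverse>" for k
  have "resolvable_on (H i) (RA i)" for i
    unfolding RA_def by (rule resolvable_on_translate[OF H(1) A_resolvable z])
  moreover have "resolvable_on (G k) (RG k)" for k
    unfolding RG_def by (rule resolvable_on_zero[OF G(1)])
  moreover have "resolvable_on (X k) (RD k)" for k
    unfolding RD_def
    by (intro resolvable_on_translate resolvable_on_converse X D_resolvable subspace_neg N_r)
  moreover have "resolvable_on (Y k) (RB k)" for k
    unfolding RB_def by (intro resolvable_on_converse Y B_resolvable)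
  ultimately have "resolvable_on K {(x, u).
      (fst x, fst u) \<in> {(x, u). (fst x, fst u) \<in> {(x, u). \<forall>i. (x $ i, u $ i) \<in> RA i} \<and>
        (snd x, snd u) \<in> {(x, u). \<forall>k. (x $ k, u $ k) \<in> RG k}} \<and>
      (snd x, snd u) \<in> {(x, u). (fst x, fst u) \<in> {(x, u). \<forall>k. (x $ k, u $ k) \<in> RD k} \<and>
        (snd x, snd u) \<in> {(x, u). \<forall>k. (x $ k, u $ k) \<in> RB k}}}"
    unfolding K_def by (intro resolvable_on_Times resolvable_on_prod_space)
  also have "{(x, u).
      (fst x, fst u) \<in> {(x, u). (fst x, fst u) \<in> {(x, u). \<forall>i. (x $ i, u $ i) \<in> RA i} \<and>
        (snd x, snd u) \<in> {(x, u). \<forall>k. (x $ k, u $ k) \<in> RG k}} \<and>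
      (snd x, snd u) \<in> {(x, u). (fst x, fst u) \<in> {(x, u). \<forall>k. (x $ k, u $ k) \<in> RD k} \<and>
        (snd x, snd u) \<in> {(x, u). \<forall>k. (x $ k, u $ k) \<in> RB k}}} = R"
    unfolding R_def RA_def RG_def RD_def RB_def by auto
  finally show ?thesis .
qed

section \<open>The skew coupling and the Lipschitz constant of \<open>Q\<close>\<close>

lemma T_in: "p \<in> prod_space H \<times> prod_space G \<Longrightarrow> T p \<in> prod_space X \<times> prod_space Y"
  using bounded_linear_onD(1)[OF N] bounded_linear_onD(1)[OF M] bounded_linear_onD(1)[OF L] X
  by (auto simp: T_def prod_space_def intro!: subspace_diff subspace_sum)

lemma T_adj_in: "T_adj d \<in> prod_space H \<times> prod_space G"
  using adjoint_on(1)[OF H L] adjoint_on(1)[OF G N] adjoint_on(1)[OF G M] H G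
  by (auto simp: T_adj_def prod_space_def intro!: subspace_diff subspace_sum)

lemma Q_in_K: "w \<in> K \<Longrightarrow> Q w \<in> K"
  using T_in T_adj_in[of "snd w"] C H G X Y
  by (auto simp: K_def Q_def F_def prod_space_def mem_Times_iff subspace_0 subspace_neg
      intro!: subspace_add)

lemma T_adjoint:
  assumes p: "p \<in> prod_space H \<times> prod_space G"
  shows "T p \<bullet> d = p \<bullet> T_adj d"
proof -
  have pH: "fst p $ i \<in> H i" and pG: "snd p $ k \<in> G k" for i k
    using p by (auto simp: prod_space_def)
  have NL: "N k (L k i (fst p $ i)) \<bullet> v = fst p $ i \<bullet> L_adj k i (N_adj k v)" for i k v
    using adjoint_on(2)[OF G N bounded_linear_onD(1)[OF L pH]] adjoint_on(2)[OF H L pH] by metis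
  have "T p \<bullet> d = (\<Sum>k\<in>UNIV. (\<Sum>i\<in>UNIV. fst p $ i \<bullet> L_adj k i (N_adj k (fst d $ k)))
      - snd p $ k \<bullet> N_adj k (fst d $ k)) + (\<Sum>k\<in>UNIV. snd p $ k \<bullet> M_adj k (snd d $ k))"
    unfolding T_def inner_prod_def inner_vec_def
    by (simp add: inner_diff_left inner_sum_left NL adjoint_on(2)[OF G N pG] adjoint_on(2)[OF G M pG])
  also have "\<dots> = (\<Sum>k\<in>UNIV. \<Sum>i\<in>UNIV. fst p $ i \<bullet> L_adj k i (N_adj k (fst d $ k)))
      + (\<Sum>k\<in>UNIV. snd p $ k \<bullet> (M_adj k (snd d $ k) - N_adj k (fst d $ k)))"
    by (simp add: inner_diff_right sum_subtractf)
  also have "(\<Sum>k\<in>UNIV. \<Sum>i\<in>UNIV. fst p $ i \<bullet> L_adj k i (N_adj k (fst d $ k)))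
      = (\<Sum>i\<in>UNIV. \<Sum>k\<in>UNIV. fst p $ i \<bullet> L_adj k i (N_adj k (fst d $ k)))"
    by (rule sum.swap)
  finally show ?thesis
    unfolding T_adj_def inner_prod_def inner_vec_def by (simp add: inner_sum_right)
qed

lemma T_diff:
  assumes "p \<in> prod_space H \<times> prod_space G" "q \<in> prod_space H \<times> prod_space G"
  shows "T p - T q = T (p - q)"
proof -
  have mem: "fst p $ i \<in> H i" "snd p $ k \<in> G k" "fst q $ i \<in> H i" "snd q $ k \<in> G k" for i k
    using assms by (auto simp: prod_space_def)
  have "N k (L k i (fst p $ i - fst q $ i)) = N k (L k i (fst p $ i)) - N k (L k i (fst q $ i))" for i k
    using bounded_linear_on_diff[OF L H(1)] bounded_linear_on_diff[OF N G(1)]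
      bounded_linear_onD(1)[OF L] mem by metis
  then show ?thesis
    unfolding T_def using mem
    by (simp add: prod_eq_iff vec_eq_iff sum_subtractf bounded_linear_on_diff[OF N G(1)]
        bounded_linear_on_diff[OF M G(1)])
qed

text \<open>The share of \<beta> due to the coupling: an upper bound for the norm of
  \<open>T\<close>, not necessarily its exact value.\<close>

definition \<tau> :: real
  where "\<tau> = sqrt ((\<Sum>i\<in>UNIV. \<Sum>k\<in>UNIV. (onorm_on (H i) (N k \<circ> L k i))\<^sup>2)
          + (MAX k. (onorm_on (G k) (N k))\<^sup>2 + (onorm_on (G k) (M k))\<^sup>2))"

text \<open>Split \<open>T\<close> by its two arguments. The first part mixes all indices, so
  Cauchy-Schwarz produces the double sum \<open>a\<close>; the second acts on each \<open>k\<close>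
  separately, so the maximum \<open>b\<close> suffices. A planar Cauchy-Schwarz inequality joins the
  two into the square root of \<open>a + b\<close>.\<close>

lemma T_bound:
  assumes p: "p \<in> prod_space H \<times> prod_space G"
  shows "norm (T p) \<le> \<tau> * norm p"
proof -
  define a where "a = (\<Sum>i\<in>UNIV. \<Sum>k\<in>UNIV. (onorm_on (H i) (N k \<circ> L k i))\<^sup>2)"
  define b where "b = (MAX k. (onorm_on (G k) (N k))\<^sup>2 + (onorm_on (G k) (M k))\<^sup>2)"
  have pH: "fst p $ i \<in> H i" and pG: "snd p $ k \<in> G k" for i k
    using p by (auto simp: prod_space_def)
  have a: "0 \<le> a" unfolding a_def by (intro sum_nonneg) auto
  have b_ge: "(onorm_on (G k) (N k))\<^sup>2 + (onorm_on (G k) (M k))\<^sup>2 \<le> b" for k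
    unfolding b_def by (intro Max_ge) auto
  then have b: "0 \<le> b" by (meson add_nonneg_nonneg order_trans zero_le_power2)
  define T1 :: "('x ^ 's) \<times> ('y ^ 's)" where "T1 = (\<chi> k. \<Sum>i\<in>UNIV. N k (L k i (fst p $ i)), 0)"
  define T2 :: "('x ^ 's) \<times> ('y ^ 's)" where "T2 = (\<chi> k. - N k (snd p $ k), \<chi> k. M k (snd p $ k))"
  have "(norm (\<Sum>i\<in>UNIV. N k (L k i (fst p $ i))))\<^sup>2
      \<le> (\<Sum>i\<in>UNIV. (onorm_on (H i) (N k \<circ> L k i))\<^sup>2) * (norm (fst p))\<^sup>2" for k
  proof -
    have "norm (\<Sum>i\<in>UNIV. N k (L k i (fst p $ i))) \<le> (\<Sum>i\<in>UNIV. norm (N k (L k i (fst p $ i))))"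
      by (rule norm_sum)
    also have "\<dots> \<le> (\<Sum>i\<in>UNIV. onorm_on (H i) (N k \<circ> L k i) * norm (fst p $ i))"
      using norm_le_onorm_on[OF bounded_linear_on_comp[OF L N] pH] by (intro sum_mono) simp
    finally have "(norm (\<Sum>i\<in>UNIV. N k (L k i (fst p $ i))))\<^sup>2
        \<le> (\<Sum>i\<in>UNIV. onorm_on (H i) (N k \<circ> L k i) * norm (fst p $ i))\<^sup>2"
      by (rule power_mono) simp
    also have "\<dots> \<le> (\<Sum>i\<in>UNIV. (onorm_on (H i) (N k \<circ> L k i))\<^sup>2) * (\<Sum>i\<in>UNIV. (norm (fst p $ i))\<^sup>2)"
      by (rule Cauchy_Schwarz_ineq_sum)
    finally show ?thesis by (simp add: norm_vec_sq)
  qed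
  then have "(norm T1)\<^sup>2 \<le> (\<Sum>k\<in>UNIV. (\<Sum>i\<in>UNIV. (onorm_on (H i) (N k \<circ> L k i))\<^sup>2) * (norm (fst p))\<^sup>2)"
    unfolding norm_prod_sq norm_vec_sq[of "fst T1"] by (auto simp: T1_def intro!: sum_mono)
  also have "\<dots> = a * (norm (fst p))\<^sup>2"
    unfolding a_def by (subst sum.swap) (simp add: sum_distrib_right)
  finally have "norm T1 \<le> sqrt (a * (norm (fst p))\<^sup>2)"
    by (rule real_le_rsqrt)
  then have T1: "norm T1 \<le> sqrt a * norm (fst p)"
    by (simp add: real_sqrt_mult)
  have "(norm (N k (snd p $ k)))\<^sup>2 + (norm (M k (snd p $ k)))\<^sup>2 \<le> b * (norm (snd p $ k))\<^sup>2" for k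
  proof -
    have "(norm (N k (snd p $ k)))\<^sup>2 + (norm (M k (snd p $ k)))\<^sup>2
        \<le> (onorm_on (G k) (N k) * norm (snd p $ k))\<^sup>2 + (onorm_on (G k) (M k) * norm (snd p $ k))\<^sup>2"
      using norm_le_onorm_on[OF N pG] norm_le_onorm_on[OF M pG]
      by (intro add_mono power_mono) auto
    also have "\<dots> = ((onorm_on (G k) (N k))\<^sup>2 + (onorm_on (G k) (M k))\<^sup>2) * (norm (snd p $ k))\<^sup>2"
      by (simp add: power_mult_distrib distrib_right)
    also have "\<dots> \<le> b * (norm (snd p $ k))\<^sup>2"
      by (intro mult_right_mono b_ge) auto
    finally show ?thesis .
  qed
  then have "(norm T2)\<^sup>2 \<le> (\<Sum>k\<in>UNIV. b * (norm (snd p $ k))\<^sup>2)"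
    unfolding norm_prod_sq norm_vec_sq[of "fst T2"] norm_vec_sq[of "snd T2"]
    by (auto simp: T2_def sum.distrib[symmetric] intro!: sum_mono)
  also have "\<dots> = b * (norm (snd p))\<^sup>2"
    by (simp add: norm_vec_sq sum_distrib_left)
  finally have "norm T2 \<le> sqrt (b * (norm (snd p))\<^sup>2)"
    by (rule real_le_rsqrt)
  then have T2: "norm T2 \<le> sqrt b * norm (snd p)"
    by (simp add: real_sqrt_mult)
  have "T p = T1 + T2"
    unfolding T_def T1_def T2_def by (simp add: prod_eq_iff vec_eq_iff)
  then have "norm (T p) \<le> sqrt a * norm (fst p) + sqrt b * norm (snd p)"
    using norm_triangle_ineq[of T1 T2] T1 T2 by simp
  also have "\<dots> \<le> sqrt ((a + b) * ((norm (fst p))\<^sup>2 + (norm (snd p))\<^sup>2))"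
  proof (rule real_le_rsqrt)
    \<comment> \<open>Lagrange's identity; dropping the second square is the planar Cauchy-Schwarz
      inequality.\<close>
    have lagrange: "(x * u + y * v)\<^sup>2 + (x * v - y * u)\<^sup>2 = (x\<^sup>2 + y\<^sup>2) * (u\<^sup>2 + v\<^sup>2)"
      for x y u v :: real by (simp add: power2_eq_square algebra_simps)
    have "(sqrt a * norm (fst p) + sqrt b * norm (snd p))\<^sup>2
        + (sqrt a * norm (snd p) - sqrt b * norm (fst p))\<^sup>2
        = ((sqrt a)\<^sup>2 + (sqrt b)\<^sup>2) * ((norm (fst p))\<^sup>2 + (norm (snd p))\<^sup>2)"
      by (rule lagrange)
    then show "(sqrt a * norm (fst p) + sqrt b * norm (snd p))\<^sup>2
        \<le> (a + b) * ((norm (fst p))\<^sup>2 + (norm (snd p))\<^sup>2)"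
      unfolding real_sqrt_pow2[OF a] real_sqrt_pow2[OF b]
      using zero_le_power2[of "sqrt a * norm (snd p) - sqrt b * norm (fst p)"] by linarith
  qed
  also have "\<dots> = \<tau> * norm p"
    unfolding norm_prod_sq[symmetric] real_sqrt_mult by (simp add: \<tau>_def a_def b_def)
  finally show ?thesis .
qed

lemma \<tau>_nonneg: "0 \<le> \<tau>"
proof -
  have "(0::real) \<le> (onorm_on (G undefined) (N undefined))\<^sup>2 + (onorm_on (G undefined) (M undefined))\<^sup>2" by simp
  also have "\<dots> \<le> (MAX k. (onorm_on (G k) (N k))\<^sup>2 + (onorm_on (G k) (M k))\<^sup>2)"
    by (intro Max_ge) auto
  finally show ?thesis
    unfolding \<tau>_def by (auto intro!: add_nonneg_nonneg sum_nonneg)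
qed

text \<open>For \<open>p = T_adj d - T_adj e\<close> the adjoint identity gives |p|^2 =
  \<open>T p \<bullet> (d - e)\<close>, so the bound for \<open>T\<close> carries over with the same
  constant.\<close>

lemma T_adj_bound:
  assumes d: "d \<in> prod_space X \<times> prod_space Y" "e \<in> prod_space X \<times> prod_space Y"
  shows "norm (T_adj d - T_adj e) \<le> \<tau> * norm (d - e)"
proof -
  define p where "p = T_adj d - T_adj e"
  have p: "p \<in> prod_space H \<times> prod_space G"
    unfolding p_def using T_adj_in subspace_diff[OF subspace_Times[OF subspace_prod_space subspace_prod_space]] H G
    by blast
  have "(norm p)\<^sup>2 = T p \<bullet> (d - e)"
    using T_adjoint[OF p] by (simp add: p_def power2_norm_eq_inner inner_diff_right)
  also have "\<dots> \<le> norm (T p) * norm (d - e)"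
    by (rule norm_cauchy_schwarz)
  also have "\<dots> \<le> (\<tau> * norm p) * norm (d - e)"
    by (intro mult_right_mono T_bound[OF p]) auto
  finally have "norm p * norm p \<le> norm p * (\<tau> * norm (d - e))"
    by (simp add: power2_eq_square algebra_simps)
  then show ?thesis
    using \<tau>_nonneg by (cases "p = 0") (auto simp: p_def[symmetric])
qed

text \<open>The coupling sends the primal and dual differences into orthogonal components, each with
  factor \<tau>, so the whole skew part has constant \<tau>; \<open>C\<close> adds
  \<open>\<nu>\<^sub>0\<close> by the triangle inequality.\<close>

lemma Q_lipschitz:
  assumes "w \<in> K" "w' \<in> K"
  shows "norm (Q w - Q w') \<le> \<beta> * norm (w - w')"
proof -
  obtain p d p' d' where w: "w = (p, d)" "w' = (p', d')" by (cases w, cases w')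
  have mem: "p \<in> prod_space H \<times> prod_space G" "p' \<in> prod_space H \<times> prod_space G"
    "d \<in> prod_space X \<times> prod_space Y" "d' \<in> prod_space X \<times> prod_space Y"
    using assms by (auto simp: w K_def)
  have "Q w - Q w' = (F p - F p', 0) + (T_adj d - T_adj d', - (T p - T p'))"
    by (simp add: Q_def w)
  then have "norm (Q w - Q w')
      \<le> norm (F p - F p', 0 :: ('x ^ 's) \<times> ('y ^ 's)) + norm (T_adj d - T_adj d', - (T p - T p'))"
    by (simp only: norm_triangle_ineq)
  also have "norm (F p - F p', 0 :: ('x ^ 's) \<times> ('y ^ 's)) \<le> \<nu>\<^sub>0 * norm (w - w')"
  proof -
    have "(norm (F p - F p'))\<^sup>2 \<le> \<nu>\<^sub>0\<^sup>2 * (norm (fst p - fst p'))\<^sup>2"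
      using C_lipschitz[of "fst p" "fst p'"] mem
      by (auto simp: norm_prod_sq F_def norm_vec_sq)
    also have "\<dots> \<le> \<nu>\<^sub>0\<^sup>2 * (norm (w - w'))\<^sup>2"
      by (intro mult_left_mono) (auto simp: norm_prod_sq w)
    finally have "(norm (F p - F p'))\<^sup>2 \<le> (\<nu>\<^sub>0 * norm (w - w'))\<^sup>2"
      by (simp add: power_mult_distrib)
    then have "norm (F p - F p') \<le> \<nu>\<^sub>0 * norm (w - w')"
      by (rule power2_le_imp_le) (use \<nu>\<^sub>0 in simp)
    then show ?thesis by (simp add: norm_prod_def)
  qed
  also have "norm (T_adj d - T_adj d', - (T p - T p')) \<le> \<tau> * norm (w - w')"
  proof (rule power2_le_imp_le)
    have "(norm (T_adj d - T_adj d', - (T p - T p')))\<^sup>2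
        = (norm (T_adj d - T_adj d'))\<^sup>2 + (norm (T (p - p')))\<^sup>2"
      unfolding T_diff[OF mem(1,2)] by (simp add: norm_prod_sq)
    also have "\<dots> \<le> (\<tau> * norm (d - d'))\<^sup>2 + (\<tau> * norm (p - p'))\<^sup>2"
    proof (intro add_mono power_mono T_adj_bound T_bound mem)
      show "p - p' \<in> prod_space H \<times> prod_space G"
        using mem H G subspace_diff[OF subspace_Times[OF subspace_prod_space subspace_prod_space]]
        by blast
    qed auto
    also have "\<dots> = (\<tau> * norm (w - w'))\<^sup>2"
      by (simp add: power_mult_distrib norm_prod_sq[of "(p - p', d - d')"] w distrib_left)
    finally show "(norm (T_adj d - T_adj d', - (T p - T p')))\<^sup>2 \<le> (\<tau> * norm (w - w'))\<^sup>2" .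
  qed (use \<tau>_nonneg in simp)
  finally show ?thesis
    by (simp add: \<beta>_def \<tau>_def distrib_right)
qed

text \<open>The skew parts cancel, so only the operators \<open>C i\<close> are seen. This yields
  monotonicity of \<open>Q\<close> and later identifies its gap with the expression in the
  assumptions on \<open>C\<close>.\<close>

lemma Q_inner:
  assumes "w \<in> K" "w' \<in> K"
  shows "(w - w') \<bullet> (Q w - Q w')
    = (\<Sum>i\<in>UNIV. (C i (fst (fst w)) - C i (fst (fst w'))) \<bullet> (fst (fst w) $ i - fst (fst w') $ i))"
proof -
  obtain p d p' d' where w: "w = (p, d)" "w' = (p', d')" by (cases w, cases w')
  have mem: "p \<in> prod_space H \<times> prod_space G" "p' \<in> prod_space H \<times> prod_space G"
    using assms by (auto simp: w K_def)
  have pp: "p - p' \<in> prod_space H \<times> prod_space G"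
    using mem H G subspace_diff[OF subspace_Times[OF subspace_prod_space subspace_prod_space]]
    by blast
  have "(w - w') \<bullet> (Q w - Q w')
      = (p - p') \<bullet> (F p - F p') + (p - p') \<bullet> (T_adj d - T_adj d') - (d - d') \<bullet> (T p - T p')"
    by (simp add: w Q_def inner_Pair inner_simps)
  also have "(d - d') \<bullet> (T p - T p') = (p - p') \<bullet> (T_adj d - T_adj d')"
    unfolding T_diff[OF mem] using T_adjoint[OF pp, of d] T_adjoint[OF pp, of d']
    by (simp add: inner_commute[of "d - d'"] inner_diff_right)
  also have "(p - p') \<bullet> (F p - F p')
      = (\<Sum>i\<in>UNIV. (C i (fst p) - C i (fst p')) \<bullet> (fst p $ i - fst p' $ i))"
    by (simp add: F_def inner_prod_def inner_vec_def inner_commute)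
  finally show ?thesis by (simp add: w)
qed

lemma Q_monotone: "w \<in> K \<Longrightarrow> w' \<in> K \<Longrightarrow> (w - w') \<bullet> (Q w - Q w') \<ge> 0"
  unfolding Q_inner by (rule C_monotone) (auto simp: K_def)

section \<open>Zeros of \<open>R + Q\<close> and solutions of the system\<close>

lemma zero_iff:
  "(((p1, p2), (d1, d2)), - Q ((p1, p2), (d1, d2))) \<in> R \<longleftrightarrow>
    (\<forall>i. (p1 $ i, z i - (C i p1 + (\<Sum>k\<in>UNIV. L_adj k i (N_adj k (d1 $ k))))) \<in> gra (A i)) \<and>
    (\<forall>k. p2 $ k \<in> G k \<and> N_adj k (d1 $ k) = M_adj k (d2 $ k)) \<and>
    (\<forall>k. ((\<Sum>i\<in>UNIV. N k (L k i (p1 $ i))) - N k (p2 $ k) - N k (r k), d1 $ k) \<in> gra (D k)) \<and>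
    (\<forall>k. (M k (p2 $ k), d2 $ k) \<in> gra (B k))"
  unfolding R_def Q_def F_def T_def T_adj_def by (simp add: algebra_simps)

lemma N_linear:
  assumes "\<And>i. p1 i \<in> H i" "q \<in> G k"
  shows "(\<Sum>i\<in>UNIV. N k (L k i (p1 i))) - N k q - N k (r k) = N k ((\<Sum>i\<in>UNIV. L k i (p1 i)) - r k - q)"
    "N k (\<Sum>i\<in>UNIV. L k i (p1 i)) = (\<Sum>i\<in>UNIV. N k (L k i (p1 i)))"
proof -
  have mem: "L k i (p1 i) \<in> G k" for i
    using bounded_linear_onD(1)[OF L] assms by blast
  then have sum: "(\<Sum>i\<in>UNIV. L k i (p1 i)) \<in> G k"
    using G by (intro subspace_sum) auto
  show *: "N k (\<Sum>i\<in>UNIV. L k i (p1 i)) = (\<Sum>i\<in>UNIV. N k (L k i (p1 i)))"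
    using mem by (intro bounded_linear_on_sum[OF N G(1)]) auto
  show "(\<Sum>i\<in>UNIV. N k (L k i (p1 i))) - N k q - N k (r k) = N k ((\<Sum>i\<in>UNIV. L k i (p1 i)) - r k - q)"
    using sum r assms(2) G by (simp add: bounded_linear_on_diff[OF N G(1)] subspace_diff *)
qed

text \<open>The auxiliary variable \<open>p2 $ k\<close> is the summand belonging to
  \<open>M k\<close> and \<open>B k\<close>, the remainder of the residual belongs to
  \<open>N k\<close> and \<open>D k\<close>; the zero \<open>G\<close>-block makes both take the
  same dual value.\<close>

lemma zero_imp_solution:
  assumes "(((p1, p2), (d1, d2)), - Q ((p1, p2), (d1, d2))) \<in> R"
  shows "(p1, \<lambda>k. N_adj k (d1 $ k)) \<in> solutions H G z A C r B D M N L"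
proof -
  note zero = assms[unfolded zero_iff]
  have p1: "p1 $ i \<in> H i" for i
    using zero resolvable_onD(1)[OF A_resolvable] by blast
  have p2: "p2 $ k \<in> G k" for k using zero by blast
  have mem: "(\<Sum>i\<in>UNIV. L k i (p1 $ i)) - r k - p2 $ k \<in> G k" for k
    using bounded_linear_onD(1)[OF L] p1 p2 G r by (intro subspace_diff subspace_sum) auto
  have "z i - (\<Sum>k\<in>UNIV. L_adj k i (N_adj k (d1 $ k))) \<in> A i (p1 $ i) + {C i p1}" for i
  proof -
    have "z i - (C i p1 + (\<Sum>k\<in>UNIV. L_adj k i (N_adj k (d1 $ k)))) \<in> A i (p1 $ i)"
      using zero unfolding gra_def by blast
    from set_plus_intro[OF this, of "C i p1" "{C i p1}"] show ?thesis by (simp add: algebra_simps)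
  qed
  moreover have "(\<Sum>i\<in>UNIV. L k i (p1 $ i)) - r k \<in>
      op_inv (adjoint_sandwich (G k) (M k) (B k)) (N_adj k (d1 $ k)) +
      op_inv (adjoint_sandwich (G k) (N k) (D k)) (N_adj k (d1 $ k))" for k
  proof -
    have "p2 $ k \<in> op_inv (adjoint_sandwich (G k) (M k) (B k)) (N_adj k (d1 $ k))"
    proof -
      have "d2 $ k \<in> B k (M k (p2 $ k))" "N_adj k (d1 $ k) = M_adj k (d2 $ k)"
        using zero unfolding gra_def by blast+
      then show ?thesis using p2 by (simp add: op_inv_def adjoint_sandwich_def)
    qed
    moreover have "(\<Sum>i\<in>UNIV. L k i (p1 $ i)) - r k - p2 $ k
        \<in> op_inv (adjoint_sandwich (G k) (N k) (D k)) (N_adj k (d1 $ k))"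
    proof -
      have "d1 $ k \<in> D k (N k ((\<Sum>i\<in>UNIV. L k i (p1 $ i)) - r k - p2 $ k))"
        using zero unfolding gra_def N_linear(1)[of "\<lambda>i. p1 $ i", OF p1 p2] by blast
      then show ?thesis using mem by (simp add: op_inv_def adjoint_sandwich_def)
    qed
    ultimately have "p2 $ k + ((\<Sum>i\<in>UNIV. L k i (p1 $ i)) - r k - p2 $ k) \<in>
      op_inv (adjoint_sandwich (G k) (M k) (B k)) (N_adj k (d1 $ k)) +
      op_inv (adjoint_sandwich (G k) (N k) (D k)) (N_adj k (d1 $ k))"
      by (rule set_plus_intro)
    then show ?thesis by simp
  qed
  moreover have "p1 \<in> prod_space H" using p1 by (simp add: prod_space_def)
  ultimately show ?thesis
    unfolding solutions_def using adjoint_on(1)[OF G N] by auto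
qed

lemma solution_imp_zero:
  assumes "solutions H G z A C r B D M N L \<noteq> {}"
  shows "\<exists>w. (w, - Q w) \<in> R"
proof -
  obtain x v where xv: "(x, v) \<in> solutions H G z A C r B D M N L"
    using assms by auto
  then have x: "\<And>i. x $ i \<in> H i"
    and xA: "\<And>i. z i - (\<Sum>k\<in>UNIV. L_adj k i (v k)) \<in> A i (x $ i) + {C i x}"
    and xG: "\<And>k. (\<Sum>i\<in>UNIV. L k i (x $ i)) - r k \<in>
      op_inv (adjoint_sandwich (G k) (M k) (B k)) (v k) +
      op_inv (adjoint_sandwich (G k) (N k) (D k)) (v k)"
    unfolding solutions_def prod_space_def by simp_all
  \<comment> \<open>Each splitting of the parallel sum supplies the auxiliary primal point
    \<open>y\<close>, and the two sandwiched operators supply preimages \<open>e\<close> and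
    \<open>d\<close> of the common dual value \<open>v k\<close>.\<close>
  have "\<forall>k. \<exists>y d e. y \<in> G k \<and> e \<in> B k (M k y) \<and> v k = M_adj k e
      \<and> d \<in> D k (N k ((\<Sum>i\<in>UNIV. L k i (x $ i)) - r k - y)) \<and> v k = N_adj k d"
  proof
    fix k
    obtain y y' where "(\<Sum>i\<in>UNIV. L k i (x $ i)) - r k = y + y'"
      and y: "v k \<in> adjoint_sandwich (G k) (M k) (B k) y" "v k \<in> adjoint_sandwich (G k) (N k) (D k) y'"
      using xG[of k] by (auto simp: op_inv_def elim!: set_plus_elim)
    then have y': "y' = (\<Sum>i\<in>UNIV. L k i (x $ i)) - r k - y" by simp
    show "\<exists>y d e. y \<in> G k \<and> e \<in> B k (M k y) \<and> v k = M_adj k e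
      \<and> d \<in> D k (N k ((\<Sum>i\<in>UNIV. L k i (x $ i)) - r k - y)) \<and> v k = N_adj k d"
    proof -
      from y(1) obtain e where e: "y \<in> G k" "e \<in> B k (M k y)" "v k = M_adj k e"
        unfolding adjoint_sandwich_def by (auto split: if_splits)
      from y(2) obtain d where "d \<in> D k (N k y')" "v k = N_adj k d"
        unfolding adjoint_sandwich_def by (auto split: if_splits)
      with e show ?thesis unfolding y' by blast
    qed
  qed
  then obtain y d e where yde: "\<forall>k. y k \<in> G k \<and> e k \<in> B k (M k (y k)) \<and> v k = M_adj k (e k)
      \<and> d k \<in> D k (N k ((\<Sum>i\<in>UNIV. L k i (x $ i)) - r k - y k)) \<and> v k = N_adj k (d k)"
    unfolding choice_iff by (elim exE) (rule that)
  then have y: "\<And>k. y k \<in> G k" "\<And>k. e k \<in> B k (M k (y k))" "\<And>k. v k = M_adj k (e k)"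
    "\<And>k. d k \<in> D k (N k ((\<Sum>i\<in>UNIV. L k i (x $ i)) - r k - y k))" "\<And>k. v k = N_adj k (d k)"
    by blast+
  have a: "(x $ i, z i - (C i x + (\<Sum>k\<in>UNIV. L_adj k i (N_adj k (d k))))) \<in> gra (A i)" for i
  proof -
    obtain u where "u \<in> A i (x $ i)" "z i - (\<Sum>k\<in>UNIV. L_adj k i (v k)) = u + C i x"
      using xA[of i] by (auto elim!: set_plus_elim)
    moreover from this(2) have "u = z i - (C i x + (\<Sum>k\<in>UNIV. L_adj k i (v k)))"
      by (simp add: algebra_simps)
    ultimately show ?thesis by (simp add: gra_def y(5)[symmetric])
  qed
  have b: "N_adj k (d k) = M_adj k (e k)" for k using y(3,5)[of k] by simp
  have c: "(N k ((\<Sum>i\<in>UNIV. L k i (x $ i)) - r k - y k), d k) \<in> gra (D k)" for k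
    using y(4) by (simp add: gra_def)
  have d: "(M k (y k), e k) \<in> gra (B k)" for k
    using y(2) by (simp add: gra_def)
  have "(((x, \<chi> k. y k), (\<chi> k. d k, \<chi> k. e k)),
      - Q ((x, \<chi> k. y k), (\<chi> k. d k, \<chi> k. e k))) \<in> R"
    unfolding zero_iff vec_lambda_beta N_linear(1)[of "\<lambda>i. x $ i", OF x y(1)]
    by (intro conjI allI a y(1) b c d)
  then show ?thesis by (rule exI)
qed

lemma mem_R:
  "(w, u) \<in> R \<longleftrightarrow>
    (\<forall>i. (fst (fst w) $ i, fst (fst u) $ i + z i) \<in> gra (A i)) \<and>
    (\<forall>k. snd (fst w) $ k \<in> G k \<and> snd (fst u) $ k = 0) \<and>
    (\<forall>k. (fst (snd u) $ k - N k (r k), fst (snd w) $ k) \<in> gra (D k)) \<and>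
    (\<forall>k. (snd (snd u) $ k, snd (snd w) $ k) \<in> gra (B k))"
  by (simp add: R_def case_prod_unfold)

text \<open>The total gap is the sum of nonnegative block gaps, since the \<open>G\<close>-block
  contributes 0. Hence each block gap is dominated by the total and vanishes with it.\<close>

lemma R_gap:
  assumes "(w, u) \<in> R" "(w', u') \<in> R"
  defines "gA \<equiv> \<lambda>i. (fst (fst w) $ i - fst (fst w') $ i) \<bullet> (fst (fst u) $ i - fst (fst u') $ i)"
    and "gD \<equiv> \<lambda>k. (fst (snd w) $ k - fst (snd w') $ k) \<bullet> (fst (snd u) $ k - fst (snd u') $ k)"
    and "gB \<equiv> \<lambda>k. (snd (snd w) $ k - snd (snd w') $ k) \<bullet> (snd (snd u) $ k - snd (snd u') $ k)"
  shows "0 \<le> gA i" "gA i \<le> (w - w') \<bullet> (u - u')"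
    "0 \<le> gD k" "gD k \<le> (w - w') \<bullet> (u - u')"
    "0 \<le> gB k" "gB k \<le> (w - w') \<bullet> (u - u')"
proof -
  note R = assms(1,2)[unfolded mem_R]
  have pos: "0 \<le> gA i" "0 \<le> gD k" "0 \<le> gB k" for i k
  proof -
    have "(fst (fst w) $ i, fst (fst u) $ i + z i) \<in> gra (A i)"
      "(fst (fst w') $ i, fst (fst u') $ i + z i) \<in> gra (A i)" using R by blast+
    from resolvable_onD(3)[OF A_resolvable this] show "0 \<le> gA i" by (simp add: gA_def)
    have "(fst (snd u) $ k - N k (r k), fst (snd w) $ k) \<in> gra (D k)"
      "(fst (snd u') $ k - N k (r k), fst (snd w') $ k) \<in> gra (D k)" using R by blast+
    from resolvable_onD(3)[OF D_resolvable this] show "0 \<le> gD k"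
      by (simp add: gD_def inner_commute)
    have "(snd (snd u) $ k, snd (snd w) $ k) \<in> gra (B k)"
      "(snd (snd u') $ k, snd (snd w') $ k) \<in> gra (B k)" using R by blast+
    from resolvable_onD(3)[OF B_resolvable this] show "0 \<le> gB k"
      by (simp add: gB_def inner_commute)
  qed
  have "snd (fst u) = 0" "snd (fst u') = 0"
    using R by (simp_all add: vec_eq_iff)
  then have total: "(w - w') \<bullet> (u - u') = sum gA UNIV + (sum gD UNIV + sum gB UNIV)"
    by (simp add: inner_prod_def inner_vec_def gA_def gD_def gB_def)
  have sums: "gA i \<le> sum gA UNIV" "gD k \<le> sum gD UNIV" "gB k \<le> sum gB UNIV"
    "0 \<le> sum gA UNIV" "0 \<le> sum gD UNIV" "0 \<le> sum gB UNIV" for i k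
    by (auto intro!: member_le_sum sum_nonneg pos)
  show "0 \<le> gA i" "gA i \<le> (w - w') \<bullet> (u - u')"
    "0 \<le> gD k" "gD k \<le> (w - w') \<bullet> (u - u')"
    "0 \<le> gB k" "gB k \<le> (w - w') \<bullet> (u - u')"
    unfolding total
    using pos(1)[of i] pos(2,3)[of k] sums(1)[of i] sums(2,3)[of k] sums(4-6) by linarith+
qed

text \<open>Test vectors with a single nonzero component reduce the claim to weak convergence in the
  product.\<close>

lemma weakly_converges_components:
  assumes "weakly_converges_in K W w"
  shows "weakly_converges_in (H i) (\<lambda>n. fst (fst (W n)) $ i) (fst (fst w) $ i)"
    "weakly_converges_in (X k) (\<lambda>n. fst (snd (W n)) $ k) (fst (snd w) $ k)"
    "weakly_converges_in (Y k) (\<lambda>n. snd (snd (W n)) $ k) (snd (snd w) $ k)"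
proof -
  have w: "w \<in> K" and lim: "\<And>u. u \<in> K \<Longrightarrow> (\<lambda>n. W n \<bullet> u) \<longlonglongrightarrow> w \<bullet> u"
    using assms by (auto simp: weakly_converges_in_def)
  have zero: "0 \<in> H i" "0 \<in> G k" "0 \<in> X k" "0 \<in> Y k" for i k
    using H G X Y by (auto simp: subspace_0)
  have "(\<lambda>n. fst (fst (W n)) $ i \<bullet> u) \<longlonglongrightarrow> fst (fst w) $ i \<bullet> u" if "u \<in> H i" for u
  proof -
    have "((axis i u, 0), (0, 0)) \<in> K"
      unfolding mem_K using that zero by (auto simp: axis_def)
    from lim[OF this] show ?thesis by (simp add: inner_prod_def inner_axis)
  qed
  moreover have "(\<lambda>n. fst (snd (W n)) $ k \<bullet> u) \<longlonglongrightarrow> fst (snd w) $ k \<bullet> u" if "u \<in> X k" for u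
  proof -
    have "((0, 0), (axis k u, 0)) \<in> K"
      unfolding mem_K using that zero by (auto simp: axis_def)
    from lim[OF this] show ?thesis by (simp add: inner_prod_def inner_axis)
  qed
  moreover have "(\<lambda>n. snd (snd (W n)) $ k \<bullet> u) \<longlonglongrightarrow> snd (snd w) $ k \<bullet> u" if "u \<in> Y k" for u
  proof -
    have "((0, 0), (0, axis k u)) \<in> K"
      unfolding mem_K using that zero by (auto simp: axis_def)
    from lim[OF this] show ?thesis by (simp add: inner_prod_def inner_axis)
  qed
  moreover have "fst (fst w) $ i \<in> H i" "fst (snd w) $ k \<in> X k" "snd (snd w) $ k \<in> Y k"
    using w by (auto simp: K_def prod_space_def)
  ultimately show "weakly_converges_in (H i) (\<lambda>n. fst (fst (W n)) $ i) (fst (fst w) $ i)"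
    "weakly_converges_in (X k) (\<lambda>n. fst (snd (W n)) $ k) (fst (snd w) $ k)"
    "weakly_converges_in (Y k) (\<lambda>n. snd (snd (W n)) $ k) (snd (snd w) $ k)"
    by (auto simp: weakly_converges_in_def)
qed

end

section \<open>The algorithm as an instance of Tseng's iteration\<close>

theorem theorem2p1:
  fixes H :: "'m::finite \<Rightarrow> 'h::{real_inner, complete_space} set"
    and G :: "'s::finite \<Rightarrow> 'g::{real_inner, complete_space} set"
    and Y :: "'s \<Rightarrow> 'y::{real_inner, complete_space} set"
    and X :: "'s \<Rightarrow> 'x::{real_inner, complete_space} set"
    and z :: "'m \<Rightarrow> 'h"
    and A :: "'m \<Rightarrow> 'h \<Rightarrow> 'h set"
    and C :: "'m \<Rightarrow> 'h ^ 'm \<Rightarrow> 'h"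
    and r :: "'s \<Rightarrow> 'g"
    and B :: "'s \<Rightarrow> 'y \<Rightarrow> 'y set"
    and D :: "'s \<Rightarrow> 'x \<Rightarrow> 'x set"
    and M :: "'s \<Rightarrow> 'g \<Rightarrow> 'y"
    and N :: "'s \<Rightarrow> 'g \<Rightarrow> 'x"
    and L :: "'s \<Rightarrow> 'm \<Rightarrow> 'h \<Rightarrow> 'g"
    and \<nu>\<^sub>0 \<beta> \<epsilon> :: real
    and \<gamma> :: "nat \<Rightarrow> real"
    and a11 b11 c11 :: "'m \<Rightarrow> nat \<Rightarrow> 'h"
    and a12 c12 :: "'s \<Rightarrow> nat \<Rightarrow> 'g"
    and a21 b21 c21 :: "'s \<Rightarrow> nat \<Rightarrow> 'x"
    and a22 b22 c22 :: "'s \<Rightarrow> nat \<Rightarrow> 'y"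
    and x1 s11 p11 q11 :: "nat \<Rightarrow> 'h ^ 'm"
    and x2 p12 q12 :: "nat \<Rightarrow> 's \<Rightarrow> 'g"
    and v1 s21 p21 q21 :: "nat \<Rightarrow> 's \<Rightarrow> 'x"
    and v2 s22 p22 q22 :: "nat \<Rightarrow> 's \<Rightarrow> 'y"
  assumes H: "\<And>i. subspace (H i)" "\<And>i. closed (H i)"
    and G: "\<And>k. subspace (G k)" "\<And>k. closed (G k)"
    and Y: "\<And>k. subspace (Y k)" "\<And>k. closed (Y k)"
    and X: "\<And>k. subspace (X k)" "\<And>k. closed (X k)"
    and z: "\<And>i. z i \<in> H i"
    and A: "\<And>i. maximally_monotone_on (H i) (A i)"
    and C: "\<And>i x. x \<in> prod_space H \<Longrightarrow> C i x \<in> H i"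
    and \<nu>\<^sub>0: "\<nu>\<^sub>0 \<ge> 0"
    and C_lipschitz: "\<And>x y. x \<in> prod_space H \<Longrightarrow> y \<in> prod_space H \<Longrightarrow>
          (\<Sum>i\<in>UNIV. (norm (C i x - C i y))\<^sup>2) \<le> \<nu>\<^sub>0\<^sup>2 * (\<Sum>i\<in>UNIV. (norm (x $ i - y $ i))\<^sup>2)"
    and C_monotone: "\<And>x y. x \<in> prod_space H \<Longrightarrow> y \<in> prod_space H \<Longrightarrow>
          (\<Sum>i\<in>UNIV. (C i x - C i y) \<bullet> (x $ i - y $ i)) \<ge> 0"
    and r: "\<And>k. r k \<in> G k"
    and B: "\<And>k. maximally_monotone_on (Y k) (B k)"
    and D: "\<And>k. maximally_monotone_on (X k) (D k)"
    and M: "\<And>k. bounded_linear_on (G k) (Y k) (M k)"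
    and N: "\<And>k. bounded_linear_on (G k) (X k) (N k)"
    and L: "\<And>k i. bounded_linear_on (H i) (G k) (L k i)"
    and solvable: "solutions H G z A C r B D M N L \<noteq> {}"
    and \<beta>_def: "\<beta> = \<nu>\<^sub>0 + sqrt ((\<Sum>i\<in>UNIV. \<Sum>k\<in>UNIV. (onorm_on (H i) (N k \<circ> L k i))\<^sup>2)
          + (MAX k. (onorm_on (G k) (N k))\<^sup>2 + (onorm_on (G k) (M k))\<^sup>2))"
    and \<beta>_pos: "\<beta> > 0"
    and errors_H: "\<And>i. abs_summable_in (H i) (a11 i)" "\<And>i. abs_summable_in (H i) (b11 i)"
          "\<And>i. abs_summable_in (H i) (c11 i)"
    and errors_G: "\<And>k. abs_summable_in (G k) (a12 k)" "\<And>k. abs_summable_in (G k) (c12 k)"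
    and errors_X: "\<And>k. abs_summable_in (X k) (a21 k)" "\<And>k. abs_summable_in (X k) (b21 k)"
          "\<And>k. abs_summable_in (X k) (c21 k)"
    and errors_Y: "\<And>k. abs_summable_in (Y k) (a22 k)" "\<And>k. abs_summable_in (Y k) (b22 k)"
          "\<And>k. abs_summable_in (Y k) (c22 k)"
    and init: "\<And>i. x1 0 $ i \<in> H i" "\<And>k. x2 0 k \<in> G k" "\<And>k. v1 0 k \<in> X k" "\<And>k. v2 0 k \<in> Y k"
    and \<epsilon>: "\<epsilon> \<in> {0<..<1 / (\<beta> + 1)}"
    and \<gamma>: "\<And>n. \<gamma> n \<in> {\<epsilon>..(1 - \<epsilon>) / \<beta>}"
    and s11: "\<And>n i. s11 n $ i = x1 n $ i - \<gamma> n *\<^sub>R (C i (x1 n)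
          + (\<Sum>k\<in>UNIV. adjoint_on (H i) (L k i) (adjoint_on (G k) (N k) (v1 n k))) + a11 i n)"
    and p11: "\<And>n i. p11 n $ i
          = resolvent (op_scale (\<gamma> n) (A i)) (s11 n $ i + \<gamma> n *\<^sub>R z i) + b11 i n"
    and p12: "\<And>n k. p12 n k = x2 n k + \<gamma> n *\<^sub>R (adjoint_on (G k) (N k) (v1 n k)
          - adjoint_on (G k) (M k) (v2 n k) + a12 k n)"
    and s21: "\<And>n k. s21 n k = v1 n k + \<gamma> n *\<^sub>R ((\<Sum>i\<in>UNIV. N k (L k i (x1 n $ i)))
          - N k (x2 n k) + a21 k n)"
    and p21: "\<And>n k. p21 n k = s21 n k - \<gamma> n *\<^sub>R (N k (r k)
          + resolvent (op_scale (inverse (\<gamma> n)) (D k)) (inverse (\<gamma> n) *\<^sub>R s21 n k - N k (r k))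
          + b21 k n)"
    and q21: "\<And>n k. q21 n k = p21 n k + \<gamma> n *\<^sub>R (N k (\<Sum>i\<in>UNIV. L k i (p11 n $ i))
          - N k (p12 n k) + c21 k n)"
    and v1: "\<And>n k. v1 (Suc n) k = v1 n k - s21 n k + q21 n k"
    and s22: "\<And>n k. s22 n k = v2 n k + \<gamma> n *\<^sub>R (M k (x2 n k) + a22 k n)"
    and p22: "\<And>n k. p22 n k = s22 n k - \<gamma> n *\<^sub>R
          (resolvent (op_scale (inverse (\<gamma> n)) (B k)) (inverse (\<gamma> n) *\<^sub>R s22 n k) + b22 k n)"
    and q22: "\<And>n k. q22 n k = p22 n k + \<gamma> n *\<^sub>R (M k (p12 n k) + c22 k n)"
    and v2: "\<And>n k. v2 (Suc n) k = v2 n k - s22 n k + q22 n k"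
    and q12: "\<And>n k. q12 n k = p12 n k + \<gamma> n *\<^sub>R (adjoint_on (G k) (N k) (p21 n k)
          - adjoint_on (G k) (M k) (p22 n k) + c12 k n)"
    and x2: "\<And>n k. x2 (Suc n) k = x2 n k - p12 n k + q12 n k"
    and q11: "\<And>n i. q11 n $ i = p11 n $ i - \<gamma> n *\<^sub>R (C i (p11 n)
          + (\<Sum>k\<in>UNIV. adjoint_on (H i) (L k i) (adjoint_on (G k) (N k) (p21 n k))) + c11 i n)"
    and x1: "\<And>n i. x1 (Suc n) $ i = x1 n $ i - s11 n $ i + q11 n $ i"
  shows "(\<forall>i. summable (\<lambda>n. (norm (x1 n $ i - p11 n $ i))\<^sup>2)) \<and>
    (\<forall>k. summable (\<lambda>n. (norm (x2 n k - p12 n k))\<^sup>2)) \<and>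
    (\<forall>k. summable (\<lambda>n. (norm (v1 n k - p21 n k))\<^sup>2)) \<and>
    (\<forall>k. summable (\<lambda>n. (norm (v2 n k - p22 n k))\<^sup>2)) \<and>
    (\<exists>(xbar1 :: 'h ^ 'm) (vbar1 :: 's \<Rightarrow> 'x) (vbar2 :: 's \<Rightarrow> 'y).
      (\<forall>i. weakly_converges_in (H i) (\<lambda>n. x1 n $ i) (xbar1 $ i)) \<and>
      (\<forall>k. weakly_converges_in (X k) (\<lambda>n. v1 n k) (vbar1 k)) \<and>
      (\<forall>k. weakly_converges_in (Y k) (\<lambda>n. v2 n k) (vbar2 k)) \<and>
      (\<forall>k. adjoint_on (G k) (M k) (vbar2 k) = adjoint_on (G k) (N k) (vbar1 k)) \<and>
      (xbar1, \<lambda>k. adjoint_on (G k) (N k) (vbar1 k)) \<in> solutions H G z A C r B D M N L \<and>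
      (\<forall>j. uniformly_monotone_at (A j) (xbar1 $ j) \<longrightarrow> (\<lambda>n. x1 n $ j) \<longlonglongrightarrow> xbar1 $ j) \<and>
      (uniformly_monotone_at (single_valued_op (prod_space H) (\<lambda>x. \<chi> j. C j x)) xbar1 \<longrightarrow>
        (\<forall>i. (\<lambda>n. x1 n $ i) \<longlonglongrightarrow> xbar1 $ i)) \<and>
      (\<forall>j \<phi>. uniform_modulus \<phi> \<and>
          (\<forall>x \<in> prod_space H.
            ereal (\<Sum>i\<in>UNIV. (C i x - C i xbar1) \<bullet> (x $ i - xbar1 $ i))
              \<ge> \<phi> (norm (x $ j - xbar1 $ j))) \<longrightarrow>
        (\<lambda>n. x1 n $ j) \<longlonglongrightarrow> xbar1 $ j) \<and>
      (\<forall>j. uniformly_monotone_at (op_inv (D j)) (vbar1 j) \<longrightarrow> (\<lambda>n. v1 n j) \<longlonglongrightarrow> vbar1 j) \<and>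
      (\<forall>j. uniformly_monotone_at (op_inv (B j)) (vbar2 j) \<longrightarrow> (\<lambda>n. v2 n j) \<longlonglongrightarrow> vbar2 j))"
proof -
  interpret S: structured_system H G Y X z A C r B D M N L \<nu>\<^sub>0 \<beta>
    by unfold_locales (fact H G Y X z A C \<nu>\<^sub>0 C_lipschitz C_monotone r B D M N L \<beta>_def)+
  define xs where "xs n = ((x1 n, \<chi> k. x2 n k), (\<chi> k. v1 n k, \<chi> k. v2 n k))" for n
  \<comment> \<open>The zero operator on \<open>G k\<close> has the identity as resolvent, so
    \<open>p12\<close> fills this block of \<open>ss\<close>, of \<open>ys\<close> and of
    \<open>ps\<close>.\<close>
  define ss where "ss n = ((s11 n, \<chi> k. p12 n k), (\<chi> k. s21 n k, \<chi> k. s22 n k))" for n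
  define ps where "ps n = ((p11 n, \<chi> k. p12 n k), (\<chi> k. p21 n k, \<chi> k. p22 n k))" for n
  define qs where "qs n = ((q11 n, \<chi> k. q12 n k), (\<chi> k. q21 n k, \<chi> k. q22 n k))" for n
  \<comment> \<open>Three blocks of the algorithm add \<gamma> times an expression, whereas the
    scheme subtracts \<gamma> (Q + a); this accounts for the signs.\<close>
  define as where "as n = ((\<chi> i. a11 i n, \<chi> k. - a12 k n), (\<chi> k. - a21 k n, \<chi> k. - a22 k n))" for n
  \<comment> \<open>In the dual blocks the resolvent error is subtracted inside the factor \<gamma>;
    it stays summable because \<gamma> \<le> 1/\<beta>.\<close>
  define bs where "bs n = ((\<chi> i. b11 i n, (\<chi> k. 0) :: 'g ^ 's),
    (\<chi> k. - (\<gamma> n *\<^sub>R b21 k n), \<chi> k. - (\<gamma> n *\<^sub>R b22 k n)))" for n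
  define cs where "cs n = ((\<chi> i. c11 i n, \<chi> k. - c12 k n), (\<chi> k. - c21 k n, \<chi> k. - c22 k n))" for n
  \<comment> \<open>Adding the errors back to \<open>p21\<close> and \<open>p22\<close> recovers the
    error-free resolvent points.\<close>
  define ys where "ys n =
    ((\<chi> i. resolvent (op_scale (\<gamma> n) (A i)) (s11 n $ i + \<gamma> n *\<^sub>R z i), \<chi> k. p12 n k),
     (\<chi> k. p21 n k + \<gamma> n *\<^sub>R b21 k n, \<chi> k. p22 n k + \<gamma> n *\<^sub>R b22 k n))" for n
  have eps: "0 < \<epsilon>" "\<epsilon> < 1"
  proof -
    show "0 < \<epsilon>" using \<epsilon> by simp
    have "1 / (\<beta> + 1) \<le> 1" using \<beta>_pos by (simp add: divide_simps)
    then show "\<epsilon> < 1" using \<epsilon> by simp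
  qed
  have gamma_pos: "0 < \<gamma> n" for n
    using \<gamma>[of n] eps by simp
  have gamma_le: "\<gamma> n \<le> 1 / \<beta>" for n
  proof -
    have "(1 - \<epsilon>) / \<beta> \<le> 1 / \<beta>" using eps \<beta>_pos by (intro divide_right_mono) auto
    then show ?thesis using \<gamma>[of n] by simp
  qed
  have scaled_summable: "summable (\<lambda>n. norm (\<gamma> n *\<^sub>R e n))"
    if "summable (\<lambda>n. norm (e n))" for e :: "nat \<Rightarrow> 'e::real_normed_vector"
  proof (rule summable_comparison_test')
    show "summable (\<lambda>n. 1 / \<beta> * norm (e n))"
      by (intro summable_mult that)
    show "norm (norm (\<gamma> n *\<^sub>R e n)) \<le> 1 / \<beta> * norm (e n)" for n
      using gamma_pos[of n] mult_right_mono[OF gamma_le[of n] norm_ge_zero[of "e n"]] by simp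
  qed
  note err_mem = errors_H[unfolded abs_summable_in_def] errors_G[unfolded abs_summable_in_def]
    errors_X[unfolded abs_summable_in_def] errors_Y[unfolded abs_summable_in_def]
  interpret P: perturbed_tseng S.K S.R S.Q \<beta> \<epsilon> \<gamma> as bs cs xs ss ys ps qs
  proof
    show "subspace S.K" "closed S.K" by (fact S.K)+
    show "resolvable_on S.K S.R" by (fact S.R_resolvable)
    show "S.Q w \<in> S.K" if "w \<in> S.K" for w using that by (rule S.Q_in_K)
    show "norm (S.Q w - S.Q w') \<le> \<beta> * norm (w - w')" if "w \<in> S.K" "w' \<in> S.K" for w w'
      using that by (rule S.Q_lipschitz)
    show "0 \<le> (w - w') \<bullet> (S.Q w - S.Q w')" if "w \<in> S.K" "w' \<in> S.K" for w w'
      using that by (rule S.Q_monotone)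
    show "0 < \<beta>" by (fact \<beta>_pos)
    show "0 < \<epsilon>" "\<epsilon> < 1" by (fact eps)+
    show "\<gamma> n \<in> {\<epsilon>..(1 - \<epsilon>) / \<beta>}" for n by (fact \<gamma>)
    show "as n \<in> S.K" "bs n \<in> S.K" "cs n \<in> S.K" for n
      unfolding as_def bs_def cs_def S.mem_K using err_mem H G X Y
      by (simp_all add: subspace_neg subspace_scale subspace_0)
    show "summable (\<lambda>n. norm (as n))" "summable (\<lambda>n. norm (cs n))"
      unfolding as_def cs_def using err_mem by (auto intro!: summable_norm_quadruple)
    show "summable (\<lambda>n. norm (bs n))"
      unfolding bs_def using err_mem
      by (auto intro!: summable_norm_quadruple scaled_summable simp del: norm_scaleR)
    show "xs 0 \<in> S.K"
      unfolding xs_def S.mem_K using init by simp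
    show "ss n = xs n - \<gamma> n *\<^sub>R (S.Q (xs n) + as n)" for n
      unfolding ss_def xs_def as_def S.Q_def S.F_def S.T_def S.T_adj_def
      by (simp add: prod_eq_iff vec_eq_iff s11 p12 s21 s22) (simp add: algebra_simps)
    show "ps n = ys n + bs n" for n
      unfolding ps_def ys_def bs_def by (simp add: prod_eq_iff vec_eq_iff p11)
    show "xs (Suc n) = xs n - ss n + qs n" for n
      unfolding xs_def ss_def qs_def by (simp add: prod_eq_iff vec_eq_iff x1 x2 v1 v2)
    show "qs n = ps n - \<gamma> n *\<^sub>R (S.Q (ps n) + cs n)" if "ps n \<in> S.K" for n
    proof -
      have "p11 n $ i \<in> H i" for i using that by (simp add: ps_def S.mem_K)
      then have "N k (\<Sum>i\<in>UNIV. L k i (p11 n $ i)) = (\<Sum>i\<in>UNIV. N k (L k i (p11 n $ i)))" for k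
        using S.N_linear(2)[of "\<lambda>i. p11 n $ i" 0 k] G by (simp add: subspace_0)
      then show ?thesis
        unfolding qs_def ps_def cs_def S.Q_def S.F_def S.T_def S.T_adj_def
        by (simp add: prod_eq_iff vec_eq_iff q11 q12 q21 q22) (simp add: algebra_simps)
    qed
    show "(ys n, (1 / \<gamma> n) *\<^sub>R (ss n - ys n)) \<in> S.R" if ss: "ss n \<in> S.K" for n
    proof -
      have mem: "s11 n $ i \<in> H i" "p12 n k \<in> G k" "s21 n k \<in> X k" "s22 n k \<in> Y k" for i k
        using ss by (simp_all add: ss_def S.mem_K)
      have "(J, (1 / \<gamma> n) *\<^sub>R (s11 n $ i - J) + z i) \<in> gra (A i)"
        if J: "J = resolvent (op_scale (\<gamma> n) (A i)) (s11 n $ i + \<gamma> n *\<^sub>R z i)" for i J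
      proof -
        have "s11 n $ i + \<gamma> n *\<^sub>R z i \<in> H i"
          using mem(1) z H by (intro subspace_add subspace_scale) auto
        from resolvent_in_gra[OF S.A_resolvable gamma_pos[of n] this]
        have "(J, (1 / \<gamma> n) *\<^sub>R (s11 n $ i + \<gamma> n *\<^sub>R z i - J)) \<in> gra (A i)"
          by (simp add: J)
        moreover have "(1 / \<gamma> n) *\<^sub>R (s11 n $ i + \<gamma> n *\<^sub>R z i - J)
            = (1 / \<gamma> n) *\<^sub>R (s11 n $ i - J) + z i"
          using gamma_pos[of n] by (simp add: scaleR_diff_right scaleR_add_right)
        ultimately show ?thesis by simp
      qed
      moreover have "((1 / \<gamma> n) *\<^sub>R (s21 n k - (p21 n k + \<gamma> n *\<^sub>R b21 k n)) - N k (r k),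
          p21 n k + \<gamma> n *\<^sub>R b21 k n) \<in> gra (D k)" for k
      proof -
        \<comment> \<open>Moreau's decomposition in action:
          \<open>s21 n k - \<gamma> n (N k (r k) + J)\<close> is the resolvent point of the
          translated inverse of \<open>D k\<close>, and \<open>J\<close> paired with it lies in the
          graph of \<open>D k\<close>.\<close>
        define J where "J = resolvent (op_scale (inverse (\<gamma> n)) (D k)) (inverse (\<gamma> n) *\<^sub>R s21 n k - N k (r k))"
        have "inverse (\<gamma> n) *\<^sub>R s21 n k - N k (r k) \<in> X k"
          using mem(3) S.N_r X by (intro subspace_diff subspace_scale) auto
        from resolvent_in_gra[OF S.D_resolvable _ this, of "inverse (\<gamma> n)"] gamma_pos[of n]
        have "(J, (1 / inverse (\<gamma> n)) *\<^sub>R (inverse (\<gamma> n) *\<^sub>R s21 n k - N k (r k) - J)) \<in> gra (D k)"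
          by (simp add: J_def)
        moreover have y: "p21 n k + \<gamma> n *\<^sub>R b21 k n = s21 n k - \<gamma> n *\<^sub>R (N k (r k) + J)"
          unfolding p21 J_def by (simp add: scaleR_add_right)
        have "(1 / inverse (\<gamma> n)) *\<^sub>R (inverse (\<gamma> n) *\<^sub>R s21 n k - N k (r k) - J)
            = s21 n k - \<gamma> n *\<^sub>R (N k (r k) + J)"
          using gamma_pos[of n] by (simp add: inverse_eq_divide scaleR_diff_right scaleR_add_right)
        moreover have "(1 / \<gamma> n) *\<^sub>R (s21 n k - (s21 n k - \<gamma> n *\<^sub>R (N k (r k) + J))) - N k (r k) = J"
          using gamma_pos[of n] by simp
        ultimately show ?thesis unfolding y by simp
      qed
      moreover have "((1 / \<gamma> n) *\<^sub>R (s22 n k - (p22 n k + \<gamma> n *\<^sub>R b22 k n)),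
          p22 n k + \<gamma> n *\<^sub>R b22 k n) \<in> gra (B k)" for k
      proof -
        define J where "J = resolvent (op_scale (inverse (\<gamma> n)) (B k)) (inverse (\<gamma> n) *\<^sub>R s22 n k)"
        have "inverse (\<gamma> n) *\<^sub>R s22 n k \<in> Y k"
          using mem(4) Y by (intro subspace_scale) auto
        from resolvent_in_gra[OF S.B_resolvable _ this, of "inverse (\<gamma> n)"] gamma_pos[of n]
        have "(J, (1 / inverse (\<gamma> n)) *\<^sub>R (inverse (\<gamma> n) *\<^sub>R s22 n k - J)) \<in> gra (B k)"
          by (simp add: J_def)
        moreover have y: "p22 n k + \<gamma> n *\<^sub>R b22 k n = s22 n k - \<gamma> n *\<^sub>R J"
          unfolding p22 J_def by (simp add: scaleR_add_right)
        have "(1 / inverse (\<gamma> n)) *\<^sub>R (inverse (\<gamma> n) *\<^sub>R s22 n k - J) = s22 n k - \<gamma> n *\<^sub>R J"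
          using gamma_pos[of n] by (simp add: inverse_eq_divide scaleR_diff_right)
        moreover have "(1 / \<gamma> n) *\<^sub>R (s22 n k - (s22 n k - \<gamma> n *\<^sub>R J)) = J"
          using gamma_pos[of n] by simp
        ultimately show ?thesis unfolding y by simp
      qed
      ultimately show ?thesis
        unfolding S.mem_R ys_def ss_def using mem(2) by simp
    qed
    show "\<exists>w. (w, - S.Q w) \<in> S.R"
      by (rule S.solution_imp_zero[OF solvable])
  qed

  obtain w where w: "weakly_converges_in S.K xs w" "(w, - S.Q w) \<in> S.R"
    and dual_gap: "(\<lambda>n. (P.prox n - w) \<bullet> (P.dual n + S.Q w)) \<longlonglongrightarrow> 0"
    and Q_gap: "(\<lambda>n. (P.prox n - w) \<bullet> (S.Q (P.prox n) - S.Q w)) \<longlonglongrightarrow> 0"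
    by (rule P.weak_convergence)
  obtain xb x2b v1b v2b where w_eq: "w = ((xb, x2b), (v1b, v2b))"
    by (metis surj_pair)
  have wK: "w \<in> S.K" using w(1) by (simp add: weakly_converges_in_def)
  note dual_mem = P.prox_dual[unfolded S.mem_R] and w_mem = w(2)[unfolded S.mem_R]
  note gap = S.R_gap[OF P.prox_dual w(2)]

  \<comment> \<open>The gaps live at the exact points \<open>P.prox n\<close>; as these differ from
    the iterates by a null sequence, strong limits of single components transfer.\<close>
  have component_limit: "X' \<longlonglongrightarrow> l"
    if "Y' \<longlonglongrightarrow> l" "\<And>n. norm (X' n - Y' n) \<le> norm (xs n - P.prox n)"
    for X' Y' :: "nat \<Rightarrow> 'e::real_normed_vector" and l
  proof -
    have "(\<lambda>n. X' n - Y' n) \<longlonglongrightarrow> 0"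
      by (rule Lim_null_comparison[OF always_eventually P.norm_x_prox]) (use that(2) in simp)
    from tendsto_add[OF this that(1)] show ?thesis by simp
  qed
  have x1_limit: "(\<lambda>n. x1 n $ j) \<longlonglongrightarrow> xb $ j" if "(\<lambda>n. fst (fst (P.prox n)) $ j) \<longlonglongrightarrow> xb $ j" for j
    using that norm_component_le(1)[of "xs _ - P.prox _" j]
    by (intro component_limit[OF that]) (simp add: xs_def)
  have v1_limit: "(\<lambda>n. v1 n j) \<longlonglongrightarrow> v1b $ j" if "(\<lambda>n. fst (snd (P.prox n)) $ j) \<longlonglongrightarrow> v1b $ j" for j
    using that norm_component_le(3)[of "xs _ - P.prox _" j]
    by (intro component_limit[OF that]) (simp add: xs_def)
  have v2_limit: "(\<lambda>n. v2 n j) \<longlonglongrightarrow> v2b $ j" if "(\<lambda>n. snd (snd (P.prox n)) $ j) \<longlonglongrightarrow> v2b $ j" for j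
    using that norm_component_le(4)[of "xs _ - P.prox _" j]
    by (intro component_limit[OF that]) (simp add: xs_def)

  have component_summable: "summable (\<lambda>n. (norm (f n))\<^sup>2)"
    if "\<And>n. norm (f n) \<le> norm (xs n - ps n)" for f :: "nat \<Rightarrow> 'e::real_normed_vector"
  proof (rule summable_comparison_test'[OF P.summable_p])
    show "norm ((norm (f n))\<^sup>2) \<le> (norm (xs n - ps n))\<^sup>2" for n
      using power_mono[OF that[of n] norm_ge_zero, of 2] by simp
  qed
  have "summable (\<lambda>n. (norm (x1 n $ i - p11 n $ i))\<^sup>2)" for i
    using norm_component_le(1)[of "xs _ - ps _" i]
    by (intro component_summable) (simp add: xs_def ps_def)
  moreover have "summable (\<lambda>n. (norm (x2 n k - p12 n k))\<^sup>2)" for k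
    using norm_component_le(2)[of "xs _ - ps _" k]
    by (intro component_summable) (simp add: xs_def ps_def)
  moreover have "summable (\<lambda>n. (norm (v1 n k - p21 n k))\<^sup>2)" for k
    using norm_component_le(3)[of "xs _ - ps _" k]
    by (intro component_summable) (simp add: xs_def ps_def)
  moreover have "summable (\<lambda>n. (norm (v2 n k - p22 n k))\<^sup>2)" for k
    using norm_component_le(4)[of "xs _ - ps _" k]
    by (intro component_summable) (simp add: xs_def ps_def)
  moreover have "weakly_converges_in (H i) (\<lambda>n. x1 n $ i) (xb $ i)" for i
    using S.weakly_converges_components(1)[OF w(1), of i] by (simp add: xs_def w_eq)
  moreover have "weakly_converges_in (X k) (\<lambda>n. v1 n k) (v1b $ k)" for k
    using S.weakly_converges_components(2)[OF w(1), of k] by (simp add: xs_def w_eq)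
  moreover have "weakly_converges_in (Y k) (\<lambda>n. v2 n k) (v2b $ k)" for k
    using S.weakly_converges_components(3)[OF w(1), of k] by (simp add: xs_def w_eq)
  moreover have "adjoint_on (G k) (M k) (v2b $ k) = adjoint_on (G k) (N k) (v1b $ k)" for k
    using w(2)[unfolded w_eq S.zero_iff] by metis
  moreover have "(xb, \<lambda>k. adjoint_on (G k) (N k) (v1b $ k)) \<in> solutions H G z A C r B D M N L"
    using S.zero_imp_solution[OF w(2)[unfolded w_eq]] .
  moreover have "(\<lambda>n. x1 n $ j) \<longlonglongrightarrow> xb $ j" if "uniformly_monotone_at (A j) (xb $ j)" for j
  proof (rule x1_limit, rule uniformly_monotone_tendsto[OF that])
    show "(xb $ j, fst (fst (- S.Q w)) $ j + z j) \<in> gra (A j)"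
      using w_mem by (simp add: w_eq)
    show "(fst (fst (P.prox n)) $ j, fst (fst (P.dual n)) $ j + z j) \<in> gra (A j)" for n
      using dual_mem by blast
    \<comment> \<open>The dual element at \<open>w\<close> is \<open>- S.Q w\<close>, the shifts by
      \<open>z j\<close> cancel, and the block gap is squeezed between 0 and
      \<open>dual_gap\<close>.\<close>
    show "(\<lambda>n. (fst (fst (P.prox n)) $ j - xb $ j)
        \<bullet> (fst (fst (P.dual n)) $ j + z j - (fst (fst (- S.Q w)) $ j + z j))) \<longlonglongrightarrow> 0"
      by (rule tendsto_sandwich[OF _ _ tendsto_const dual_gap])
        (use gap(1,2)[where i = j] in \<open>auto simp: w_eq\<close>)
  qed
  moreover have "(\<lambda>n. x1 n $ i) \<longlonglongrightarrow> xb $ i"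
    if "uniformly_monotone_at (single_valued_op (prod_space H) (\<lambda>x. \<chi> j. C j x)) xb" for i
  proof -
    have "(\<lambda>n. fst (fst (P.prox n))) \<longlonglongrightarrow> xb"
    proof (rule uniformly_monotone_tendsto[OF that])
      have "xb \<in> prod_space H" using wK by (simp add: w_eq S.K_def)
      then show "(xb, \<chi> j. C j xb) \<in> gra (single_valued_op (prod_space H) (\<lambda>x. \<chi> j. C j x))"
        by (simp add: gra_def single_valued_op_def)
      have "fst (fst (P.prox n)) \<in> prod_space H" for n
        using P.prox_in_K[of n] by (auto simp: S.K_def)
      then show "(fst (fst (P.prox n)), \<chi> j. C j (fst (fst (P.prox n))))
          \<in> gra (single_valued_op (prod_space H) (\<lambda>x. \<chi> j. C j x))" for n
        by (simp add: gra_def single_valued_op_def)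
      \<comment> \<open>By skewness \<open>Q_gap\<close> is exactly the monotonicity gap of the
        operator formed by the \<open>C j\<close>.\<close>
      show "(\<lambda>n. (fst (fst (P.prox n)) - xb)
          \<bullet> ((\<chi> j. C j (fst (fst (P.prox n)))) - (\<chi> j. C j xb))) \<longlonglongrightarrow> 0"
        using Q_gap unfolding S.Q_inner[OF P.prox_in_K wK]
        by (simp add: w_eq inner_vec_def inner_commute)
    qed
    from x1_limit[OF tendsto_vec_nth[OF this]] show ?thesis .
  qed
  moreover have "(\<lambda>n. x1 n $ j) \<longlonglongrightarrow> xb $ j"
    if "uniform_modulus \<phi> \<and> (\<forall>x \<in> prod_space H.
      ereal (\<Sum>i\<in>UNIV. (C i x - C i xb) \<bullet> (x $ i - xb $ i)) \<ge> \<phi> (norm (x $ j - xb $ j)))" for j \<phi>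
  proof (rule x1_limit, rule modulus_tendsto[OF conjunct1[OF that] Q_gap])
    show "\<phi> (norm (fst (fst (P.prox n)) $ j - xb $ j))
        \<le> ereal ((P.prox n - w) \<bullet> (S.Q (P.prox n) - S.Q w))" for n
    proof -
      have "fst (fst (P.prox n)) \<in> prod_space H"
        using P.prox_in_K[of n] by (auto simp: S.K_def)
      with that show ?thesis
        unfolding S.Q_inner[OF P.prox_in_K wK] by (simp add: w_eq)
    qed
  qed
  moreover have "(\<lambda>n. v1 n j) \<longlonglongrightarrow> v1b $ j" if "uniformly_monotone_at (op_inv (D j)) (v1b $ j)" for j
  proof (rule v1_limit, rule uniformly_monotone_tendsto[OF that])
    \<comment> \<open>The dual variable is the argument of the inverse of \<open>D j\<close>; the
      translation by \<open>N j (r j)\<close> drops out of the gap.\<close>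
    have inv: "(v, u) \<in> gra (op_inv (D j)) \<longleftrightarrow> (u, v) \<in> gra (D j)" for u v
      by (simp add: gra_def op_inv_def)
    show "(v1b $ j, fst (snd (- S.Q w)) $ j - N j (r j)) \<in> gra (op_inv (D j))"
      unfolding inv using w_mem by (simp add: w_eq)
    show "(fst (snd (P.prox n)) $ j, fst (snd (P.dual n)) $ j - N j (r j)) \<in> gra (op_inv (D j))" for n
      unfolding inv using dual_mem by blast
    show "(\<lambda>n. (fst (snd (P.prox n)) $ j - v1b $ j)
        \<bullet> (fst (snd (P.dual n)) $ j - N j (r j) - (fst (snd (- S.Q w)) $ j - N j (r j)))) \<longlonglongrightarrow> 0"
      by (rule tendsto_sandwich[OF _ _ tendsto_const dual_gap])
        (use gap(3,4)[where k = j] in \<open>auto simp: w_eq\<close>)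
  qed
  moreover have "(\<lambda>n. v2 n j) \<longlonglongrightarrow> v2b $ j" if "uniformly_monotone_at (op_inv (B j)) (v2b $ j)" for j
  proof (rule v2_limit, rule uniformly_monotone_tendsto[OF that])
    have inv: "(v, u) \<in> gra (op_inv (B j)) \<longleftrightarrow> (u, v) \<in> gra (B j)" for u v
      by (simp add: gra_def op_inv_def)
    show "(v2b $ j, snd (snd (- S.Q w)) $ j) \<in> gra (op_inv (B j))"
      unfolding inv using w_mem by (simp add: w_eq)
    show "(snd (snd (P.prox n)) $ j, snd (snd (P.dual n)) $ j) \<in> gra (op_inv (B j))" for n
      unfolding inv using dual_mem by blast
    show "(\<lambda>n. (snd (snd (P.prox n)) $ j - v2b $ j)
        \<bullet> (snd (snd (P.dual n)) $ j - snd (snd (- S.Q w)) $ j)) \<longlonglongrightarrow> 0"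
      by (rule tendsto_sandwich[OF _ _ tendsto_const dual_gap])
        (use gap(5,6)[where k = j] in \<open>auto simp: w_eq\<close>)
  qed
  ultimately show ?thesis
    by (intro conjI exI[of _ xb] exI[of _ "\<lambda>k. v1b $ k"] exI[of _ "\<lambda>k. v2b $ k"] allI impI)
qed

end
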